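(* Let $X_1,\ldots,X_n$ be connected prime graphs. Assume that the graph $X_1\,\square \cdots\square \,X_n$ is $\mathrm{WL}_6$-closed, and denote by $J_1,\ldots,J_a$ the maximal subsets of indices such that $i,j\in J_k$ for some $1\le k\le a$ if and only if the graphs $X_i$ and $X_j$ are $\mathrm{WL}$-equivalent. Then \[ \mathrm{WL}(X_1\,\square \cdots\square \,X_n)=\mathrm{WL}(X_{J_1})\otimes \cdots\otimes\mathrm{WL}(X_{J_a}), \] where $X_{J_k}$ is the Cartesian product of the graphs $X_j$ with $j\in J_k$, $k=1,\ldots,a$. Moreover, for each $k$, \[ \mathrm{WL}(X_{J_k})\le \{\mathrm{WL}(X_j)\}_{j\in J_k}\uparrow\mathrm{Sym}(n_k), \] where $n_k=|J_k|$.
   Context: Graphs are finite, simple, undirected. For a graph $X=(\Omega,E)$, $\mathrm{WL}(X)$ is the coherent configuration of $X$: the smallest coherent configuration on $\Omega$ having the edge set $E$ as a relation (union of basis relations). For coherent configurations on the same set, $\mathcal X\le\mathcal X'$ means every basis relation of $\mathcal X$ is a union of basis relations of $\mathcal X'$. The Cartesian product $X_1\,\square\cdots\square\,X_n$ of graphs $X_i=(\Omega_i,E_i)$ has vertex set $\Omega_1\times\cdots\times\Omega_n$, two vertices being adjacent iff they differ in exactly one coordinate $i$ and their $i$-th coordinates are adjacent in $X_i$. A graph is prime if whenever it is isomorphic to a Cartesian product of $n$ graphs each with at least two vertices, then $n=1$. The tensor product $\mathcal X_1\otimes\mathcal X_2$ of coherent configurations $(\Omega_1,S_1)$, $(\Omega_2,S_2)$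 is the coherent configuration on $\Omega_1\times\Omega_2$ with basis relations $s_1\otimes s_2=\{((\alpha_1,\alpha_2),(\beta_1,\beta_2)) : (\alpha_1,\beta_1)\in s_1,(\alpha_2,\beta_2)\in s_2\}$, $s_i\in S_i$. Two graphs $X,X'$ are $\mathrm{WL}$-equivalent if there is an algebraic isomorphism $\varphi:\mathrm{WL}(X)\to\mathrm{WL}(X')$ (a bijection between basis relations preserving all intersection numbers) with $\varphi(E(X))=E(X')$. A graph $X$ is $\mathrm{WL}_m$-closed if $\mathrm{WL}(X)=\mathrm{pr}_2\,\mathrm{WL}_m(X)$, i.e. the projection to $\Omega^2$ of the output of the $m$-dimensional Weisfeiler–Leman algorithm on $X$ equals the partition of $\Omega^2$ into basis relations of $\mathrm{WL}(X)$. Exponentiation: given coherent configurations $\mathcal X_1,\ldots,\mathcal X_n$ with algebraic isomorphisms $\varphi_{ij}:\mathcal X_i\to\mathcal X_j$ satisfying $\varphi_{ii}=\mathrm{id}$ and $\varphi_{ij}\varphi_{jk}=\varphi_{ik}$ (here for pairwise WL-equivalent graphs, chosen with $\varphi_{ij}(E_i)=E_j$), and a group $G\le\mathrm{Sym}(n)$, each $g\in G$ gives an algebraic automorphism $\varphi_g$ of $\mathcal X_1\otimes\cdots\otimes\mathcal X_n$ sending $s_1\otimes\cdots\otimes s_n$ to $\varphi_{j_1 1}(s_{j_1})\otimes\cdots\otimes\varphi_{j_n n}(s_{j_n})$ with $j_i=i^{g^{-1}}$; the exponentiation $\{\mathcal X_i\}_{i=1}^n\uparrow G$ is the coherent configuration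 whose basis relations are the unions $\bigcup_{g\in G}(s_1\otimes\cdots\otimes s_n)^{\varphi_g}$. *)

theory Defs
  imports "Graph_Theory.Graph_Theory" "HOL-Library.Disjoint_Sets" "HOL-Library.Multiset"
begin

text \<open>
  Finite simple undirected graphs are the \<open>pair_graph\<close>s of the library: an undirected edge is
  a pair of opposite arcs, so \<open>parcs\<close> is the symmetric irreflexive adjacency relation.
  Direct products of sets are sets \<open>Pi\<^sub>E I V\<close> of extensional functions.
\<close>

subsection \<open>Cartesian products and prime graphs\<close>

definition cart_prod :: "'i set \<Rightarrow> ('i \<Rightarrow> 'a pair_pre_digraph) \<Rightarrow> ('i \<Rightarrow> 'a) pair_pre_digraph" where
  "cart_prod I X = \<lparr>
     pverts = (\<Pi>\<^sub>E i\<in>I. pverts (X i)),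
     parcs = {(x, y). x \<in> (\<Pi>\<^sub>E i\<in>I. pverts (X i)) \<and> y \<in> (\<Pi>\<^sub>E i\<in>I. pverts (X i)) \<and>
                (\<exists>i\<in>I. (x i, y i) \<in> parcs (X i) \<and> (\<forall>j\<in>I - {i}. x j = y j))} \<rparr>"

text \<open>
  The factors are finite, so nothing is lost by taking their vertices to be natural numbers.
  Products of zero graphs are not considered; the one-vertex graph therefore counts as prime.
\<close>
definition prime_graph :: "'a pair_pre_digraph \<Rightarrow> bool" where
  "prime_graph G \<longleftrightarrow>
     (\<forall>n\<ge>1. \<forall>Y :: nat \<Rightarrow> nat pair_pre_digraph.
        (\<forall>i\<in>{1..n}. pair_graph (Y i) \<and> card (pverts (Y i)) \<ge> 2) \<and>
        digraph_iso (with_proj G) (with_proj (cart_prod {1..n} Y)) \<longrightarrow> n = 1)"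

subsection \<open>Coherent configurations\<close>

record 'a config =
  points :: "'a set"
  basis :: "'a rel set"

definition is_relation :: "'a config \<Rightarrow> 'a rel \<Rightarrow> bool" where
  "is_relation C r \<longleftrightarrow> (\<exists>T\<subseteq>basis C. r = \<Union>T)"

definition coherent :: "'a config \<Rightarrow> bool" where
  "coherent C \<longleftrightarrow>
     finite (points C) \<and>
     partition_on (points C \<times> points C) (basis C) \<and>
     is_relation C (Id_on (points C)) \<and>
     (\<forall>s\<in>basis C. s\<inverse> \<in> basis C) \<and>
     (\<forall>r\<in>basis C. \<forall>s\<in>basis C. \<forall>t\<in>basis C. \<exists>k. \<forall>(\<alpha>, \<beta>)\<in>t.
        card {\<gamma> \<in> points C. (\<alpha>, \<gamma>) \<in> r \<and> (\<gamma>, \<beta>) \<in> s} = k)"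

definition inters_num :: "'a config \<Rightarrow> 'a rel \<Rightarrow> 'a rel \<Rightarrow> 'a rel \<Rightarrow> nat" where
  "inters_num C r s t =
     (THE k. \<forall>(\<alpha>, \<beta>)\<in>t. card {\<gamma> \<in> points C. (\<alpha>, \<gamma>) \<in> r \<and> (\<gamma>, \<beta>) \<in> s} = k)"

definition config_le :: "'a config \<Rightarrow> 'a config \<Rightarrow> bool" where
  "config_le C C' \<longleftrightarrow> points C = points C' \<and> (\<forall>s\<in>basis C. is_relation C' s)"

definition alg_iso :: "'a config \<Rightarrow> 'b config \<Rightarrow> ('a rel \<Rightarrow> 'b rel) \<Rightarrow> bool" where
  "alg_iso C C' \<phi> \<longleftrightarrow>
     bij_betw \<phi> (basis C) (basis C') \<and>
     (\<forall>r\<in>basis C. \<forall>s\<in>basis C. \<forall>t\<in>basis C.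
        inters_num C' (\<phi> r) (\<phi> s) (\<phi> t) = inters_num C r s t)"

definition map_config :: "('a \<Rightarrow> 'b) \<Rightarrow> 'a config \<Rightarrow> 'b config" where
  "map_config f C = \<lparr> points = f ` points C, basis = (\<lambda>s. map_prod f f ` s) ` basis C \<rparr>"

definition tensor_rel :: "'i set \<Rightarrow> ('i \<Rightarrow> 'a rel) \<Rightarrow> ('i \<Rightarrow> 'a) rel" where
  "tensor_rel I s =
     {(x, y). x \<in> extensional I \<and> y \<in> extensional I \<and> (\<forall>i\<in>I. (x i, y i) \<in> s i)}"

definition tensor :: "'i set \<Rightarrow> ('i \<Rightarrow> 'a config) \<Rightarrow> ('i \<Rightarrow> 'a) config" where
  "tensor I C = \<lparr> points = (\<Pi>\<^sub>E i\<in>I. points (C i)),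
                  basis = tensor_rel I ` (\<Pi>\<^sub>E i\<in>I. basis (C i)) \<rparr>"

text \<open>
  \<open>\<phi> i j\<close> is the algebraic isomorphism from \<open>C i\<close> to \<open>C j\<close>; composition in the cocycle
  condition is written from left to right, i.e. \<open>\<phi> i j\<close> is applied first.
\<close>
definition alg_iso_system ::
  "'i set \<Rightarrow> ('i \<Rightarrow> 'a config) \<Rightarrow> ('i \<Rightarrow> 'i \<Rightarrow> 'a rel \<Rightarrow> 'a rel) \<Rightarrow> bool" where
  "alg_iso_system I C \<phi> \<longleftrightarrow>
     (\<forall>i\<in>I. \<forall>j\<in>I. alg_iso (C i) (C j) (\<phi> i j)) \<and>
     (\<forall>i\<in>I. \<forall>s\<in>basis (C i). \<phi> i i s = s) \<and>
     (\<forall>i\<in>I. \<forall>j\<in>I. \<forall>k\<in>I. \<forall>s\<in>basis (C i). \<phi> j k (\<phi> i j s) = \<phi> i k s)"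

text \<open>
  Here \<open>G\<close> is a group of permutations of the index set \<open>I\<close>. The \<open>i\<close>-th factor of the image of
  \<open>tensor_rel I s\<close> under \<open>g\<close> comes from the index \<open>inv g i\<close>.
\<close>
definition exponentiation ::
  "'i set \<Rightarrow> ('i \<Rightarrow> 'a config) \<Rightarrow> ('i \<Rightarrow> 'i \<Rightarrow> 'a rel \<Rightarrow> 'a rel) \<Rightarrow> ('i \<Rightarrow> 'i) set
     \<Rightarrow> ('i \<Rightarrow> 'a) config" where
  "exponentiation I C \<phi> G = \<lparr>
     points = (\<Pi>\<^sub>E i\<in>I. points (C i)),
     basis = (\<lambda>s. \<Union>g\<in>G. tensor_rel I (\<lambda>i\<in>I. \<phi> (inv g i) i (s (inv g i))))
               ` (\<Pi>\<^sub>E i\<in>I. basis (C i)) \<rparr>"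

subsection \<open>The coherent configuration of a graph\<close>

definition WL :: "'a pair_pre_digraph \<Rightarrow> 'a config" where
  "WL G = (THE C.
     coherent C \<and> points C = pverts G \<and> is_relation C (parcs G) \<and>
     (\<forall>C'. coherent C' \<and> points C' = pverts G \<and> is_relation C' (parcs G) \<longrightarrow> config_le C C'))"

definition WL_iso ::
  "'a pair_pre_digraph \<Rightarrow> 'b pair_pre_digraph \<Rightarrow> ('a rel \<Rightarrow> 'b rel) \<Rightarrow> bool" where
  "WL_iso G H \<phi> \<longleftrightarrow>
     alg_iso (WL G) (WL H) \<phi> \<and> \<Union>(\<phi> ` {s \<in> basis (WL G). s \<subseteq> parcs G}) = parcs H"

definition WL_equivalent :: "'a pair_pre_digraph \<Rightarrow> 'b pair_pre_digraph \<Rightarrow> bool" where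
  "WL_equivalent G H \<longleftrightarrow> (\<exists>\<phi>. WL_iso G H \<phi>)"

subsection \<open>The multidimensional Weisfeiler-Leman algorithm\<close>

definition tuples :: "nat \<Rightarrow> 'a set \<Rightarrow> 'a list set" where
  "tuples m V = {x. length x = m \<and> set x \<subseteq> V}"

definition same_type :: "'a pair_pre_digraph \<Rightarrow> nat \<Rightarrow> 'a list \<Rightarrow> 'a list \<Rightarrow> bool" where
  "same_type G m x y \<longleftrightarrow>
     (\<forall>i<m. \<forall>j<m. (x ! i = x ! j \<longleftrightarrow> y ! i = y ! j) \<and>
                  ((x ! i, x ! j) \<in> parcs G \<longleftrightarrow> (y ! i, y ! j) \<in> parcs G))"

text \<open>
  The colour of an \<open>m\<close>-tuple after \<open>r\<close> rounds is represented by its colour class. One round refines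
  the colour of \<open>x\<close> by the multiset, over all vertices \<open>v\<close>, of the \<open>m\<close>-tuples of colours of
  \<open>x[0 := v], \<dots>, x[m - 1 := v]\<close>. With this version of the algorithm, dimension 2 computes
  \<open>WL\<close>.
\<close>
primrec wl_class :: "'a pair_pre_digraph \<Rightarrow> nat \<Rightarrow> nat \<Rightarrow> 'a list \<Rightarrow> 'a list set" where
  "wl_class G m 0 x = {y \<in> tuples m (pverts G). same_type G m x y}"
| "wl_class G m (Suc r) x =
     {y \<in> tuples m (pverts G).
        wl_class G m r y = wl_class G m r x \<and>
        image_mset (\<lambda>v. map (\<lambda>i. wl_class G m r (y[i := v])) [0..<m]) (mset_set (pverts G)) =
        image_mset (\<lambda>v. map (\<lambda>i. wl_class G m r (x[i := v])) [0..<m]) (mset_set (pverts G))}"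

text \<open>
  The classes \<open>wl_class G m r x\<close> decrease with \<open>r\<close>, so for finite \<open>G\<close> they stabilise and the
  intersection below is the class of \<open>x\<close> in the stable partition.
\<close>
definition WL_dim :: "nat \<Rightarrow> 'a pair_pre_digraph \<Rightarrow> 'a list set set" where
  "WL_dim m G = (\<lambda>x. \<Inter>r. wl_class G m r x) ` tuples m (pverts G)"

definition pr2 :: "'a list set set \<Rightarrow> 'a rel set" where
  "pr2 P = (\<lambda>\<Lambda>. (\<lambda>x. (x ! 0, x ! 1)) ` \<Lambda>) ` P"

definition WL_closed :: "nat \<Rightarrow> 'a pair_pre_digraph \<Rightarrow> bool" where
  "WL_closed m G \<longleftrightarrow> basis (WL G) = pr2 (WL_dim m G)"

subsection \<open>Regrouping coordinates\<close>

text \<open>The canonical identification of the product over \<open>\<Union>k\<in>K. J k\<close> (for disjoint \<open>J k\<close>) with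
  the product over \<open>k \<in> K\<close> of the products over \<open>J k\<close>.\<close>
definition regroup :: "'k set \<Rightarrow> ('k \<Rightarrow> 'i set) \<Rightarrow> ('i \<Rightarrow> 'a) \<Rightarrow> 'k \<Rightarrow> 'i \<Rightarrow> 'a" where
  "regroup K J x = (\<lambda>k\<in>K. restrict x (J k))"

end

(*
The relations of WL(G) are the smallest family of relations that contains the arcs and the diagonal
and is closed under complement, union, converse and counting of paths of length two; so inclusions
and correspondences between such families can be proved by induction over their generation.

In a Cartesian product, arcs in different directions are related neither by the Djokovic relation
Theta nor by tau (common tail, spanning no square). Conversely, splitting the arcs of a connected
graph into two parts that are unrelated by Theta and tau factorises the graph, so in a prime graph
the transitive closure of Theta and tau relates any two arcs. Hence "same direction" is this closure,
and it is definable with six variables: four for the two arcs and two for the intermediate arc.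

If two arcs xy and uv, of directions i and j, have the same colour, then the relations on the i-layer
of x that are definable with the parameters x, y correspond to the relations on the j-layer of u
defined in the same way with parameters u, v. This correspondence restricts to an algebraic
isomorphism from WL(X_i) to WL(X_j). So in a WL_6-closed product the arcs whose direction lies in J_k
form a relation of WL, which yields the tensor decomposition. For the exponentiation, the relations
of the tensor product that are fixed by an algebraic automorphism form a coherent family, and the
arcs belong to it.
*)
theory Submission
  imports Defs
begin

subsection \<open>Coherent families of relations\<close>

text \<open>WL-equivalent factors need not be isomorphic, so no vertex map links two layers; they
  are compared only through one formula, read with parameters x, y and with u, v. Emptiness is the
  one property compared: inclusion is emptiness of a difference, and basis relations, intersection
  numbers and arcs are all expressed through inclusions. Counting paths c, p, d inside a layer takes
  five variables, with p confined to the layer because the formula says nothing off it, so six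
  suffice here too. Theta never relates different directions because distances add over the
  coordinates; parallel arcs of one direction are Theta-related, which lets primeness of a single
  factor govern all its layers. Being WL_6-closed enters once: whatever six variables can say about
  an arc is constant on the basis relations of WL. For the tensor product it then suffices that the
  arcs of each class form a relation: a block product is connected, so reachability recovers its
  layers, and lifted relations compose to product relations.\<close>

definition rels :: "'a config \<Rightarrow> 'a rel set" where
  "rels C = {r. is_relation C r}"

text \<open>The count is fixed exactly: intersection numbers become inclusions
  \<open>t \<subseteq> paths V r s n\<close> (\<open>basis_paths\<close>), and the complement of the
  case n = 0 is the composition.\<close>

definition paths :: "'a set \<Rightarrow> 'a rel \<Rightarrow> 'a rel \<Rightarrow> nat \<Rightarrow> 'a rel" where
  "paths V r s n = {(x, y) \<in> V \<times> V. card {z \<in> V. (x, z) \<in> r \<and> (z, y) \<in> s} = n}"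

lemma paths_unique: "p \<in> paths V r s n \<Longrightarrow> p \<in> paths V r s m \<Longrightarrow> n = m"
  unfolding paths_def by auto

text \<open>Models the set of all relations of a coherent configuration instead of the partition
  into basis relations; the partition returns as the atoms of this finite Boolean algebra.\<close>

definition coherent_family :: "'a set \<Rightarrow> 'a rel set \<Rightarrow> bool" where
  "coherent_family V F \<longleftrightarrow> F \<subseteq> Pow (V \<times> V) \<and> Id_on V \<in> F \<and> (\<forall>r\<in>F. V \<times> V - r \<in> F) \<and>
     (\<forall>r\<in>F. \<forall>s\<in>F. r \<union> s \<in> F) \<and> (\<forall>r\<in>F. r\<inverse> \<in> F) \<and> (\<forall>r\<in>F. \<forall>s\<in>F. \<forall>n. paths V r s n \<in> F)"

lemma coherent_familyI:
  assumes "\<And>r. r \<in> F \<Longrightarrow> r \<subseteq> V \<times> V" "Id_on V \<in> F" "\<And>r. r \<in> F \<Longrightarrow> V \<times> V - r \<in> F"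
    "\<And>r s. r \<in> F \<Longrightarrow> s \<in> F \<Longrightarrow> r \<union> s \<in> F" "\<And>r. r \<in> F \<Longrightarrow> r\<inverse> \<in> F"
    "\<And>r s n. r \<in> F \<Longrightarrow> s \<in> F \<Longrightarrow> paths V r s n \<in> F"
  shows "coherent_family V F"
proof -
  have "F \<subseteq> Pow (V \<times> V)" using assms(1) by blast
  then show ?thesis unfolding coherent_family_def using assms(2-) by simp
qed

section \<open>From a coherent family to its configuration\<close>

locale coh_family =
  fixes V :: "'a set" and F :: "'a rel set"
  assumes fam: "coherent_family V F" and finV: "finite V"
begin

lemma sub: "r \<in> F \<Longrightarrow> r \<subseteq> V \<times> V"
  and id_mem: "Id_on V \<in> F"
  and compl_mem: "r \<in> F \<Longrightarrow> V \<times> V - r \<in> F"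
  and un_mem: "r \<in> F \<Longrightarrow> s \<in> F \<Longrightarrow> r \<union> s \<in> F"
  and conv_mem: "r \<in> F \<Longrightarrow> r\<inverse> \<in> F"
  and paths_mem: "r \<in> F \<Longrightarrow> s \<in> F \<Longrightarrow> paths V r s n \<in> F"
  using fam unfolding coherent_family_def by blast+

lemma finF: "finite F"
  using fam finV unfolding coherent_family_def by (meson finite_Pow_iff finite_SigmaI finite_subset)

lemma all_mem: "V \<times> V \<in> F"
proof -
  have "V \<times> V = Id_on V \<union> (V \<times> V - Id_on V)" by auto
  then show ?thesis using un_mem[OF id_mem compl_mem[OF id_mem]] by simp
qed

lemma empty_mem: "{} \<in> F"
  using compl_mem[OF all_mem] by simp

lemma int_mem: "r \<in> F \<Longrightarrow> s \<in> F \<Longrightarrow> r \<inter> s \<in> F"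
proof -
  assume rs: "r \<in> F" "s \<in> F"
  have "r \<inter> s = V \<times> V - ((V \<times> V - r) \<union> (V \<times> V - s))" using sub rs by blast
  then show ?thesis using rs compl_mem un_mem by simp
qed

lemma diff_mem: "r \<in> F \<Longrightarrow> s \<in> F \<Longrightarrow> r - s \<in> F"
proof -
  assume rs: "r \<in> F" "s \<in> F"
  have "r - s = r \<inter> (V \<times> V - s)" using sub rs by blast
  then show ?thesis using rs compl_mem int_mem by simp
qed

lemma Union_mem: "T \<subseteq> F \<Longrightarrow> \<Union>T \<in> F"
proof -
  assume T: "T \<subseteq> F"
  have "finite T" using T finF finite_subset by blast
  then show ?thesis using T by (induction T) (auto intro: empty_mem un_mem)
qed

lemma Inter_mem: "T \<subseteq> F \<Longrightarrow> T \<noteq> {} \<Longrightarrow> \<Inter>T \<in> F"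
proof -
  assume T: "T \<subseteq> F" "T \<noteq> {}"
  have "finite T" using T finF finite_subset by blast
  then show ?thesis using T(2,1) by (induction T rule: finite_ne_induct) (auto intro: int_mem)
qed

lemma comp_mem: "r \<in> F \<Longrightarrow> s \<in> F \<Longrightarrow> r O s \<in> F"
proof -
  assume rs: "r \<in> F" "s \<in> F"
  have "r O s = V \<times> V - paths V r s 0"
    using sub[OF rs(1)] sub[OF rs(2)] finV unfolding paths_def by fastforce
  then show ?thesis using rs compl_mem paths_mem by simp
qed

text \<open>Intersecting with V \<times> V discards the loops outside V that the reflexive closure
  adds. The union over all powers is harmless because F is finite.\<close>

lemma rtrancl_mem: "r \<in> F \<Longrightarrow> (V \<times> V) \<inter> r\<^sup>* \<in> F"
proof -
  assume r: "r \<in> F"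
  have pow: "(V \<times> V) \<inter> r ^^ n \<in> F" for n
  proof (induction n)
    case 0
    have "(V \<times> V) \<inter> r ^^ 0 = Id_on V" by auto
    then show ?case using id_mem by simp
  next
    case (Suc n)
    have "(V \<times> V) \<inter> r ^^ Suc n = ((V \<times> V) \<inter> r ^^ n) O r"
      using sub[OF r] by (auto simp: relcomp_unfold)
    then show ?case using comp_mem[OF Suc r] by simp
  qed
  have "(V \<times> V) \<inter> r\<^sup>* = \<Union>(range (\<lambda>n. (V \<times> V) \<inter> r ^^ n))"
    by (auto simp: rtrancl_is_UN_relpow)
  then show ?thesis using Union_mem[of "range (\<lambda>n. (V \<times> V) \<inter> r ^^ n)"] pow by auto
qed

definition atom :: "'a \<times> 'a \<Rightarrow> 'a rel" where
  "atom p = \<Inter>{r \<in> F. p \<in> r}"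

lemma atom_mem: "p \<in> V \<times> V \<Longrightarrow> atom p \<in> F"
  unfolding atom_def using all_mem by (intro Inter_mem) auto

lemma atom_self: "p \<in> atom p"
  unfolding atom_def by auto

lemma atom_least: "r \<in> F \<Longrightarrow> p \<in> r \<Longrightarrow> atom p \<subseteq> r"
  unfolding atom_def by auto

text \<open>If p were outside \<open>atom q\<close>, then \<open>atom p - atom q\<close> would be a
  member of the family that contains p and is smaller than \<open>atom p\<close>.\<close>

lemma atom_eq: "p \<in> V \<times> V \<Longrightarrow> q \<in> atom p \<Longrightarrow> atom q = atom p"
proof (rule antisym)
  assume p: "p \<in> V \<times> V" and q: "q \<in> atom p"
  show s: "atom q \<subseteq> atom p" by (rule atom_least[OF atom_mem[OF p] q])
  have qV: "q \<in> V \<times> V" using sub[OF atom_mem[OF p]] q by blast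
  show "atom p \<subseteq> atom q"
  proof (cases "p \<in> atom q")
    case True
    then show ?thesis using atom_least[OF atom_mem[OF qV]] by blast
  next
    case False
    then have "atom p \<subseteq> atom p - atom q"
      using atom_least[OF diff_mem[OF atom_mem[OF p] atom_mem[OF qV]]] atom_self by blast
    then show ?thesis using q atom_self by blast
  qed
qed

definition config :: "'a config" where
  "config = \<lparr> points = V, basis = atom ` (V \<times> V) \<rparr>"

lemma rels_config: "rels config = F"
proof (intro set_eqI iffI)
  fix r assume "r \<in> rels config"
  then obtain T where T: "T \<subseteq> atom ` (V \<times> V)" "r = \<Union>T"
    unfolding rels_def is_relation_def config_def by auto
  have "T \<subseteq> F" using T(1) atom_mem by blast
  then show "r \<in> F" using Union_mem T(2) by blast
next
  fix r assume r: "r \<in> F"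
  have "r = \<Union>(atom ` r)" using atom_self atom_least[OF r] by blast
  then show "r \<in> rels config"
    unfolding rels_def is_relation_def config_def using image_mono[OF sub[OF r], of atom] by auto
qed

lemma coherent_config: "coherent config"
proof -
  have part: "partition_on (V \<times> V) (atom ` (V \<times> V))"
  proof (rule partition_onI)
    show "\<Union>(atom ` (V \<times> V)) = V \<times> V"
    proof
      show "\<Union>(atom ` (V \<times> V)) \<subseteq> V \<times> V" using sub[OF atom_mem] by blast
      show "V \<times> V \<subseteq> \<Union>(atom ` (V \<times> V))" using atom_self by blast
    qed
    show "{} \<notin> atom ` (V \<times> V)" using atom_self by blast
    show "disjnt p q" if pq: "p \<in> atom ` (V \<times> V)" "q \<in> atom ` (V \<times> V)" "p \<noteq> q" for p q
    proof (rule ccontr)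
      obtain a b where ab: "p = atom a" "q = atom b" "a \<in> V \<times> V" "b \<in> V \<times> V" using pq by blast
      assume "\<not> disjnt p q"
      then obtain c where "c \<in> p" "c \<in> q" unfolding disjnt_def by blast
      then have "atom c = p" "atom c = q" using atom_eq[OF ab(3), of c] atom_eq[OF ab(4), of c] ab by blast+
      then show False using pq(3) by blast
    qed
  qed
  have ir: "is_relation config r \<longleftrightarrow> r \<in> F" for r
    using rels_config unfolding rels_def by blast
  have conv: "(atom p)\<inverse> \<in> atom ` (V \<times> V)" if p: "p \<in> V \<times> V" for p
  proof -
    obtain a b where ab: "p = (a, b)" by (cases p)
    have "(b, a) \<in> V \<times> V" using p ab by auto
    moreover have "atom (b, a) = (atom p)\<inverse>"
    proof
      show "atom (b, a) \<subseteq> (atom p)\<inverse>"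
        using atom_least[OF conv_mem[OF atom_mem[OF p]], of "(b, a)"] atom_self[of p] ab by simp
      have "atom (a, b) \<subseteq> (atom (b, a))\<inverse>"
        using atom_least[OF conv_mem[OF atom_mem[of "(b, a)"]], of "(a, b)"] atom_self[of "(b, a)"] ab p by simp
      then show "(atom p)\<inverse> \<subseteq> atom (b, a)" unfolding ab by blast
    qed
    ultimately show ?thesis by (metis imageI)
  qed
  have int: "\<exists>k. \<forall>(\<alpha>, \<beta>)\<in>atom p. card {\<gamma> \<in> V. (\<alpha>, \<gamma>) \<in> r \<and> (\<gamma>, \<beta>) \<in> s} = k"
    if p: "p \<in> V \<times> V" and rs: "r \<in> F" "s \<in> F" for p r s
  proof -
    obtain a b where ab: "p = (a, b)" by (cases p)
    let ?k = "card {\<gamma> \<in> V. (a, \<gamma>) \<in> r \<and> (\<gamma>, b) \<in> s}"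
    \<comment> \<open>The count at the single pair p yields a member of the family containing p; the
      atom of p lies inside it, so the count is constant on the atom.\<close>
    have "p \<in> paths V r s ?k" using ab p unfolding paths_def by auto
    then have "atom p \<subseteq> paths V r s ?k" using atom_least paths_mem rs by blast
    then show ?thesis unfolding paths_def by (intro exI[of _ ?k]) auto
  qed
  show ?thesis
    unfolding coherent_def
    using finV part ir id_mem conv int[OF _ atom_mem atom_mem] unfolding config_def by auto
qed

lemma points_config: "points config = V"
  unfolding config_def by simp

end

section \<open>From a coherent configuration to its family of relations\<close>

locale coh =
  fixes C :: "'a config"
  assumes coherent: "coherent C"
begin

lemma fin: "finite (points C)"
  and part: "partition_on (points C \<times> points C) (basis C)"
  and id_rel: "is_relation C (Id_on (points C))"
  and conv_basis: "s \<in> basis C \<Longrightarrow> s\<inverse> \<in> basis C"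
  using coherent unfolding coherent_def by blast+

lemma basis_sub: "s \<in> basis C \<Longrightarrow> s \<subseteq> points C \<times> points C"
  using part unfolding partition_on_def by blast

lemma basis_ne: "s \<in> basis C \<Longrightarrow> s \<noteq> {}"
  using part unfolding partition_on_def by blast

lemma basis_eq: "s \<in> basis C \<Longrightarrow> t \<in> basis C \<Longrightarrow> p \<in> s \<Longrightarrow> p \<in> t \<Longrightarrow> s = t"
  using part unfolding partition_on_def disjoint_def by blast

lemma basis_cover:
  assumes "p \<in> points C \<times> points C" obtains s where "s \<in> basis C" "p \<in> s"
  using assms part unfolding partition_on_def by blast

lemma fin_basis: "finite (basis C)"
  by (rule finite_elements[OF _ part]) (use fin in simp)

lemma rels_iff:
  "r \<in> rels C \<longleftrightarrow> r \<subseteq> points C \<times> points C \<and> (\<forall>s\<in>basis C. s \<inter> r = {} \<or> s \<subseteq> r)"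
proof
  assume "r \<in> rels C"
  then obtain T where T: "T \<subseteq> basis C" "r = \<Union>T" unfolding rels_def is_relation_def by blast
  show "r \<subseteq> points C \<times> points C \<and> (\<forall>s\<in>basis C. s \<inter> r = {} \<or> s \<subseteq> r)"
  proof (intro conjI ballI)
    show "r \<subseteq> points C \<times> points C" using T basis_sub by blast
    fix s assume s: "s \<in> basis C"
    show "s \<inter> r = {} \<or> s \<subseteq> r" using T basis_eq[OF s] by blast
  qed
next
  assume a: "r \<subseteq> points C \<times> points C \<and> (\<forall>s\<in>basis C. s \<inter> r = {} \<or> s \<subseteq> r)"
  have eq: "r = \<Union>{s \<in> basis C. s \<subseteq> r}"
  proof
    show "r \<subseteq> \<Union>{s \<in> basis C. s \<subseteq> r}"
    proof
      fix p assume p: "p \<in> r"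
      have "p \<in> points C \<times> points C" using a p by blast
      then obtain s where s: "s \<in> basis C" "p \<in> s" by (rule basis_cover)
      then have "s \<subseteq> r" using a p by blast
      then show "p \<in> \<Union>{s \<in> basis C. s \<subseteq> r}" using s by blast
    qed
  qed blast
  have "{s \<in> basis C. s \<subseteq> r} \<subseteq> basis C" by blast
  then show "r \<in> rels C" unfolding rels_def is_relation_def using eq by blast
qed

lemma basis_rels: "s \<in> basis C \<Longrightarrow> s \<in> rels C"
  unfolding rels_def is_relation_def by (auto intro!: exI[of _ "{s}"])

lemma rels_basis:
  assumes "r \<in> rels C" "p \<in> r" obtains s where "s \<in> basis C" "p \<in> s" "s \<subseteq> r"
  using assms unfolding rels_def is_relation_def by auto

lemma rels_Union: "r \<in> rels C \<Longrightarrow> r = \<Union>{s \<in> basis C. s \<subseteq> r}"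
  using rels_basis by blast

lemma inters_num:
  assumes "r \<in> basis C" "s \<in> basis C" "t \<in> basis C" "(x, y) \<in> t"
  shows "inters_num C r s t = card {z \<in> points C. (x, z) \<in> r \<and> (z, y) \<in> s}"
proof -
  obtain k where k: "\<forall>(\<alpha>, \<beta>)\<in>t. card {\<gamma> \<in> points C. (\<alpha>, \<gamma>) \<in> r \<and> (\<gamma>, \<beta>) \<in> s} = k"
    using coherent assms(1-3) unfolding coherent_def by meson
  have "inters_num C r s t = k"
    unfolding inters_num_def using k assms(4) by (intro the_equality) auto
  then show ?thesis using k assms(4) by auto
qed

lemma rels_cases: "r \<in> rels C \<Longrightarrow> s \<in> basis C \<Longrightarrow> s \<inter> r = {} \<or> s \<subseteq> r"
  and rels_sub: "r \<in> rels C \<Longrightarrow> r \<subseteq> points C \<times> points C"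
  by (simp_all add: rels_iff)

text \<open>Sorting the midpoints z by the basis relations of their two steps gives disjoint sets
  counted by intersection numbers, so the total depends on t alone.\<close>

lemma card_paths:
  assumes r: "r \<in> rels C" and s: "s \<in> rels C" and t: "t \<in> basis C" and xy: "(x, y) \<in> t"
  shows "card {z \<in> points C. (x, z) \<in> r \<and> (z, y) \<in> s} =
    (\<Sum>(p, q)\<in>{p \<in> basis C. p \<subseteq> r} \<times> {q \<in> basis C. q \<subseteq> s}. inters_num C p q t)"
proof -
  let ?I = "{p \<in> basis C. p \<subseteq> r} \<times> {q \<in> basis C. q \<subseteq> s}"
  let ?A = "\<lambda>(p, q). {z \<in> points C. (x, z) \<in> p \<and> (z, y) \<in> q}"
  have "{z \<in> points C. (x, z) \<in> r \<and> (z, y) \<in> s} = (\<Union>i\<in>?I. ?A i)"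
  proof (intro set_eqI iffI)
    fix z assume z: "z \<in> {z \<in> points C. (x, z) \<in> r \<and> (z, y) \<in> s}"
    obtain p where p: "p \<in> basis C" "p \<subseteq> r" "(x, z) \<in> p" using z rels_basis[OF r] by blast
    obtain q where q: "q \<in> basis C" "q \<subseteq> s" "(z, y) \<in> q" using z rels_basis[OF s] by blast
    show "z \<in> (\<Union>i\<in>?I. ?A i)" using z p q by (intro UN_I[of "(p, q)"]) auto
  qed auto
  moreover have "card (\<Union>i\<in>?I. ?A i) = (\<Sum>i\<in>?I. card (?A i))"
  proof (rule card_UN_disjoint)
    show "finite ?I" using fin_basis by simp
    show "\<forall>i\<in>?I. finite (?A i)" using fin by auto
    show "\<forall>i\<in>?I. \<forall>j\<in>?I. i \<noteq> j \<longrightarrow> ?A i \<inter> ?A j = {}"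
    proof (intro ballI impI)
      fix i j assume ij: "i \<in> ?I" "j \<in> ?I" "i \<noteq> j"
      obtain p q p' q' where pq: "i = (p, q)" "j = (p', q')" by (cases i, cases j)
      have b: "p \<in> basis C" "p' \<in> basis C" "q \<in> basis C" "q' \<in> basis C" using ij pq by auto
      have "p = p' \<and> q = q'" if "z \<in> ?A i \<inter> ?A j" for z
        using that basis_eq[OF b(1,2), of "(x, z)"] basis_eq[OF b(3,4), of "(z, y)"] pq by simp
      then show "?A i \<inter> ?A j = {}" using pq ij(3) by blast
    qed
  qed
  moreover have "(\<Sum>i\<in>?I. card (?A i)) = (\<Sum>(p, q)\<in>?I. inters_num C p q t)"
    using inters_num[OF _ _ t xy] by (intro sum.cong) auto
  ultimately show ?thesis by simp
qed

lemma family: "coherent_family (points C) (rels C)"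
proof (rule coherent_familyI)
  let ?V = "points C"
  show "Id_on ?V \<in> rels C" using id_rel unfolding rels_def by simp
  fix r assume r: "r \<in> rels C"
  show "r \<subseteq> ?V \<times> ?V" using rels_sub[OF r] by blast
  show "?V \<times> ?V - r \<in> rels C"
    unfolding rels_iff
  proof (intro conjI ballI)
    fix t assume t: "t \<in> basis C"
    show "t \<inter> (?V \<times> ?V - r) = {} \<or> t \<subseteq> ?V \<times> ?V - r"
      using rels_cases[OF r t] basis_sub[OF t] by blast
  qed blast
  show "r\<inverse> \<in> rels C"
    unfolding rels_iff
  proof (intro conjI ballI)
    show "r\<inverse> \<subseteq> ?V \<times> ?V" using rels_sub[OF r] by blast
    fix s assume "s \<in> basis C"
    then have "s\<inverse> \<inter> r = {} \<or> s\<inverse> \<subseteq> r" using rels_cases[OF r] conv_basis by metis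
    then show "s \<inter> r\<inverse> = {} \<or> s \<subseteq> r\<inverse>"
    proof
      assume "s\<inverse> \<inter> r = {}"
      then have "s \<inter> r\<inverse> = {}" by auto
      then show ?thesis ..
    next
      assume "s\<inverse> \<subseteq> r"
      then have "s \<subseteq> r\<inverse>" by auto
      then show ?thesis ..
    qed
  qed
  fix s assume s: "s \<in> rels C"
  show "r \<union> s \<in> rels C"
    unfolding rels_iff
  proof (intro conjI ballI)
    show "r \<union> s \<subseteq> ?V \<times> ?V" using rels_sub[OF r] rels_sub[OF s] by blast
    fix t assume t: "t \<in> basis C"
    show "t \<inter> (r \<union> s) = {} \<or> t \<subseteq> r \<union> s"
      using rels_cases[OF r t] rels_cases[OF s t] by blast
  qed
  show "paths ?V r s n \<in> rels C" for n
    unfolding rels_iff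
  proof (intro conjI ballI)
    show "paths ?V r s n \<subseteq> ?V \<times> ?V" unfolding paths_def by blast
    fix t assume t: "t \<in> basis C"
    let ?k = "\<Sum>(p, q)\<in>{p \<in> basis C. p \<subseteq> r} \<times> {q \<in> basis C. q \<subseteq> s}. inters_num C p q t"
    have "t \<subseteq> paths ?V r s ?k"
    proof (rule subrelI)
      fix x y assume xy: "(x, y) \<in> t"
      then have "x \<in> ?V" "y \<in> ?V" using basis_sub[OF t] by auto
      then show "(x, y) \<in> paths ?V r s ?k"
        using card_paths[OF r s t xy] unfolding paths_def by simp
    qed
    then show "t \<inter> paths ?V r s n = {} \<or> t \<subseteq> paths ?V r s n"
      using paths_unique[of _ ?V r s n ?k] by blast
  qed
qed

sublocale coh_family "points C" "rels C"
  using family fin by unfold_locales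

lemma basis_paths:
  assumes "r \<in> basis C" "s \<in> basis C" "t \<in> basis C"
  shows "inters_num C r s t = n \<longleftrightarrow> t \<subseteq> paths (points C) r s n"
proof -
  obtain x y where xy: "(x, y) \<in> t" using basis_ne[OF assms(3)] by auto
  have "t \<subseteq> paths (points C) r s (inters_num C r s t)"
  proof (rule subrelI)
    fix a b assume ab: "(a, b) \<in> t"
    then show "(a, b) \<in> paths (points C) r s (inters_num C r s t)"
      using inters_num[OF assms ab] basis_sub[OF assms(3)] unfolding paths_def by auto
  qed
  then show ?thesis using paths_unique[of "(x, y)"] xy by blast
qed

text \<open>Recovers the basis from the set of relations alone, so that correspondences and images
  only have to respect inclusion and emptiness.\<close>

lemma basis_minimal:
  "s \<in> basis C \<longleftrightarrow> s \<in> rels C \<and> s \<noteq> {} \<and> (\<forall>r\<in>rels C. r \<subseteq> s \<longrightarrow> r = {} \<or> r = s)"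
proof
  assume s: "s \<in> basis C"
  then show "s \<in> rels C \<and> s \<noteq> {} \<and> (\<forall>r\<in>rels C. r \<subseteq> s \<longrightarrow> r = {} \<or> r = s)"
    using basis_ne basis_rels rels_cases[OF _ s] by blast
next
  assume a: "s \<in> rels C \<and> s \<noteq> {} \<and> (\<forall>r\<in>rels C. r \<subseteq> s \<longrightarrow> r = {} \<or> r = s)"
  then obtain p where p: "p \<in> s" by blast
  then obtain t where t: "t \<in> basis C" "p \<in> t" "t \<subseteq> s" using a rels_basis by metis
  then show "s \<in> basis C" using a basis_rels by blast
qed

lemma basis_sub_un: "s \<in> basis C \<Longrightarrow> r \<in> rels C \<Longrightarrow> r' \<in> rels C \<Longrightarrow>
    s \<subseteq> r \<union> r' \<longleftrightarrow> s \<subseteq> r \<or> s \<subseteq> r'"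
  using rels_cases[of r s] rels_cases[of r' s] basis_ne by blast

lemma basis_sub_compl: "s \<in> basis C \<Longrightarrow> r \<in> rels C \<Longrightarrow>
    s \<subseteq> points C \<times> points C - r \<longleftrightarrow> \<not> s \<subseteq> r"
proof -
  assume s: "s \<in> basis C" and r: "r \<in> rels C"
  have "s \<inter> r = {} \<or> s \<subseteq> r" by (rule rels_cases[OF r s])
  then show ?thesis using basis_ne[OF s] basis_sub[OF s] by blast
qed

end

lemma config_eqI:
  assumes "coherent C" "coherent C'" "points C = points C'" "rels C = rels C'"
  shows "C = C'"
proof -
  interpret C: coh C using assms(1) by unfold_locales
  interpret C': coh C' using assms(2) by unfold_locales
  have "basis C = basis C'"
    by (intro set_eqI) (simp only: C.basis_minimal C'.basis_minimal assms(4))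
  then show ?thesis using assms(3) by simp
qed

lemma config_le_iff:
  assumes "coherent C" "coherent C'"
  shows "config_le C C' \<longleftrightarrow> points C = points C' \<and> rels C \<subseteq> rels C'"
proof -
  interpret C: coh C using assms(1) by unfold_locales
  interpret C': coh C' using assms(2) by unfold_locales
  show ?thesis
  proof
    assume le: "config_le C C'"
    then have "basis C \<subseteq> rels C'" unfolding config_le_def rels_def by auto
    then have "rels C \<subseteq> rels C'" 
      using C'.Union_mem unfolding rels_def[of C] is_relation_def by fastforce
    then show "points C = points C' \<and> rels C \<subseteq> rels C'" using le unfolding config_le_def by simp
  next
    assume "points C = points C' \<and> rels C \<subseteq> rels C'"
    then show "config_le C C'" using C.basis_rels unfolding config_le_def rels_def by auto
  qed
qed

section \<open>Generating the relations of WL(G)\<close>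

inductive_set WL_rels :: "'a pair_pre_digraph \<Rightarrow> 'a rel set" for G where
  arcs: "parcs G \<in> WL_rels G"
| diag: "Id_on (pverts G) \<in> WL_rels G"
| compl: "r \<in> WL_rels G \<Longrightarrow> pverts G \<times> pverts G - r \<in> WL_rels G"
| un: "r \<in> WL_rels G \<Longrightarrow> s \<in> WL_rels G \<Longrightarrow> r \<union> s \<in> WL_rels G"
| conv: "r \<in> WL_rels G \<Longrightarrow> r\<inverse> \<in> WL_rels G"
| paths: "r \<in> WL_rels G \<Longrightarrow> s \<in> WL_rels G \<Longrightarrow> paths (pverts G) r s n \<in> WL_rels G"

definition fin_graph :: "'a pair_pre_digraph \<Rightarrow> bool" where
  "fin_graph G \<longleftrightarrow> finite (pverts G) \<and> parcs G \<subseteq> pverts G \<times> pverts G"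

lemma WL_rels_least:
  assumes "coherent_family (pverts G) F" "parcs G \<in> F"
  shows "WL_rels G \<subseteq> F"
proof
  fix r assume "r \<in> WL_rels G"
  then show "r \<in> F" using assms unfolding coherent_family_def by induction auto
qed

lemma WL_rels_family:
  assumes "fin_graph G" shows "coherent_family (pverts G) (WL_rels G)"
proof (rule coherent_familyI)
  show "r \<subseteq> pverts G \<times> pverts G" if "r \<in> WL_rels G" for r
    using that assms unfolding fin_graph_def by induction (auto simp: paths_def)
qed (auto intro: WL_rels.intros)

context
  fixes G :: "'a pair_pre_digraph"
  assumes G: "fin_graph G"
begin

text \<open>The definite description in \<open>WL\<close> is met by the configuration of the
  generated family: its relations are relations of every competitor, and configurations that are
  \<open>config_le\<close> in both directions have the same relations, hence are equal.\<close>

lemma WL_props: "coherent (WL G) \<and> points (WL G) = pverts G \<and> rels (WL G) = WL_rels G"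
proof -
  interpret W: coh_family "pverts G" "WL_rels G"
    using WL_rels_family[OF G] G unfolding fin_graph_def by unfold_locales auto
  let ?C = "W.config"
  have min: "config_le ?C C'" if "coherent C'" "points C' = pverts G" "is_relation C' (parcs G)" for C'
  proof -
    interpret C': coh C' using that(1) by unfold_locales
    show ?thesis
      using WL_rels_least[of G "rels C'"] C'.family that W.rels_config W.points_config
      by (simp add: config_le_iff[OF W.coherent_config that(1)] rels_def)
  qed
  have ar: "is_relation ?C (parcs G)"
    using W.rels_config WL_rels.arcs unfolding rels_def by blast
  have "WL G = ?C"
    unfolding WL_def
  proof (rule the_equality)
    show "coherent ?C \<and> points ?C = pverts G \<and> is_relation ?C (parcs G) \<and>
     (\<forall>C'. coherent C' \<and> points C' = pverts G \<and> is_relation C' (parcs G) \<longrightarrow> config_le ?C C')"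
      using W.coherent_config W.points_config ar min by blast
    fix D assume D: "coherent D \<and> points D = pverts G \<and> is_relation D (parcs G) \<and>
     (\<forall>C'. coherent C' \<and> points C' = pverts G \<and> is_relation C' (parcs G) \<longrightarrow> config_le D C')"
    have "config_le D ?C" using D W.coherent_config W.points_config ar by blast
    moreover have "config_le ?C D" using D min by blast
    ultimately show "D = ?C"
      using D W.coherent_config config_le_iff[of D ?C] config_le_iff[of ?C D]
      by (intro config_eqI) auto
  qed
  then show ?thesis using W.coherent_config W.points_config W.rels_config by simp
qed

lemma coherent_WL: "coherent (WL G)"
  and points_WL: "points (WL G) = pverts G"
  and rels_WL: "rels (WL G) = WL_rels G"
  using WL_props by blast+

lemma WL_rels_sub:
  assumes "coherent C" "points C = pverts G" "parcs G \<in> rels C"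
  shows "rels (WL G) \<subseteq> rels C"
proof -
  interpret C: coh C using assms(1) by unfold_locales
  show ?thesis using WL_rels_least[of G "rels C"] C.family assms rels_WL by simp
qed

end

subsection \<open>Algebraic isomorphisms\<close>

text \<open>Relations of the two graphs are paired when one term generates both. Different terms may
  produce the same relation, so nothing here forces the pairing to be single-valued; that comes from
  preservation of emptiness in \<open>WL_equivalentI\<close>.\<close>

inductive_set WL_rel_pairs :: "'a pair_pre_digraph \<Rightarrow> 'b pair_pre_digraph \<Rightarrow> ('a rel \<times> 'b rel) set"
  for G H where
  arcs: "(parcs G, parcs H) \<in> WL_rel_pairs G H"
| diag: "(Id_on (pverts G), Id_on (pverts H)) \<in> WL_rel_pairs G H"
| compl: "(r, r') \<in> WL_rel_pairs G H \<Longrightarrow>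
    (pverts G \<times> pverts G - r, pverts H \<times> pverts H - r') \<in> WL_rel_pairs G H"
| un: "(r, r') \<in> WL_rel_pairs G H \<Longrightarrow> (s, s') \<in> WL_rel_pairs G H \<Longrightarrow>
    (r \<union> s, r' \<union> s') \<in> WL_rel_pairs G H"
| conv: "(r, r') \<in> WL_rel_pairs G H \<Longrightarrow> (r\<inverse>, r'\<inverse>) \<in> WL_rel_pairs G H"
| paths: "(r, r') \<in> WL_rel_pairs G H \<Longrightarrow> (s, s') \<in> WL_rel_pairs G H \<Longrightarrow>
    (paths (pverts G) r s n, paths (pverts H) r' s' n) \<in> WL_rel_pairs G H"

lemma WL_rel_pairs_rels:
  "(r, r') \<in> WL_rel_pairs G H \<Longrightarrow> r \<in> WL_rels G \<and> r' \<in> WL_rels H"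
  by (induction rule: WL_rel_pairs.induct) (auto intro: WL_rels.intros)

lemma WL_rel_pairs_fst: "r \<in> WL_rels G \<Longrightarrow> \<exists>r'. (r, r') \<in> WL_rel_pairs G H"
  by (induction rule: WL_rels.induct) (blast intro: WL_rel_pairs.intros)+

lemma WL_rel_pairs_swap: "(r, r') \<in> WL_rel_pairs G H \<Longrightarrow> (r', r) \<in> WL_rel_pairs H G"
  by (induction rule: WL_rel_pairs.induct) (auto intro: WL_rel_pairs.intros)

lemma WL_rel_pairs_snd: "r' \<in> WL_rels H \<Longrightarrow> \<exists>r. (r, r') \<in> WL_rel_pairs G H"
  using WL_rel_pairs_fst WL_rel_pairs_swap by blast

text \<open>Inclusion, and with it equality, turns into emptiness of a difference, so emptiness is
  the only property the pairing has to preserve.\<close>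

lemma WL_rel_pairs_diff:
  assumes "fin_graph G" "fin_graph H" "(r, r') \<in> WL_rel_pairs G H" "(s, s') \<in> WL_rel_pairs G H"
  shows "(r - s, r' - s') \<in> WL_rel_pairs G H"
proof -
  let ?V = "pverts G \<times> pverts G" and ?W = "pverts H \<times> pverts H"
  have "r \<subseteq> ?V" "r' \<subseteq> ?W"
    using WL_rel_pairs_rels[OF assms(3)] WL_rels_family[OF assms(1)] WL_rels_family[OF assms(2)]
    unfolding coherent_family_def by auto
  then have eq: "r - s = ?V - ((?V - r) \<union> s)" "r' - s' = ?W - ((?W - r') \<union> s')" by auto
  show ?thesis unfolding eq by (intro WL_rel_pairs.compl WL_rel_pairs.un assms)
qed

text \<open>If the two graphs generate their relations in parallel without ever distinguishing an empty
  from a nonempty relation, this correspondence is an algebraic isomorphism.\<close>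
lemma WL_equivalentI:
  assumes G: "fin_graph G" and H: "fin_graph H"
    and empty: "\<And>r r'. (r, r') \<in> WL_rel_pairs G H \<Longrightarrow> r = {} \<longleftrightarrow> r' = {}"
  shows "WL_equivalent G H"
proof -
  let ?P = "WL_rel_pairs G H"
  interpret C: coh "WL G" by (unfold_locales) (rule coherent_WL[OF G])
  interpret D: coh "WL H" by (unfold_locales) (rule coherent_WL[OF H])
  note rels = rels_WL[OF G] rels_WL[OF H]
  have sub: "r \<subseteq> s \<longleftrightarrow> r' \<subseteq> s'" if "(r, r') \<in> ?P" "(s, s') \<in> ?P" for r r' s s'
    using empty[OF WL_rel_pairs_diff[OF G H that]] by (simp add: Diff_eq_empty_iff)
  have eq: "r = s \<longleftrightarrow> r' = s'" if "(r, r') \<in> ?P" "(s, s') \<in> ?P" for r r' s s'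
    using sub[OF that] sub[OF that(2,1)] by (simp add: set_eq_subset)
  define \<phi> where "\<phi> r = (THE r'. (r, r') \<in> ?P)" for r
  have phi_eq: "\<phi> r = r'" if "(r, r') \<in> ?P" for r r'
    unfolding \<phi>_def using that eq[OF that] by (intro the_equality) auto
  have phi: "(r, \<phi> r) \<in> ?P" if "r \<in> rels (WL G)" for r
    using WL_rel_pairs_fst[of r G H] that phi_eq rels by auto
  have basis: "r \<in> basis (WL G) \<longleftrightarrow> r' \<in> basis (WL H)" if p: "(r, r') \<in> ?P" for r r'
  proof -
    have "(\<forall>q\<in>WL_rels G. q \<subseteq> r \<longrightarrow> q = {} \<or> q = r) \<longleftrightarrow>
      (\<forall>q'\<in>WL_rels H. q' \<subseteq> r' \<longrightarrow> q' = {} \<or> q' = r')"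
    proof (intro iffI ballI impI)
      fix q' assume a: "\<forall>q\<in>WL_rels G. q \<subseteq> r \<longrightarrow> q = {} \<or> q = r" and q': "q' \<in> WL_rels H" "q' \<subseteq> r'"
      obtain q where q: "(q, q') \<in> ?P" using WL_rel_pairs_snd q'(1) by metis
      then show "q' = {} \<or> q' = r'"
        using a q'(2) WL_rel_pairs_rels[OF q] sub[OF q p] empty[OF q] eq[OF q p] by blast
    next
      fix q assume a: "\<forall>q'\<in>WL_rels H. q' \<subseteq> r' \<longrightarrow> q' = {} \<or> q' = r'" and q: "q \<in> WL_rels G" "q \<subseteq> r"
      obtain q' where q': "(q, q') \<in> ?P" using WL_rel_pairs_fst q(1) by metis
      then show "q = {} \<or> q = r"
        using a q(2) WL_rel_pairs_rels[OF q'] sub[OF q' p] empty[OF q'] eq[OF q' p] by blast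
    qed
    then show ?thesis
      unfolding C.basis_minimal D.basis_minimal rels using WL_rel_pairs_rels[OF p] empty[OF p] by simp
  qed
  have phi_b: "(r, \<phi> r) \<in> ?P" if "r \<in> basis (WL G)" for r
    using phi[OF C.basis_rels[OF that]] .
  have bij: "bij_betw \<phi> (basis (WL G)) (basis (WL H))"
  proof (rule bij_betw_imageI)
    show "inj_on \<phi> (basis (WL G))" using eq[OF phi_b phi_b] unfolding inj_on_def by blast
    show "\<phi> ` basis (WL G) = basis (WL H)"
    proof
      show "\<phi> ` basis (WL G) \<subseteq> basis (WL H)" using basis[OF phi_b] by blast
      show "basis (WL H) \<subseteq> \<phi> ` basis (WL G)"
      proof
        fix r' assume r': "r' \<in> basis (WL H)"
        then obtain r where r: "(r, r') \<in> ?P" using WL_rel_pairs_snd D.basis_rels rels by metis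
        then show "r' \<in> \<phi> ` basis (WL G)" using phi_eq[OF r] basis[OF r] r' by blast
      qed
    qed
  qed
  have nums: "inters_num (WL H) (\<phi> r) (\<phi> s) (\<phi> t) = inters_num (WL G) r s t"
    if b: "r \<in> basis (WL G)" "s \<in> basis (WL G)" "t \<in> basis (WL G)" for r s t
  proof -
    let ?k = "inters_num (WL G) r s t"
    \<comment> \<open>The intersection number is rewritten as an inclusion between generated
      relations, and inclusions carry over to the paired relations.\<close>
    have "t \<subseteq> paths (pverts G) r s ?k"
      using C.basis_paths[OF b, of ?k] points_WL[OF G] by simp
    moreover have "(paths (pverts G) r s ?k, paths (pverts H) (\<phi> r) (\<phi> s) ?k) \<in> ?P"
      by (intro WL_rel_pairs.paths phi_b b)
    ultimately have "\<phi> t \<subseteq> paths (pverts H) (\<phi> r) (\<phi> s) ?k"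
      using sub[OF phi_b[OF b(3)]] by blast
    moreover have "\<phi> r \<in> basis (WL H)" "\<phi> s \<in> basis (WL H)" "\<phi> t \<in> basis (WL H)"
      using basis[OF phi_b] b by blast+
    ultimately show ?thesis using D.basis_paths points_WL[OF H] by simp
  qed
  have "\<Union>(\<phi> ` {s \<in> basis (WL G). s \<subseteq> parcs G}) = \<Union>{s \<in> basis (WL H). s \<subseteq> parcs H}"
  proof -
    have "\<phi> ` {s \<in> basis (WL G). s \<subseteq> parcs G} = {s \<in> basis (WL H). s \<subseteq> parcs H}"
    proof (intro set_eqI iffI)
      fix s' assume "s' \<in> \<phi> ` {s \<in> basis (WL G). s \<subseteq> parcs G}"
      then obtain s where s: "s' = \<phi> s" "s \<in> basis (WL G)" "s \<subseteq> parcs G" by blast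
      then show "s' \<in> {s \<in> basis (WL H). s \<subseteq> parcs H}"
        using basis[OF phi_b[OF s(2)]] sub[OF phi_b[OF s(2)] WL_rel_pairs.arcs] by simp
    next
      fix s' assume s': "s' \<in> {s \<in> basis (WL H). s \<subseteq> parcs H}"
      then obtain s where s: "s' = \<phi> s" "s \<in> basis (WL G)" using bij unfolding bij_betw_def by blast
      then have "s \<subseteq> parcs G" using s' sub[OF phi_b[OF s(2)] WL_rel_pairs.arcs] by simp
      then show "s' \<in> \<phi> ` {s \<in> basis (WL G). s \<subseteq> parcs G}" using s by blast
    qed
    then show ?thesis by simp
  qed
  also have "\<dots> = parcs H" using D.rels_Union[of "parcs H"] WL_rels.arcs[of H] rels by simp
  finally have "WL_iso G H \<phi>" unfolding WL_iso_def alg_iso_def using bij nums by blast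
  then show ?thesis unfolding WL_equivalent_def by blast
qed

lemma alg_iso_bij: "alg_iso C D \<phi> \<Longrightarrow> bij_betw \<phi> (basis C) (basis D)"
  and alg_iso_num: "alg_iso C D \<phi> \<Longrightarrow> r \<in> basis C \<Longrightarrow> s \<in> basis C \<Longrightarrow> t \<in> basis C \<Longrightarrow>
    inters_num D (\<phi> r) (\<phi> s) (\<phi> t) = inters_num C r s t"
  unfolding alg_iso_def by blast+

lemma alg_iso_basis: "alg_iso C D \<phi> \<Longrightarrow> s \<in> basis C \<Longrightarrow> \<phi> s \<in> basis D"
  using alg_iso_bij bij_betwE by blast

lemma alg_iso_id: "alg_iso C C (\<lambda>s. s)"
  unfolding alg_iso_def bij_betw_def by simp

lemma alg_iso_comp:
  assumes "alg_iso C D \<phi>" "alg_iso D E \<psi>" shows "alg_iso C E (\<lambda>s. \<psi> (\<phi> s))"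
proof -
  have "bij_betw (\<psi> \<circ> \<phi>) (basis C) (basis E)"
    using alg_iso_bij[OF assms(1)] alg_iso_bij[OF assms(2)] by (rule bij_betw_trans)
  then show ?thesis
    unfolding alg_iso_def comp_def
    using alg_iso_num[OF assms(1)] alg_iso_num[OF assms(2)] alg_iso_basis[OF assms(1)] by simp
qed

lemma alg_iso_inv:
  assumes "alg_iso C D \<phi>" shows "alg_iso D C (the_inv_into (basis C) \<phi>)"
proof -
  let ?i = "the_inv_into (basis C) \<phi>"
  note b = alg_iso_bij[OF assms]
  have i: "?i s \<in> basis C" "\<phi> (?i s) = s" if "s \<in> basis D" for s
    using b that f_the_inv_into_f_bij_betw[OF b, of s] bij_betwE[OF bij_betw_the_inv_into[OF b]] by auto
  then show ?thesis
    unfolding alg_iso_def using bij_betw_the_inv_into[OF b] alg_iso_num[OF assms i(1) i(1) i(1)]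
    by auto
qed

context coh
begin

text \<open>\<open>alg_iso\<close> speaks of intersection numbers only, so diagonal basis relations
  have to be recognised from them: they are the left units, multiplication by which never leads from
  r to a different basis relation.\<close>

lemma diag_basis:
  assumes s: "s \<in> basis C"
  shows "s \<subseteq> Id \<longleftrightarrow> (\<forall>r\<in>basis C. \<forall>t\<in>basis C. r \<noteq> t \<longrightarrow> inters_num C s r t = 0)"
proof
  assume sub: "s \<subseteq> Id"
  show "\<forall>r\<in>basis C. \<forall>t\<in>basis C. r \<noteq> t \<longrightarrow> inters_num C s r t = 0"
  proof (intro ballI impI)
    fix r t assume rt: "r \<in> basis C" "t \<in> basis C" "r \<noteq> t"
    obtain x y where xy: "(x, y) \<in> t" using basis_ne[OF rt(2)] by auto
    then have "{z \<in> points C. (x, z) \<in> s \<and> (z, y) \<in> r} = {}"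
      using sub basis_eq[OF rt(1,2)] rt(3) by blast
    then show "inters_num C s r t = 0" unfolding inters_num[OF s rt(1,2) xy] by (simp only: card.empty)
  qed
next
  assume z: "\<forall>r\<in>basis C. \<forall>t\<in>basis C. r \<noteq> t \<longrightarrow> inters_num C s r t = 0"
  show "s \<subseteq> Id"
  proof (rule subrelI)
    fix x y assume xy: "(x, y) \<in> s"
    then have y: "y \<in> points C" using basis_sub[OF s] by blast
    \<comment> \<open>r is the diagonal basis relation at the head y. The midpoint y makes
      \<open>inters_num C s r s\<close> positive, which the hypothesis allows only for r =
      s.\<close>
    have "(y, y) \<in> Id_on (points C)" using y by blast
    then obtain r where r: "r \<in> basis C" "(y, y) \<in> r" "r \<subseteq> Id_on (points C)"
      using rels_basis id_mem by metis
    have "y \<in> {z \<in> points C. (x, z) \<in> s \<and> (z, y) \<in> r}" using xy r y by simp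
    then have "inters_num C s r s \<noteq> 0"
      unfolding inters_num[OF s r(1) s xy] using fin by auto
    then have "r = s" using z[rule_format, OF r(1) s] by argo
    then show "(x, y) \<in> Id" using r(3) xy by blast
  qed
qed

text \<open>A positive number at a diagonal t means that some pair of s is reversed by s'; as basis
  relations are disjoint, one reversed pair forces equality with the converse.\<close>

lemma conv_basis_iff:
  assumes s: "s \<in> basis C" "s' \<in> basis C"
  shows "s' = s\<inverse> \<longleftrightarrow> (\<exists>t\<in>basis C. t \<subseteq> Id \<and> inters_num C s s' t \<noteq> 0)"
proof
  assume c: "s' = s\<inverse>"
  obtain x y where xy: "(x, y) \<in> s" using basis_ne[OF s(1)] by auto
  then have p: "x \<in> points C" "y \<in> points C" using basis_sub[OF s(1)] by auto
  have "(x, x) \<in> Id_on (points C)" using p by blast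
  then obtain t where t: "t \<in> basis C" "(x, x) \<in> t" "t \<subseteq> Id_on (points C)"
    using rels_basis id_mem by metis
  have "y \<in> {z \<in> points C. (x, z) \<in> s \<and> (z, x) \<in> s'}" using p xy c by simp
  then have "inters_num C s s' t \<noteq> 0" unfolding inters_num[OF s t(1,2)] using fin by auto
  then show "\<exists>t\<in>basis C. t \<subseteq> Id \<and> inters_num C s s' t \<noteq> 0" using t by blast
next
  assume "\<exists>t\<in>basis C. t \<subseteq> Id \<and> inters_num C s s' t \<noteq> 0"
  then obtain t where t: "t \<in> basis C" "t \<subseteq> Id" "inters_num C s s' t \<noteq> 0" by blast
  obtain x where x: "(x, x) \<in> t" using basis_ne[OF t(1)] t(2) by auto
  have "{z \<in> points C. (x, z) \<in> s \<and> (z, x) \<in> s'} \<noteq> {}"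
    using t(3) unfolding inters_num[OF s t(1) x] by (metis card.empty)
  then obtain z where "(x, z) \<in> s" "(z, x) \<in> s'" by blast
  then show "s' = s\<inverse>" using basis_eq[OF s(2) conv_basis[OF s(1)]] by blast
qed

end

lemma alg_iso_diag:
  assumes "coherent C" "coherent D" "alg_iso C D \<phi>" "s \<in> basis C"
  shows "\<phi> s \<subseteq> Id \<longleftrightarrow> s \<subseteq> Id"
proof -
  interpret C: coh C using assms(1) by unfold_locales
  interpret D: coh D using assms(2) by unfold_locales
  note b = alg_iso_bij[OF assms(3)]
  have im: "basis D = \<phi> ` basis C" using b unfolding bij_betw_def by simp
  have "\<phi> r \<noteq> \<phi> t \<longleftrightarrow> r \<noteq> t" if "r \<in> basis C" "t \<in> basis C" for r t
    using b that unfolding bij_betw_def inj_on_def by blast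
  then show ?thesis
    unfolding C.diag_basis[OF assms(4)] D.diag_basis[OF alg_iso_basis[OF assms(3,4)]] im
    using alg_iso_num[OF assms(3,4)] by simp
qed

lemma alg_iso_conv:
  assumes "coherent C" "coherent D" "alg_iso C D \<phi>" "s \<in> basis C"
  shows "\<phi> (s\<inverse>) = (\<phi> s)\<inverse>"
proof -
  interpret C: coh C using assms(1) by unfold_locales
  interpret D: coh D using assms(2) by unfold_locales
  have s: "s\<inverse> \<in> basis C" using C.conv_basis assms(4) .
  then obtain t where t: "t \<in> basis C" "t \<subseteq> Id" "inters_num C s (s\<inverse>) t \<noteq> 0"
    using C.conv_basis_iff[OF assms(4) s] by blast
  have "inters_num D (\<phi> s) (\<phi> (s\<inverse>)) (\<phi> t) \<noteq> 0"
    using alg_iso_num[OF assms(3,4) s t(1)] t(3) by simp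
  moreover have "\<phi> t \<subseteq> Id" using alg_iso_diag[OF assms(1-3) t(1)] t(2) by simp
  ultimately show ?thesis
    using D.conv_basis_iff[OF alg_iso_basis[OF assms(3,4)] alg_iso_basis[OF assms(3) s]]
      alg_iso_basis[OF assms(3) t(1)] by blast
qed

lemma WL_iso_alg: "WL_iso G H \<phi> \<Longrightarrow> alg_iso (WL G) (WL H) \<phi>"
  unfolding WL_iso_def by simp

text \<open>\<open>WL_iso\<close> equates only unions. An image lying in the arcs of H shares a pair
  with the image of some basis relation made of arcs of G; disjointness of the basis and injectivity
  of \<phi> identify the two.\<close>

lemma WL_iso_arcs:
  assumes "fin_graph G" "fin_graph H" "WL_iso G H \<phi>" "s \<in> basis (WL G)"
  shows "\<phi> s \<subseteq> parcs H \<longleftrightarrow> s \<subseteq> parcs G"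
proof
  interpret C: coh "WL G" by (unfold_locales) (rule coherent_WL[OF assms(1)])
  interpret D: coh "WL H" by (unfold_locales) (rule coherent_WL[OF assms(2)])
  have U: "\<Union>(\<phi> ` {s \<in> basis (WL G). s \<subseteq> parcs G}) = parcs H" and a: "alg_iso (WL G) (WL H) \<phi>"
    using assms(3) unfolding WL_iso_def by auto
  show "\<phi> s \<subseteq> parcs H" if "s \<subseteq> parcs G" using U that assms(4) by blast
  have b: "\<phi> s \<in> basis (WL H)" by (rule alg_iso_basis[OF a assms(4)])
  obtain p where p: "p \<in> \<phi> s" using D.basis_ne[OF b] by blast
  assume "\<phi> s \<subseteq> parcs H"
  then obtain t where t: "t \<in> basis (WL G)" "t \<subseteq> parcs G" "p \<in> \<phi> t" using U p by blast
  have "\<phi> t = \<phi> s" using D.basis_eq[OF alg_iso_basis[OF a t(1)] b t(3) p] .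
  then have "t = s" using alg_iso_bij[OF a] t(1) assms(4) unfolding bij_betw_def inj_on_def by blast
  then show "s \<subseteq> parcs G" using t(2) by simp
qed

lemma WL_isoI:
  assumes "fin_graph H" "alg_iso (WL G) (WL H) \<phi>"
    "\<And>s. s \<in> basis (WL G) \<Longrightarrow> \<phi> s \<subseteq> parcs H \<longleftrightarrow> s \<subseteq> parcs G"
  shows "WL_iso G H \<phi>"
proof -
  interpret D: coh "WL H" by (unfold_locales) (rule coherent_WL[OF assms(1)])
  have im: "basis (WL H) = \<phi> ` basis (WL G)" using alg_iso_bij[OF assms(2)] unfolding bij_betw_def by simp
  have "parcs H = \<Union>{s \<in> basis (WL H). s \<subseteq> parcs H}"
    using D.rels_Union[of "parcs H"] WL_rels.arcs[of H] rels_WL[OF assms(1)] by simp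
  also have "{s \<in> basis (WL H). s \<subseteq> parcs H} = \<phi> ` {s \<in> basis (WL G). s \<subseteq> parcs G}"
    using im assms(3) by auto
  finally show ?thesis unfolding WL_iso_def using assms(2) by simp
qed

lemma WL_iso_id: "fin_graph G \<Longrightarrow> WL_iso G G (\<lambda>s. s)"
  by (rule WL_isoI) (simp_all add: alg_iso_id)

lemma WL_iso_comp:
  assumes "fin_graph G" "fin_graph H" "fin_graph K" "WL_iso G H \<phi>" "WL_iso H K \<psi>"
  shows "WL_iso G K (\<lambda>s. \<psi> (\<phi> s))"
  using alg_iso_comp[OF WL_iso_alg[OF assms(4)] WL_iso_alg[OF assms(5)]]
    WL_iso_arcs[OF assms(1,2,4)] WL_iso_arcs[OF assms(2,3,5)]
    alg_iso_basis[OF WL_iso_alg[OF assms(4)]]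
  by (intro WL_isoI[OF assms(3)]) auto

lemma WL_iso_inv:
  assumes "fin_graph G" "fin_graph H" "WL_iso G H \<phi>"
  shows "WL_iso H G (the_inv_into (basis (WL G)) \<phi>)"
proof (rule WL_isoI[OF assms(1)])
  let ?i = "the_inv_into (basis (WL G)) \<phi>"
  note a = WL_iso_alg[OF assms(3)]
  show i: "alg_iso (WL H) (WL G) ?i" by (rule alg_iso_inv[OF a])
  fix s assume s: "s \<in> basis (WL H)"
  show "?i s \<subseteq> parcs G \<longleftrightarrow> s \<subseteq> parcs H"
    using WL_iso_arcs[OF assms alg_iso_basis[OF i s]] f_the_inv_into_f_bij_betw[OF alg_iso_bij[OF a], of s] s
    by simp
qed

lemma WL_equivalent_refl: "fin_graph G \<Longrightarrow> WL_equivalent G G"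
  unfolding WL_equivalent_def using WL_iso_id by blast

lemma WL_equivalent_sym: "fin_graph G \<Longrightarrow> fin_graph H \<Longrightarrow> WL_equivalent G H \<Longrightarrow> WL_equivalent H G"
  unfolding WL_equivalent_def using WL_iso_inv by blast

lemma WL_equivalent_trans:
  "fin_graph G \<Longrightarrow> fin_graph H \<Longrightarrow> fin_graph K \<Longrightarrow> WL_equivalent G H \<Longrightarrow> WL_equivalent H K \<Longrightarrow>
    WL_equivalent G K"
  unfolding WL_equivalent_def using WL_iso_comp by blast

text \<open>All isomorphisms are routed through one fixed index.\<close>
lemma ex_alg_iso_system:
  assumes fin: "\<And>i. i \<in> I \<Longrightarrow> fin_graph (X i)"
    and equiv: "\<And>i j. i \<in> I \<Longrightarrow> j \<in> I \<Longrightarrow> WL_equivalent (X i) (X j)"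
  shows "\<exists>\<phi>. alg_iso_system I (\<lambda>j. WL (X j)) \<phi> \<and> (\<forall>i\<in>I. \<forall>j\<in>I. WL_iso (X i) (X j) (\<phi> i j))"
proof (cases "I = {}")
  case True
  then show ?thesis unfolding alg_iso_system_def by simp
next
  case False
  then obtain o' where o: "o' \<in> I" by blast
  have "\<forall>i\<in>I. \<exists>\<psi>. WL_iso (X o') (X i) \<psi>" using equiv o unfolding WL_equivalent_def by blast
  then obtain \<psi> where \<psi>: "\<And>i. i \<in> I \<Longrightarrow> WL_iso (X o') (X i) (\<psi> i)" by metis
  define \<phi> where "\<phi> i j s = \<psi> j (the_inv_into (basis (WL (X o'))) (\<psi> i) s)" for i j s
  have iso: "WL_iso (X i) (X j) (\<phi> i j)" if "i \<in> I" "j \<in> I" for i j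
    unfolding \<phi>_def by (intro WL_iso_comp[OF _ _ _ WL_iso_inv] fin that \<psi> o)
  have b: "bij_betw (\<psi> i) (basis (WL (X o'))) (basis (WL (X i)))" if "i \<in> I" for i
    by (rule alg_iso_bij[OF WL_iso_alg[OF \<psi>[OF that]]])
  have id: "\<phi> i i s = s" if "i \<in> I" "s \<in> basis (WL (X i))" for i s
    unfolding \<phi>_def using f_the_inv_into_f_bij_betw[OF b[OF that(1)], of s] that(2) by simp
  have cmp: "\<phi> j k (\<phi> i j s) = \<phi> i k s"
    if "i \<in> I" "j \<in> I" "k \<in> I" "s \<in> basis (WL (X i))" for i j k s
  proof -
    have "the_inv_into (basis (WL (X o'))) (\<psi> i) s \<in> basis (WL (X o'))"
      using bij_betwE[OF bij_betw_the_inv_into[OF b[OF that(1)]]] that(4) by blast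
    then show ?thesis
      unfolding \<phi>_def using the_inv_into_f_f[of "\<psi> j"] b[OF that(2)] unfolding bij_betw_def by simp
  qed
  have "alg_iso_system I (\<lambda>j. WL (X j)) \<phi>"
    unfolding alg_iso_system_def by (simp add: WL_iso_alg[OF iso] id cmp)
  then show ?thesis using iso by blast
qed

subsection \<open>Tensor products and exponentiation\<close>

lemma tensor_rel_cong: "(\<And>i. i \<in> I \<Longrightarrow> s i = t i) \<Longrightarrow> tensor_rel I s = tensor_rel I t"
  unfolding tensor_rel_def by auto

lemma mem_tensor_rel:
  "(x, y) \<in> tensor_rel I s \<longleftrightarrow> x \<in> extensional I \<and> y \<in> extensional I \<and> (\<forall>i\<in>I. (x i, y i) \<in> s i)"
  unfolding tensor_rel_def by simp

lemma conv_tensor_rel: "(tensor_rel I s)\<inverse> = tensor_rel I (\<lambda>i. (s i)\<inverse>)"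
  unfolding tensor_rel_def by auto

lemma tensor_rel_Id_on: "Id_on (\<Pi>\<^sub>E i\<in>I. V i) = tensor_rel I (\<lambda>i. Id_on (V i))"
proof (rule set_eqI)
  fix p :: "('a \<Rightarrow> 'b) \<times> ('a \<Rightarrow> 'b)"
  obtain x y where p: "p = (x, y)" by (cases p)
  have "x = y" if "x \<in> extensional I" "y \<in> extensional I" "\<forall>i\<in>I. x i = y i"
    using that by (intro extensionalityI[of _ I]) auto
  then show "p \<in> Id_on (\<Pi>\<^sub>E i\<in>I. V i) \<longleftrightarrow> p \<in> tensor_rel I (\<lambda>i. Id_on (V i))"
    unfolding p mem_tensor_rel Id_on_iff PiE_iff by auto
qed

text \<open>Midpoints are chosen independently in each coordinate, so the counts multiply.\<close>

lemma tensor_rel_paths: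
  assumes "finite I" "x \<in> extensional I" "y \<in> extensional I"
  shows "card {z \<in> \<Pi>\<^sub>E i\<in>I. V i. (x, z) \<in> tensor_rel I r \<and> (z, y) \<in> tensor_rel I s} =
    (\<Prod>i\<in>I. card {z \<in> V i. (x i, z) \<in> r i \<and> (z, y i) \<in> s i})"
proof -
  have "{z \<in> \<Pi>\<^sub>E i\<in>I. V i. (x, z) \<in> tensor_rel I r \<and> (z, y) \<in> tensor_rel I s} =
    (\<Pi>\<^sub>E i\<in>I. {z \<in> V i. (x i, z) \<in> r i \<and> (z, y i) \<in> s i})"
    using assms by (intro set_eqI) (simp add: mem_tensor_rel PiE_iff, blast)
  then show ?thesis using card_PiE[OF assms(1)] by simp
qed

locale coh_tensor =
  fixes I :: "'i set" and C :: "'i \<Rightarrow> 'a config"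
  assumes finI: "finite I" and cohC: "\<And>i. i \<in> I \<Longrightarrow> coherent (C i)"
begin

abbreviation "B \<equiv> (\<Pi>\<^sub>E i\<in>I. basis (C i))"
abbreviation "P \<equiv> (\<Pi>\<^sub>E i\<in>I. points (C i))"

lemma cohI: "i \<in> I \<Longrightarrow> coh (C i)"
  using cohC by unfold_locales

lemma ne: "s \<in> B \<Longrightarrow> \<exists>x y. (x, y) \<in> tensor_rel I s"
proof -
  assume s: "s \<in> B"
  have "\<forall>i\<in>I. \<exists>p. p \<in> s i"
    using s coh.basis_ne[OF cohI] by (metis PiE_mem all_not_in_conv)
  then obtain p where p: "\<forall>i\<in>I. p i \<in> s i" by metis
  show ?thesis
    by (intro exI[of _ "\<lambda>i\<in>I. fst (p i)"] exI[of _ "\<lambda>i\<in>I. snd (p i)"])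
      (use p in \<open>simp add: mem_tensor_rel\<close>)
qed

lemma uniq: "s \<in> B \<Longrightarrow> t \<in> B \<Longrightarrow> p \<in> tensor_rel I s \<Longrightarrow> p \<in> tensor_rel I t \<Longrightarrow> s = t"
proof -
  assume a: "s \<in> B" "t \<in> B" "p \<in> tensor_rel I s" "p \<in> tensor_rel I t"
  obtain x y where xy: "p = (x, y)" by (cases p)
  show "s = t"
  proof (rule PiE_ext[OF a(1,2)])
    fix i assume i: "i \<in> I"
    have "s i \<in> basis (C i)" "t i \<in> basis (C i)" using a i by auto
    moreover have "(x i, y i) \<in> s i" "(x i, y i) \<in> t i"
      using a(3,4) i unfolding xy mem_tensor_rel by auto
    ultimately show "s i = t i" using coh.basis_eq[OF cohI[OF i]] by metis
  qed
qed

text \<open>All factors of s are nonempty: a fixed pair of the product, changed in coordinate i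
  alone, tests any pair of \<open>s i\<close>.\<close>

lemma sub_iff: "s \<in> B \<Longrightarrow> tensor_rel I s \<subseteq> tensor_rel I r \<longleftrightarrow> (\<forall>i\<in>I. s i \<subseteq> r i)"
proof
  assume s: "s \<in> B" and sub: "tensor_rel I s \<subseteq> tensor_rel I r"
  obtain x y where xy: "(x, y) \<in> tensor_rel I s" using ne[OF s] by blast
  show "\<forall>i\<in>I. s i \<subseteq> r i"
  proof (intro ballI subrelI)
    fix i a b assume i: "i \<in> I" and ab: "(a, b) \<in> s i"
    have "(x(i := a), y(i := b)) \<in> tensor_rel I s"
      using xy i ab unfolding mem_tensor_rel extensional_def by auto
    then have "(x(i := a), y(i := b)) \<in> tensor_rel I r" using sub by blast
    then show "(a, b) \<in> r i" using i unfolding mem_tensor_rel by auto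
  qed
qed (auto simp: tensor_rel_def)

lemma cover:
  assumes "x \<in> P" "y \<in> P"
  obtains s where "s \<in> B" "(x, y) \<in> tensor_rel I s"
proof -
  have "\<forall>i\<in>I. \<exists>s\<in>basis (C i). (x i, y i) \<in> s"
  proof
    fix i assume i: "i \<in> I"
    then have "(x i, y i) \<in> points (C i) \<times> points (C i)" using assms by auto
    then show "\<exists>s\<in>basis (C i). (x i, y i) \<in> s" by (metis coh.basis_cover[OF cohI[OF i]])
  qed
  then obtain s where s: "\<forall>i\<in>I. s i \<in> basis (C i) \<and> (x i, y i) \<in> s i" by metis
  show thesis
    by (rule that[of "restrict s I"]) (use s assms in \<open>auto simp: mem_tensor_rel PiE_iff\<close>)
qed

lemma sub_points: "s \<in> B \<Longrightarrow> tensor_rel I s \<subseteq> P \<times> P"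
proof
  fix p assume s: "s \<in> B" and p: "p \<in> tensor_rel I s"
  obtain x y where xy: "p = (x, y)" by (cases p)
  have "(x i, y i) \<in> points (C i) \<times> points (C i)" if i: "i \<in> I" for i
    using p s i coh.basis_sub[OF cohI[OF i], of "s i"] unfolding xy mem_tensor_rel by blast
  then show "p \<in> P \<times> P" using p unfolding xy mem_tensor_rel PiE_iff mem_Times_iff fst_conv snd_conv by blast
qed

lemma is_rel:
  assumes "\<And>i. i \<in> I \<Longrightarrow> r i \<in> rels (C i)"
  shows "tensor_rel I r \<in> rels (tensor I C)"
proof -
  let ?T = "tensor_rel I ` {s \<in> B. \<forall>i\<in>I. s i \<subseteq> r i}"
  have "tensor_rel I r = \<Union>?T"
  proof
    show "\<Union>?T \<subseteq> tensor_rel I r" using sub_iff by blast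
    show "tensor_rel I r \<subseteq> \<Union>?T"
    proof (rule subrelI)
      fix x y assume xy: "(x, y) \<in> tensor_rel I r"
      have "\<forall>i\<in>I. \<exists>s\<in>basis (C i). (x i, y i) \<in> s \<and> s \<subseteq> r i"
      proof
        fix i assume i: "i \<in> I"
        then have "(x i, y i) \<in> r i" using xy unfolding mem_tensor_rel by blast
        then show "\<exists>s\<in>basis (C i). (x i, y i) \<in> s \<and> s \<subseteq> r i"
          by (metis coh.rels_basis[OF cohI[OF i] assms[OF i]])
      qed
      then obtain s where s: "\<forall>i\<in>I. s i \<in> basis (C i) \<and> (x i, y i) \<in> s i \<and> s i \<subseteq> r i" by metis
      then have "restrict s I \<in> {s \<in> B. \<forall>i\<in>I. s i \<subseteq> r i}" by auto
      moreover have "(x, y) \<in> tensor_rel I (restrict s I)"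
        using s xy unfolding mem_tensor_rel by auto
      ultimately show "(x, y) \<in> \<Union>?T" by blast
    qed
  qed
  then show ?thesis
    unfolding rels_def is_relation_def tensor_def by (intro CollectI exI[of _ ?T]) auto
qed

lemma nums:
  assumes "r \<in> B" "s \<in> B" "t \<in> B" "(x, y) \<in> tensor_rel I t"
  shows "card {z \<in> P. (x, z) \<in> tensor_rel I r \<and> (z, y) \<in> tensor_rel I s} =
    (\<Prod>i\<in>I. inters_num (C i) (r i) (s i) (t i))"
proof -
  have xy: "x \<in> extensional I" "y \<in> extensional I" "\<And>i. i \<in> I \<Longrightarrow> (x i, y i) \<in> t i"
    using assms(4) unfolding mem_tensor_rel by auto
  have "card {z \<in> points (C i). (x i, z) \<in> r i \<and> (z, y i) \<in> s i} = inters_num (C i) (r i) (s i) (t i)"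
    if i: "i \<in> I" for i
    using coh.inters_num[OF cohI[OF i] _ _ _ xy(3)[OF i], of "r i" "s i"]
      PiE_mem[OF assms(1) i] PiE_mem[OF assms(2) i] PiE_mem[OF assms(3) i] by simp
  then show ?thesis unfolding tensor_rel_paths[OF finI xy(1,2)] by (rule prod.cong[OF refl])
qed

lemma coherent_tensor: "coherent (tensor I C)"
proof -
  have finP: "finite P" using coh.fin[OF cohI] finI by (intro finite_PiE) auto
  have part: "partition_on (P \<times> P) (tensor_rel I ` B)"
  proof (rule partition_onI)
    show "\<Union>(tensor_rel I ` B) = P \<times> P"
    proof
      show "\<Union>(tensor_rel I ` B) \<subseteq> P \<times> P" using sub_points by blast
      show "P \<times> P \<subseteq> \<Union>(tensor_rel I ` B)"
      proof
        fix p assume "p \<in> P \<times> P"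
        then obtain x y where xy: "p = (x, y)" "x \<in> P" "y \<in> P" by blast
        obtain s where "s \<in> B" "(x, y) \<in> tensor_rel I s" using cover[OF xy(2,3)] .
        then show "p \<in> \<Union>(tensor_rel I ` B)" unfolding xy(1) by blast
      qed
    qed
    show "{} \<notin> tensor_rel I ` B" using ne by fastforce
    show "disjnt p q" if "p \<in> tensor_rel I ` B" "q \<in> tensor_rel I ` B" "p \<noteq> q" for p q
      using that uniq unfolding disjnt_def by blast
  qed
  have "tensor_rel I (\<lambda>i. Id_on (points (C i))) \<in> rels (tensor I C)"
    using coh.id_rel[OF cohI] unfolding rels_def[of "C _"] by (intro is_rel) (simp add: rels_def)
  then have id: "is_relation (tensor I C) (Id_on P)"
    unfolding tensor_rel_Id_on rels_def by simp
  have conv: "(tensor_rel I s)\<inverse> \<in> tensor_rel I ` B" if s: "s \<in> B" for s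
  proof (rule image_eqI)
    show "(tensor_rel I s)\<inverse> = tensor_rel I (\<lambda>i\<in>I. (s i)\<inverse>)"
      unfolding conv_tensor_rel by (rule tensor_rel_cong) simp
    show "(\<lambda>i\<in>I. (s i)\<inverse>) \<in> B" using s coh.conv_basis[OF cohI] by auto
  qed
  have int: "\<exists>k. \<forall>(\<alpha>, \<beta>)\<in>tensor_rel I t.
      card {\<gamma> \<in> P. (\<alpha>, \<gamma>) \<in> tensor_rel I r \<and> (\<gamma>, \<beta>) \<in> tensor_rel I s} = k"
    if "r \<in> B" "s \<in> B" "t \<in> B" for r s t
    by (intro exI[of _ "\<Prod>i\<in>I. inters_num (C i) (r i) (s i) (t i)"]) (auto simp: nums[OF that])
  show ?thesis
    unfolding coherent_def using id finP part conv int unfolding tensor_def by auto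
qed

lemma inters_num_tensor:
  assumes "r \<in> B" "s \<in> B" "t \<in> B"
  shows "inters_num (tensor I C) (tensor_rel I r) (tensor_rel I s) (tensor_rel I t) =
    (\<Prod>i\<in>I. inters_num (C i) (r i) (s i) (t i))"
proof -
  interpret T: coh "tensor I C" using coherent_tensor by unfold_locales
  obtain x y where xy: "(x, y) \<in> tensor_rel I t" using ne[OF assms(3)] by blast
  have b: "tensor_rel I r \<in> basis (tensor I C)" "tensor_rel I s \<in> basis (tensor I C)"
    "tensor_rel I t \<in> basis (tensor I C)" using assms unfolding tensor_def by auto
  show ?thesis using T.inters_num[OF b xy] nums[OF assms xy] unfolding tensor_def by simp
qed

end

text \<open>\<phi> acts on basis relations only, so being fixed is tested on them. Diagonal and
  converse are respected because they are determined by intersection numbers, and path counts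
  because they are sums of such numbers.\<close>

lemma invariant_family:
  assumes C: "coherent C" and \<phi>: "alg_iso C C \<phi>"
  shows "coherent_family (points C) {r \<in> rels C. \<forall>s\<in>basis C. s \<subseteq> r \<longleftrightarrow> \<phi> s \<subseteq> r}"
    (is "coherent_family ?V ?F")
proof (rule coherent_familyI)
  interpret coh C using C by unfold_locales
  note pb = alg_iso_basis[OF \<phi>]
  have mem: "r \<in> ?F \<longleftrightarrow> r \<in> rels C \<and> (\<forall>s\<in>basis C. s \<subseteq> r \<longleftrightarrow> \<phi> s \<subseteq> r)" for r by simp
  show "Id_on ?V \<in> ?F"
    unfolding mem
  proof (intro conjI ballI)
    fix s assume s: "s \<in> basis C"
    have *: "t \<subseteq> Id_on ?V \<longleftrightarrow> t \<subseteq> Id" if "t \<in> basis C" for t using basis_sub[OF that] by auto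
    show "s \<subseteq> Id_on ?V \<longleftrightarrow> \<phi> s \<subseteq> Id_on ?V"
      using alg_iso_diag[OF C C \<phi> s] *[OF s] *[OF pb[OF s]] by simp
  qed (rule id_mem)
  fix r assume r: "r \<in> ?F"
  then have r1: "r \<in> rels C" and r2: "\<And>s. s \<in> basis C \<Longrightarrow> s \<subseteq> r \<longleftrightarrow> \<phi> s \<subseteq> r" by auto
  show "r \<subseteq> ?V \<times> ?V" by (rule rels_sub[OF r1])
  show "?V \<times> ?V - r \<in> ?F"
    unfolding mem
  proof (intro conjI ballI)
    show "?V \<times> ?V - r \<in> rels C" by (rule compl_mem[OF r1])
    fix s assume s: "s \<in> basis C"
    show "s \<subseteq> ?V \<times> ?V - r \<longleftrightarrow> \<phi> s \<subseteq> ?V \<times> ?V - r"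
      unfolding basis_sub_compl[OF s r1] basis_sub_compl[OF pb[OF s] r1] r2[OF s] ..
  qed
  show "r\<inverse> \<in> ?F"
    unfolding mem
  proof (intro conjI ballI)
    show "r\<inverse> \<in> rels C" by (rule conv_mem[OF r1])
    fix s assume s: "s \<in> basis C"
    have *: "t \<subseteq> r\<inverse> \<longleftrightarrow> t\<inverse> \<subseteq> r" for t by auto
    show "s \<subseteq> r\<inverse> \<longleftrightarrow> \<phi> s \<subseteq> r\<inverse>"
      unfolding * using r2[OF conv_basis[OF s]] alg_iso_conv[OF C C \<phi> s] by simp
  qed
  fix s assume s: "s \<in> ?F"
  then have s1: "s \<in> rels C" and s2: "\<And>t. t \<in> basis C \<Longrightarrow> t \<subseteq> s \<longleftrightarrow> \<phi> t \<subseteq> s" by auto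
  show "r \<union> s \<in> ?F"
    unfolding mem
  proof (intro conjI ballI)
    show "r \<union> s \<in> rels C" by (rule un_mem[OF r1 s1])
    fix t assume t: "t \<in> basis C"
    show "t \<subseteq> r \<union> s \<longleftrightarrow> \<phi> t \<subseteq> r \<union> s"
      unfolding basis_sub_un[OF t r1 s1] basis_sub_un[OF pb[OF t] r1 s1] r2[OF t] s2[OF t] ..
  qed
  show "paths ?V r s n \<in> ?F" for n
    unfolding mem
  proof (intro conjI ballI)
    show "paths ?V r s n \<in> rels C" by (rule paths_mem[OF r1 s1])
    let ?Sum = "\<lambda>t. \<Sum>(p, q)\<in>{p \<in> basis C. p \<subseteq> r} \<times> {q \<in> basis C. q \<subseteq> s}. inters_num C p q t"
    have key: "t \<subseteq> paths ?V r s n \<longleftrightarrow> ?Sum t = n" if t: "t \<in> basis C" for t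
    proof -
      have "t \<subseteq> paths ?V r s (?Sum t)"
      proof (rule subrelI)
        fix x y assume xy: "(x, y) \<in> t"
        then have "x \<in> ?V" "y \<in> ?V" using basis_sub[OF t] by auto
        then show "(x, y) \<in> paths ?V r s (?Sum t)"
          using card_paths[OF r1 s1 t xy] unfolding paths_def by simp
      qed
      moreover obtain p where "p \<in> t" using basis_ne[OF t] by auto
      ultimately show ?thesis using paths_unique[of p ?V r s n "?Sum t"] by blast
    qed
    fix t assume t: "t \<in> basis C"
    have b: "bij_betw \<phi> {p \<in> basis C. p \<subseteq> r} {p \<in> basis C. p \<subseteq> r}" 
      if r2: "\<And>s. s \<in> basis C \<Longrightarrow> s \<subseteq> r \<longleftrightarrow> \<phi> s \<subseteq> r" for r
    proof (rule bij_betw_imageI)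
      note b = alg_iso_bij[OF \<phi>]
      show "inj_on \<phi> {p \<in> basis C. p \<subseteq> r}"
        using b unfolding bij_betw_def inj_on_def by simp
      show "\<phi> ` {p \<in> basis C. p \<subseteq> r} = {p \<in> basis C. p \<subseteq> r}"
      proof
        show "\<phi> ` {p \<in> basis C. p \<subseteq> r} \<subseteq> {p \<in> basis C. p \<subseteq> r}" using r2 pb by blast
        show "{p \<in> basis C. p \<subseteq> r} \<subseteq> \<phi> ` {p \<in> basis C. p \<subseteq> r}"
        proof
          fix q assume q: "q \<in> {p \<in> basis C. p \<subseteq> r}"
          then obtain p where p: "p \<in> basis C" "q = \<phi> p" using b unfolding bij_betw_def by blast
          then show "q \<in> \<phi> ` {p \<in> basis C. p \<subseteq> r}" using q r2 by auto
        qed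
      qed
    qed
    \<comment> \<open>\<phi> permutes the basis relations inside r and those inside s; both sums are
      reindexed by it before the intersection numbers are compared.\<close>
    have "?Sum (\<phi> t) = (\<Sum>p\<in>{p \<in> basis C. p \<subseteq> r}. \<Sum>q\<in>{q \<in> basis C. q \<subseteq> s}. inters_num C p q (\<phi> t))"
      by (simp add: sum.cartesian_product)
    also have "\<dots> = (\<Sum>p\<in>{p \<in> basis C. p \<subseteq> r}. \<Sum>q\<in>{q \<in> basis C. q \<subseteq> s}. inters_num C (\<phi> p) q (\<phi> t))"
      by (rule sum.reindex_bij_betw[OF b[OF r2], symmetric])
    also have "\<dots> = (\<Sum>p\<in>{p \<in> basis C. p \<subseteq> r}. \<Sum>q\<in>{q \<in> basis C. q \<subseteq> s}. inters_num C (\<phi> p) (\<phi> q) (\<phi> t))"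
      by (intro sum.cong[OF refl] sum.reindex_bij_betw[OF b[OF s2], symmetric])
    also have "\<dots> = (\<Sum>p\<in>{p \<in> basis C. p \<subseteq> r}. \<Sum>q\<in>{q \<in> basis C. q \<subseteq> s}. inters_num C p q t)"
      by (intro sum.cong[OF refl] alg_iso_num[OF \<phi>]) (use t in auto)
    also have "\<dots> = ?Sum t" by (simp add: sum.cartesian_product)
    finally show "t \<subseteq> paths ?V r s n \<longleftrightarrow> \<phi> t \<subseteq> paths ?V r s n"
      using key[OF t] key[OF pb[OF t]] by simp
  qed
qed

section \<open>Arcs by direction, and the bound by the exponentiation\<close>

definition arcs_in_dir :: "'i set \<Rightarrow> ('i \<Rightarrow> 'a pair_pre_digraph) \<Rightarrow> 'i \<Rightarrow> ('i \<Rightarrow> 'a) rel" where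
  "arcs_in_dir I X i = {(x, y). x \<in> (\<Pi>\<^sub>E i\<in>I. pverts (X i)) \<and> y \<in> (\<Pi>\<^sub>E i\<in>I. pverts (X i)) \<and>
     (x i, y i) \<in> parcs (X i) \<and> (\<forall>j\<in>I - {i}. x j = y j)}"

lemma pverts_cart_prod: "pverts (cart_prod I X) = (\<Pi>\<^sub>E i\<in>I. pverts (X i))"
  unfolding cart_prod_def by simp

lemma parcs_cart_prod: "parcs (cart_prod I X) = (\<Union>i\<in>I. arcs_in_dir I X i)"
  unfolding cart_prod_def arcs_in_dir_def by auto

lemma fin_graph_cart_prod:
  "finite I \<Longrightarrow> (\<And>i. i \<in> I \<Longrightarrow> fin_graph (X i)) \<Longrightarrow> fin_graph (cart_prod I X)"
  unfolding fin_graph_def pverts_cart_prod parcs_cart_prod arcs_in_dir_def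
  by (auto intro!: finite_PiE)

text \<open>With one arc factor and diagonal factors elsewhere, a direction is visibly a relation of
  the tensor product, and permuting the factors turns it into another direction.\<close>

lemma arcs_in_dir_tensor_rel:
  assumes "\<forall>i\<in>I. fin_graph (X i)" "i \<in> I"
  shows "arcs_in_dir I X i =
    tensor_rel I (\<lambda>j. if j = i then parcs (X j) else Id_on (pverts (X j)))"
proof (rule set_eqI)
  fix p :: "('a \<Rightarrow> 'b) \<times> ('a \<Rightarrow> 'b)"
  obtain x y where p: "p = (x, y)" by (cases p)
  have *: "(x i, y i) \<in> parcs (X i) \<Longrightarrow> x i \<in> pverts (X i) \<and> y i \<in> pverts (X i)"
    using assms unfolding fin_graph_def by blast
  show "p \<in> arcs_in_dir I X i \<longleftrightarrow>
    p \<in> tensor_rel I (\<lambda>j. if j = i then parcs (X j) else Id_on (pverts (X j)))" (is "?L \<longleftrightarrow> ?R")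
  proof
    assume ?L
    then show ?R unfolding p arcs_in_dir_def mem_tensor_rel by (auto simp: PiE_iff)
  next
    assume r: ?R
    have j: "x j = y j \<and> x j \<in> pverts (X j)" if "j \<in> I" "j \<noteq> i" for j
      using r that unfolding p mem_tensor_rel by fastforce
    have i: "(x i, y i) \<in> parcs (X i)" using r assms(2) unfolding p mem_tensor_rel by auto
    have "x l \<in> pverts (X l) \<and> y l \<in> pverts (X l)" if "l \<in> I" for l
      using j[of l] *[OF i] that by (cases "l = i") auto
    then show ?L
      using r i j unfolding p mem_tensor_rel arcs_in_dir_def PiE_iff by auto
  qed
qed

lemma arcs_rels_tensor:
  assumes I: "finite I" and X: "\<And>i. i \<in> I \<Longrightarrow> fin_graph (X i)"
  shows "i \<in> I \<Longrightarrow> arcs_in_dir I X i \<in> rels (tensor I (\<lambda>i. WL (X i)))"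
    and "parcs (cart_prod I X) \<in> rels (tensor I (\<lambda>i. WL (X i)))"
proof -
  interpret T: coh_tensor I "\<lambda>i. WL (X i)" using I coherent_WL[OF X] by unfold_locales
  interpret TC: coh "tensor I (\<lambda>i. WL (X i))" using T.coherent_tensor by unfold_locales
  have X': "\<forall>i\<in>I. fin_graph (X i)" using X by blast
  show dir: "arcs_in_dir I X i \<in> rels (tensor I (\<lambda>i. WL (X i)))" if i: "i \<in> I" for i
    unfolding arcs_in_dir_tensor_rel[OF X' i]
  proof (rule T.is_rel)
    fix j assume j: "j \<in> I"
    show "(if j = i then parcs (X j) else Id_on (pverts (X j))) \<in> rels (WL (X j))"
      unfolding rels_WL[OF X[OF j]] by (auto intro: WL_rels.intros)
  qed
  show "parcs (cart_prod I X) \<in> rels (tensor I (\<lambda>i. WL (X i)))"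
    unfolding parcs_cart_prod using dir by (intro TC.Union_mem) blast
qed

lemma WL_le_exponentiation:
  assumes I: "finite I" and X: "\<And>i. i \<in> I \<Longrightarrow> fin_graph (X i)"
    and sys: "alg_iso_system I (\<lambda>i. WL (X i)) \<phi>"
    and iso: "\<And>i j. i \<in> I \<Longrightarrow> j \<in> I \<Longrightarrow> WL_iso (X i) (X j) (\<phi> i j)"
    and G: "\<And>g. g \<in> G \<Longrightarrow> g permutes I" "id \<in> G"
  shows "config_le (WL (cart_prod I X)) (exponentiation I (\<lambda>i. WL (X i)) \<phi> G)"
proof -
  let ?C = "\<lambda>i. WL (X i)" and ?W = "WL (cart_prod I X)"
  have sys_id: "\<phi> i i s = s" if "i \<in> I" "s \<in> basis (?C i)" for i s
    using sys that unfolding alg_iso_system_def by simp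
  have sys_comp: "\<phi> j k (\<phi> i j s) = \<phi> i k s"
    if "i \<in> I" "j \<in> I" "k \<in> I" "s \<in> basis (?C i)" for i j k s
    using sys that unfolding alg_iso_system_def by simp
  have finP: "fin_graph (cart_prod I X)" by (rule fin_graph_cart_prod[OF I X])
  interpret T: coh_tensor I ?C using I coherent_WL[OF X] by unfold_locales
  interpret TC: coh "tensor I ?C" using T.coherent_tensor by unfold_locales
  have pts: "points (tensor I ?C) = pverts (cart_prod I X)"
    unfolding tensor_def pverts_cart_prod using points_WL[OF X] by (auto intro!: PiE_cong)
  have basisT: "basis (tensor I ?C) = tensor_rel I ` T.B" unfolding tensor_def by simp
  let ?act = "\<lambda>g s. \<lambda>i\<in>I. \<phi> (inv g i) i (s (inv g i))"
  \<comment> \<open>A basis relation is never spread over several directions, since each direction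
    is itself a relation of the tensor product.\<close>
  have arcs_sub: "tensor_rel I s \<subseteq> parcs (cart_prod I X) \<longleftrightarrow>
      (\<exists>i\<in>I. s i \<subseteq> parcs (X i) \<and> (\<forall>j\<in>I - {i}. s j \<subseteq> Id))" if s: "s \<in> T.B" for s
  proof -
    have ar: "\<forall>i\<in>I. fin_graph (X i)" using X by blast
    have sub1: "tensor_rel I s \<subseteq> arcs_in_dir I X i \<longleftrightarrow>
        s i \<subseteq> parcs (X i) \<and> (\<forall>j\<in>I - {i}. s j \<subseteq> Id)" if i: "i \<in> I" for i
    proof -
      have "s j \<subseteq> Id_on (pverts (X j)) \<longleftrightarrow> s j \<subseteq> Id" if j: "j \<in> I" for j
      proof -
        have "s j \<subseteq> pverts (X j) \<times> pverts (X j)"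
          using coh.basis_sub[OF T.cohI[OF j], of "s j"] s j points_WL[OF X[OF j]] by auto
        then show ?thesis by auto
      qed
      then show ?thesis
        using i arcs_in_dir_tensor_rel[OF ar i] T.sub_iff[OF s] by auto
    qed
    have sB: "tensor_rel I s \<in> basis (tensor I ?C)" unfolding basisT using s by blast
    have "tensor_rel I s \<subseteq> (\<Union>i\<in>I. arcs_in_dir I X i) \<longleftrightarrow> (\<exists>i\<in>I. tensor_rel I s \<subseteq> arcs_in_dir I X i)"
    proof
      assume a: "tensor_rel I s \<subseteq> (\<Union>i\<in>I. arcs_in_dir I X i)"
      obtain x y where xy: "(x, y) \<in> tensor_rel I s" using T.ne[OF s] by blast
      then obtain i where i: "i \<in> I" "(x, y) \<in> arcs_in_dir I X i" using a by blast
      then have "tensor_rel I s \<subseteq> arcs_in_dir I X i" using TC.rels_cases[OF arcs_rels_tensor(1)[OF I X i(1)] sB] xy by blast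
      then show "\<exists>i\<in>I. tensor_rel I s \<subseteq> arcs_in_dir I X i" using i by blast
    qed blast
    then show ?thesis
      unfolding parcs_cart_prod by (simp only:) (rule bex_cong[OF refl sub1])
  qed
  have act_inv: "inv g i \<in> I" if "g \<in> G" "i \<in> I" for g i
    using permutes_in_image[OF permutes_inv[OF G(1)[OF that(1)]]] that(2) by simp
  have gi: "g (inv g i) = i" "inv g (g i) = i" if "g \<in> G" for g i
    using permutes_inverses[OF G(1)[OF that]] by auto
  have gI: "g i \<in> I" if "g \<in> G" "i \<in> I" for g i
    using permutes_in_image[OF G(1)[OF that(1)]] that(2) by simp
  have actB: "?act g s \<in> T.B" if "g \<in> G" "s \<in> T.B" for g s
    by (intro PiE_I) (simp_all add: alg_iso_basis[OF WL_iso_alg[OF iso]] act_inv that PiE_mem[OF that(2)])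
  \<comment> \<open>The action is given on families of factors. A product of nonempty relations
    determines its factors, so the action descends to the basis relations of the tensor
    product.\<close>
  have inv: "\<exists>\<psi>. alg_iso (tensor I ?C) (tensor I ?C) \<psi> \<and>
      (\<forall>s\<in>T.B. \<psi> (tensor_rel I s) = tensor_rel I (?act g s))" if g: "g \<in> G" for g
  proof -
    let ?d = "the_inv_into T.B (tensor_rel I)"
    have inj: "inj_on (tensor_rel I) T.B" using T.uniq T.ne by (intro inj_onI) metis
    let ?\<psi> = "\<lambda>r. tensor_rel I (?act g (?d r))"
    have psi: "?\<psi> (tensor_rel I s) = tensor_rel I (?act g s)" if "s \<in> T.B" for s
      using the_inv_into_f_f[OF inj that] by simp
    note gi = gi[OF g] and gI = gI[OF g]
    have bij: "bij_betw (?act g) T.B T.B"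
    proof (rule bij_betw_imageI)
      show "inj_on (?act g) T.B"
      proof (rule inj_onI)
        fix s t assume st: "s \<in> T.B" "t \<in> T.B" "?act g s = ?act g t"
        show "s = t"
        proof (rule PiE_ext[OF st(1,2)])
          fix i assume i: "i \<in> I"
          have "\<phi> i (g i) (s i) = \<phi> i (g i) (t i)"
            using fun_cong[OF st(3), of "g i"] gI[OF i] gi by simp
          then show "s i = t i"
            by (rule inj_onD[OF bij_betw_imp_inj_on[OF alg_iso_bij[OF WL_iso_alg[OF iso[OF i gI[OF i]]]]]])
              (use PiE_mem[OF st(1) i] PiE_mem[OF st(2) i] in simp_all)
        qed
      qed
      show "?act g ` T.B = T.B"
      proof
        show "?act g ` T.B \<subseteq> T.B" using actB[OF g] by blast
        show "T.B \<subseteq> ?act g ` T.B"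
        proof
          fix t assume t: "t \<in> T.B"
          \<comment> \<open>The preimage of t: the action carries factor i to position g i, so the
            factor of t found there is transported back; the cocycle condition cancels the two
            transports.\<close>
          let ?s = "\<lambda>i\<in>I. \<phi> (g i) i (t (g i))"
          have s: "?s \<in> T.B"
            by (intro PiE_I) (simp_all add: alg_iso_basis[OF WL_iso_alg[OF iso]] gI PiE_mem[OF t])
          have "?act g ?s = t"
          proof (rule PiE_ext[OF actB[OF g s] t])
            fix i assume i: "i \<in> I"
            have "?act g ?s i = \<phi> (inv g i) i (\<phi> i (inv g i) (t i))"
              using i act_inv[OF g i] gi by simp
            also have "\<dots> = \<phi> i i (t i)"
              by (rule sys_comp[OF i act_inv[OF g i] i PiE_mem[OF t i]])
            also have "\<dots> = t i" by (rule sys_id[OF i PiE_mem[OF t i]])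
            finally show "?act g ?s i = t i" .
          qed
          then show "t \<in> ?act g ` T.B" using s by (intro image_eqI[of _ _ ?s]) simp_all
        qed
      qed
    qed
    have "alg_iso (tensor I ?C) (tensor I ?C) ?\<psi>"
      unfolding alg_iso_def
    proof (intro conjI ballI)
      have "bij_betw (tensor_rel I) T.B (basis (tensor I ?C))"
        unfolding basisT using inj by (rule inj_on_imp_bij_betw)
      from bij_betw_trans[OF bij_betw_the_inv_into[OF this] bij_betw_trans[OF bij this]]
      show "bij_betw ?\<psi> (basis (tensor I ?C)) (basis (tensor I ?C))" by (simp add: comp_def)
      fix r s t assume "r \<in> basis (tensor I ?C)" "s \<in> basis (tensor I ?C)" "t \<in> basis (tensor I ?C)"
      then obtain r' s' t' where b: "r' \<in> T.B" "s' \<in> T.B" "t' \<in> T.B" and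
        eq: "r = tensor_rel I r'" "s = tensor_rel I s'" "t = tensor_rel I t'" unfolding basisT by blast
      \<comment> \<open>After reindexing by g, the factor at position g i is the image under
        \<open>\<phi> i (g i)\<close> of the one at i, and this map keeps intersection
        numbers.\<close>
      have "(\<Prod>i\<in>I. inters_num (?C i) (?act g r' i) (?act g s' i) (?act g t' i)) =
        (\<Prod>i\<in>I. inters_num (?C (g i)) (?act g r' (g i)) (?act g s' (g i)) (?act g t' (g i)))"
        by (rule prod.reindex_bij_betw[OF permutes_imp_bij[OF G(1)[OF g]], symmetric])
      also have "\<dots> = (\<Prod>i\<in>I. inters_num (?C i) (r' i) (s' i) (t' i))"
      proof (rule prod.cong[OF refl])
        fix i assume i: "i \<in> I"
        have "inters_num (?C (g i)) (\<phi> i (g i) (r' i)) (\<phi> i (g i) (s' i)) (\<phi> i (g i) (t' i)) =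
          inters_num (?C i) (r' i) (s' i) (t' i)"
          by (rule alg_iso_num[OF WL_iso_alg[OF iso[OF i gI[OF i]]]
                PiE_mem[OF b(1) i] PiE_mem[OF b(2) i] PiE_mem[OF b(3) i]])
        then show "inters_num (?C (g i)) (?act g r' (g i)) (?act g s' (g i)) (?act g t' (g i)) =
          inters_num (?C i) (r' i) (s' i) (t' i)" using gI[OF i] gi by simp
      qed
      finally show "inters_num (tensor I ?C) (?\<psi> r) (?\<psi> s) (?\<psi> t) = inters_num (tensor I ?C) r s t"
        unfolding eq psi[OF b(1)] psi[OF b(2)] psi[OF b(3)]
        using T.inters_num_tensor[OF b] T.inters_num_tensor[OF actB[OF g b(1)] actB[OF g b(2)] actB[OF g b(3)]]
        by simp
    qed
    then show ?thesis using psi by blast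
  qed
  have invariant: "r \<in> rels (tensor I ?C) \<and> (\<forall>s\<in>T.B. tensor_rel I s \<subseteq> r \<longleftrightarrow> tensor_rel I (?act g s) \<subseteq> r)"
    if r: "r \<in> WL_rels (cart_prod I X)" and g: "g \<in> G" for r g
  proof -
    obtain \<psi> where \<psi>: "alg_iso (tensor I ?C) (tensor I ?C) \<psi>"
      and act: "\<And>s. s \<in> T.B \<Longrightarrow> \<psi> (tensor_rel I s) = tensor_rel I (?act g s)"
      using inv[OF g] by blast
    let ?F = "{r \<in> rels (tensor I ?C). \<forall>s\<in>basis (tensor I ?C). s \<subseteq> r \<longleftrightarrow> \<psi> s \<subseteq> r}"
    have "WL_rels (cart_prod I X) \<subseteq> ?F"
    proof (rule WL_rels_least)
      show "coherent_family (pverts (cart_prod I X)) ?F"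
        using invariant_family[OF T.coherent_tensor \<psi>] unfolding pts .
      have "parcs (cart_prod I X) \<in> rels (tensor I ?C)" by (rule arcs_rels_tensor(2)[OF I X])
      moreover have "s \<subseteq> parcs (cart_prod I X) \<longleftrightarrow> \<psi> s \<subseteq> parcs (cart_prod I X)"
        if s: "s \<in> basis (tensor I ?C)" for s
      proof -
        obtain s' where s': "s' \<in> T.B" "s = tensor_rel I s'" using s unfolding basisT by blast
        let ?t = "?act g s'"
        note gi = gi[OF g] and gI = gI[OF g]
        have t1: "?t (g i) \<subseteq> parcs (X (g i)) \<longleftrightarrow> s' i \<subseteq> parcs (X i)" if i: "i \<in> I" for i
          using WL_iso_arcs[OF X[OF i] X[OF gI[OF i]] iso[OF i gI[OF i]] PiE_mem[OF s'(1) i]]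
            gI[OF i] gi by simp
        have t2: "?t (g i) \<subseteq> Id \<longleftrightarrow> s' i \<subseteq> Id" if i: "i \<in> I" for i
          using alg_iso_diag[OF coherent_WL[OF X[OF i]] coherent_WL[OF X[OF gI[OF i]]]
              WL_iso_alg[OF iso[OF i gI[OF i]]] PiE_mem[OF s'(1) i]] gI[OF i] gi by simp
        have im: "g ` I = I" by (rule permutes_image[OF G(1)[OF g]])
        let ?P = "\<lambda>i. ?t i \<subseteq> parcs (X i) \<and> (\<forall>j\<in>I - {i}. ?t j \<subseteq> Id)"
        have P: "?P (g i) \<longleftrightarrow> s' i \<subseteq> parcs (X i) \<and> (\<forall>j\<in>I - {i}. s' j \<subseteq> Id)" if i: "i \<in> I" for i
        proof -
          have "I - {g i} = g ` (I - {i})"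
            using im inj_on_image_set_diff[OF permutes_inj_on[OF G(1)[OF g]], of I "{i}" I] i by auto
          then have "(\<forall>j\<in>I - {g i}. ?t j \<subseteq> Id) \<longleftrightarrow> (\<forall>j\<in>I - {i}. ?t (g j) \<subseteq> Id)" by simp
          also have "\<dots> \<longleftrightarrow> (\<forall>j\<in>I - {i}. s' j \<subseteq> Id)" by (rule ball_cong[OF refl]) (use t2 in blast)
          finally show ?thesis using t1[OF i] by blast
        qed
        have "(\<exists>i\<in>I. ?P i) \<longleftrightarrow> (\<exists>i\<in>g ` I. ?P i)" unfolding im ..
        also have "\<dots> \<longleftrightarrow> (\<exists>i\<in>I. ?P (g i))" by blast
        also have "\<dots> \<longleftrightarrow> (\<exists>i\<in>I. s' i \<subseteq> parcs (X i) \<and> (\<forall>j\<in>I - {i}. s' j \<subseteq> Id))"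
          by (rule bex_cong[OF refl P])
        finally show ?thesis
          unfolding s'(2) act[OF s'(1)] arcs_sub[OF s'(1)] arcs_sub[OF actB[OF g s'(1)]] by simp
      qed
      ultimately show "parcs (cart_prod I X) \<in> ?F" by simp
    qed
    then show ?thesis using r act unfolding basisT by (auto simp: subset_iff[of "WL_rels _"])
  qed
  show ?thesis
    unfolding config_le_def
  proof (intro conjI ballI)
    let ?E = "exponentiation I ?C \<phi> G"
    show "points ?W = points ?E"
      using points_WL[OF finP] pts unfolding exponentiation_def tensor_def by simp
    fix r assume "r \<in> basis ?W"
    then have r: "r \<in> WL_rels (cart_prod I X)"
      using coh.basis_rels[of ?W] coherent_WL[OF finP] rels_WL[OF finP] unfolding coh_def by simp
    let ?orb = "\<lambda>s. \<Union>g\<in>G. tensor_rel I (?act g s)"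
    have id: "?act id s = s" if s: "s \<in> T.B" for s
    proof (rule PiE_ext[OF actB[OF G(2) s] s])
      fix i assume i: "i \<in> I"
      then show "?act id s i = s i" using sys_id[OF i PiE_mem[OF s i]] by simp
    qed
    have rT: "r \<in> rels (tensor I ?C)" using invariant[OF r G(2)] by blast
    \<comment> \<open>Invariance puts whole orbits inside r. Conversely the identity in G places
      each basis relation inside its own orbit.\<close>
    have "r = \<Union>(?orb ` {s \<in> T.B. tensor_rel I s \<subseteq> r})"
    proof
      show "\<Union>(?orb ` {s \<in> T.B. tensor_rel I s \<subseteq> r}) \<subseteq> r" using invariant[OF r] by blast
      show "r \<subseteq> \<Union>(?orb ` {s \<in> T.B. tensor_rel I s \<subseteq> r})"
      proof
        fix p assume "p \<in> r"
        with rT obtain s' where s': "s' \<in> basis (tensor I ?C)" "p \<in> s'" "s' \<subseteq> r"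
          by (rule TC.rels_basis)
        then obtain s where s: "s \<in> T.B" "p \<in> tensor_rel I s" "tensor_rel I s \<subseteq> r"
          unfolding basisT by blast
        have "p \<in> ?orb s" by (rule UN_I[OF G(2)]) (use s(2) id[OF s(1)] in simp)
        then show "p \<in> \<Union>(?orb ` {s \<in> T.B. tensor_rel I s \<subseteq> r})" using s by blast
      qed
    qed
    then show "is_relation ?E r"
      unfolding is_relation_def exponentiation_def by (auto intro!: exI[of _ "?orb ` {s \<in> T.B. tensor_rel I s \<subseteq> r}"])
  qed
qed

subsection \<open>Lifting relations to a Cartesian product\<close>

definition lift_rel :: "'i set \<Rightarrow> ('i \<Rightarrow> 'a set) \<Rightarrow> 'i \<Rightarrow> 'a rel \<Rightarrow> ('i \<Rightarrow> 'a) rel" where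
  "lift_rel K V k r = {(x, y). x \<in> Pi\<^sub>E K V \<and> y \<in> Pi\<^sub>E K V \<and> (x k, y k) \<in> r \<and>
     (\<forall>l\<in>K - {k}. x l = y l)}"

lemma mem_lift_rel: "(x, y) \<in> lift_rel K V k r \<longleftrightarrow> x \<in> Pi\<^sub>E K V \<and> y \<in> Pi\<^sub>E K V \<and> (x k, y k) \<in> r \<and>
     (\<forall>l\<in>K - {k}. x l = y l)"
  unfolding lift_rel_def by simp

lemma PiE_upd: "x \<in> Pi\<^sub>E K V \<Longrightarrow> k \<in> K \<Longrightarrow> c \<in> V k \<Longrightarrow> x(k := c) \<in> Pi\<^sub>E K V"
  by (auto simp: PiE_iff extensional_def)

lemma agree_upd:
  "x \<in> Pi\<^sub>E K V \<Longrightarrow> y \<in> Pi\<^sub>E K V \<Longrightarrow> \<forall>l\<in>K - {k}. x l = y l \<Longrightarrow> x(k := y k) = y"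
proof (rule ext)
  fix i assume a: "x \<in> Pi\<^sub>E K V" "y \<in> Pi\<^sub>E K V" "\<forall>l\<in>K - {k}. x l = y l"
  have "x i = y i" if "i \<noteq> k"
    using a(3) that PiE_arb[OF a(1), of i] PiE_arb[OF a(2), of i] by (cases "i \<in> K") auto
  then show "(x(k := y k)) i = y i" by simp
qed

lemma arcs_in_dir_lift: "arcs_in_dir K Y k = lift_rel K (\<lambda>k. pverts (Y k)) k (parcs (Y k))"
  unfolding arcs_in_dir_def lift_rel_def ..

text \<open>The relations on one coordinate whose lift is a relation of the product form a coherent
  family, so they include all relations of the factor.\<close>
lemma WL_rels_lift:
  assumes K: "finite K" and Y: "\<And>k. k \<in> K \<Longrightarrow> fin_graph (Y k)"
    and con: "\<And>k x y. k \<in> K \<Longrightarrow> x \<in> pverts (Y k) \<Longrightarrow> y \<in> pverts (Y k) \<Longrightarrow> (x, y) \<in> (parcs (Y k))\<^sup>*"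
    and dir: "arcs_in_dir K Y k \<in> WL_rels (cart_prod K Y)" and k: "k \<in> K"
    and r: "r \<in> WL_rels (Y k)"
  shows "lift_rel K (\<lambda>k. pverts (Y k)) k r \<in> WL_rels (cart_prod K Y)"
proof -
  let ?V = "\<lambda>k. pverts (Y k)" and ?R = "WL_rels (cart_prod K Y)"
  let ?P = "Pi\<^sub>E K ?V" and ?L = "lift_rel K ?V k"
  have fg: "fin_graph (cart_prod K Y)" by (rule fin_graph_cart_prod[OF K Y])
  have "coh_family ?P ?R"
    using WL_rels_family[OF fg] fg unfolding pverts_cart_prod fin_graph_def by unfold_locales auto
  then interpret W: coh_family ?P ?R .
  let ?F = "{r. r \<subseteq> ?V k \<times> ?V k \<and> ?L r \<in> ?R}"
  have walk: "(x(k := c), x(k := d)) \<in> (arcs_in_dir K Y k)\<^sup>*"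
    if x: "x \<in> ?P" and cd: "(c, d) \<in> (parcs (Y k))\<^sup>*" for x c d
    using cd
  proof (induction rule: rtrancl_induct)
    case (step d e)
    then have "d \<in> ?V k" "e \<in> ?V k" using Y[OF k] unfolding fin_graph_def by auto
    then have "(x(k := d), x(k := e)) \<in> arcs_in_dir K Y k"
      unfolding arcs_in_dir_lift mem_lift_rel using step(2) PiE_upd[OF x k] by simp
    then show ?case by (rule rtrancl_into_rtrancl[OF step(3)])
  qed simp
  \<comment> \<open>The factor is connected, so agreeing outside coordinate k is reachability in
    direction k. Thus the lift of the full relation is a relation of the product; complements and
    path counts of lifts are taken inside it.\<close>
  have par: "?L (?V k \<times> ?V k) = ?P \<times> ?P \<inter> (arcs_in_dir K Y k)\<^sup>*"
  proof (intro equalityI subrelI)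
    fix x y assume "(x, y) \<in> ?L (?V k \<times> ?V k)"
    then have xy: "x \<in> ?P" "y \<in> ?P" "x k \<in> ?V k" "y k \<in> ?V k" "\<forall>l\<in>K - {k}. x l = y l"
      unfolding mem_lift_rel by auto
    have "(x(k := x k), x(k := y k)) \<in> (arcs_in_dir K Y k)\<^sup>*"
      by (intro walk xy con k)
    then show "(x, y) \<in> ?P \<times> ?P \<inter> (arcs_in_dir K Y k)\<^sup>*"
      using xy(1,2) agree_upd[OF xy(1,2,5)] by simp
  next
    fix x y assume a: "(x, y) \<in> ?P \<times> ?P \<inter> (arcs_in_dir K Y k)\<^sup>*"
    then have "(x, y) \<in> (arcs_in_dir K Y k)\<^sup>*" by simp
    then have "\<forall>l\<in>K - {k}. x l = y l"
      by (induction rule: rtrancl_induct) (auto simp: arcs_in_dir_def)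
    then show "(x, y) \<in> ?L (?V k \<times> ?V k)"
      unfolding mem_lift_rel using a PiE_mem[of x K ?V k] PiE_mem[of y K ?V k] k by simp
  qed
  have all: "?L (?V k \<times> ?V k) \<in> ?R" unfolding par by (rule W.rtrancl_mem[OF dir])
  have "coherent_family (?V k) ?F"
  proof (rule coherent_familyI)
    have "?L (Id_on (?V k)) = Id_on ?P"
    proof (intro equalityI subrelI)
      fix x y assume xy: "(x, y) \<in> ?L (Id_on (?V k))"
      then have "x k = y k" unfolding mem_lift_rel by auto
      then have "x = y"
        using xy unfolding mem_lift_rel by (intro PiE_ext[of x K ?V y]) auto
      then show "(x, y) \<in> Id_on ?P" using xy unfolding mem_lift_rel by auto
    qed (use k in \<open>auto simp: mem_lift_rel\<close>)
    then show "Id_on (?V k) \<in> ?F" using W.id_mem by auto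
    fix r assume r: "r \<in> ?F"
    then show "r \<subseteq> ?V k \<times> ?V k" by simp
    have "?L (?V k \<times> ?V k - r) = ?L (?V k \<times> ?V k) - ?L r"
      by (intro equalityI subrelI) (auto simp: mem_lift_rel)
    then show "?V k \<times> ?V k - r \<in> ?F" using W.diff_mem[OF all] r by auto
    have "?L (r\<inverse>) = (?L r)\<inverse>" by (intro equalityI subrelI) (auto simp: mem_lift_rel)
    moreover have "r\<inverse> \<subseteq> ?V k \<times> ?V k" using r by auto
    ultimately show "r\<inverse> \<in> ?F" using W.conv_mem r by simp
    fix s assume s: "s \<in> ?F"
    have "?L (r \<union> s) = ?L r \<union> ?L s" by (intro equalityI subrelI) (auto simp: mem_lift_rel)
    then show "r \<union> s \<in> ?F" using W.un_mem r s by simp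
    fix n
    have card: "card {z \<in> ?P. (x, z) \<in> ?L r \<and> (z, y) \<in> ?L s} = card {c \<in> ?V k. (x k, c) \<in> r \<and> (c, y k) \<in> s}"
      if xy: "(x, y) \<in> ?L (?V k \<times> ?V k)" for x y
    proof -
      have x: "x \<in> ?P" "y \<in> ?P" "\<forall>l\<in>K - {k}. x l = y l" using xy unfolding mem_lift_rel by auto
      have "{z \<in> ?P. (x, z) \<in> ?L r \<and> (z, y) \<in> ?L s} = (\<lambda>c. x(k := c)) ` {c \<in> ?V k. (x k, c) \<in> r \<and> (c, y k) \<in> s}"
      proof (intro equalityI subsetI)
        fix z assume "z \<in> {z \<in> ?P. (x, z) \<in> ?L r \<and> (z, y) \<in> ?L s}"
        then have z: "z \<in> ?P" "(x k, z k) \<in> r" "(z k, y k) \<in> s" "\<forall>l\<in>K - {k}. x l = z l"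
          unfolding mem_lift_rel by auto
        have "z k \<in> ?V k" using z(1) k by auto
        then show "z \<in> (\<lambda>c. x(k := c)) ` {c \<in> ?V k. (x k, c) \<in> r \<and> (c, y k) \<in> s}"
          using z agree_upd[OF x(1) z(1,4)] by (intro image_eqI[of _ _ "z k"]) auto
      next
        fix z assume "z \<in> (\<lambda>c. x(k := c)) ` {c \<in> ?V k. (x k, c) \<in> r \<and> (c, y k) \<in> s}"
        then obtain c where c: "z = x(k := c)" "c \<in> ?V k" "(x k, c) \<in> r" "(c, y k) \<in> s" by blast
        then show "z \<in> {z \<in> ?P. (x, z) \<in> ?L r \<and> (z, y) \<in> ?L s}"
          using x PiE_upd[OF x(1) k c(2)] unfolding mem_lift_rel by simp
      qed
      moreover have "inj_on (\<lambda>c. x(k := c)) {c \<in> ?V k. (x k, c) \<in> r \<and> (c, y k) \<in> s}"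
        by (intro inj_onI) (metis fun_upd_same)
      ultimately show ?thesis by (simp add: card_image)
    qed
    \<comment> \<open>The intersection matters for n = 0: then \<open>paths\<close> of the lifts
      also contains the pairs that differ outside coordinate k.\<close>
    have "?L (paths (?V k) r s n) = ?L (?V k \<times> ?V k) \<inter> paths ?P (?L r) (?L s) n"
    proof (intro equalityI subrelI)
      fix x y assume a: "(x, y) \<in> ?L (paths (?V k) r s n)"
      then have all: "(x, y) \<in> ?L (?V k \<times> ?V k)" unfolding mem_lift_rel paths_def by auto
      have "x \<in> ?P" "y \<in> ?P" "card {c \<in> ?V k. (x k, c) \<in> r \<and> (c, y k) \<in> s} = n"
        using a unfolding mem_lift_rel paths_def by simp_all
      then have "(x, y) \<in> paths ?P (?L r) (?L s) n"
        unfolding paths_def card[OF all, symmetric] by simp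
      then show "(x, y) \<in> ?L (?V k \<times> ?V k) \<inter> paths ?P (?L r) (?L s) n" using all by simp
    next
      fix x y assume a: "(x, y) \<in> ?L (?V k \<times> ?V k) \<inter> paths ?P (?L r) (?L s) n"
      then have all: "(x, y) \<in> ?L (?V k \<times> ?V k)" by simp
      have "(x, y) \<in> paths ?P (?L r) (?L s) n" using a by simp
      then have "card {c \<in> ?V k. (x k, c) \<in> r \<and> (c, y k) \<in> s} = n"
        unfolding paths_def card[OF all, symmetric] by simp
      then show "(x, y) \<in> ?L (paths (?V k) r s n)"
        using all unfolding mem_lift_rel paths_def by simp
    qed
    then show "paths (?V k) r s n \<in> ?F"
      using W.int_mem[OF all W.paths_mem] r s unfolding paths_def[of "?V k"] by auto
  qed
  moreover have "parcs (Y k) \<in> ?F"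
    using Y[OF k] dir unfolding fin_graph_def arcs_in_dir_lift by simp
  ultimately show ?thesis using WL_rels_least r by blast
qed

text \<open>Once the directions are relations, so are all lifts, and lifts in different coordinates
  compose to the basis relations of the tensor product. The other inclusion comes from minimality of
  WL, as the arcs are a relation of the tensor product.\<close>

lemma WL_cart_prod_tensor:
  assumes K: "finite K" and Y: "\<And>k. k \<in> K \<Longrightarrow> fin_graph (Y k)"
    and con: "\<And>k x y. k \<in> K \<Longrightarrow> x \<in> pverts (Y k) \<Longrightarrow> y \<in> pverts (Y k) \<Longrightarrow> (x, y) \<in> (parcs (Y k))\<^sup>*"
    and dir: "\<And>k. k \<in> K \<Longrightarrow> arcs_in_dir K Y k \<in> WL_rels (cart_prod K Y)"
  shows "WL (cart_prod K Y) = tensor K (\<lambda>k. WL (Y k))"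
proof -
  let ?V = "\<lambda>k. pverts (Y k)" and ?R = "WL_rels (cart_prod K Y)" and ?C = "\<lambda>k. WL (Y k)"
  let ?P = "Pi\<^sub>E K ?V"
  have fg: "fin_graph (cart_prod K Y)" by (rule fin_graph_cart_prod[OF K Y])
  have "coh_family ?P ?R"
    using WL_rels_family[OF fg] fg unfolding pverts_cart_prod fin_graph_def by unfold_locales auto
  then interpret W: coh_family ?P ?R .
  interpret T: coh_tensor K ?C using K coherent_WL[OF Y] by unfold_locales
  interpret TC: coh "tensor K ?C" using T.coherent_tensor by unfold_locales
  have pts: "points (tensor K ?C) = ?P"
    unfolding tensor_def using points_WL[OF Y] by (auto intro!: PiE_cong)
  have tens: "tensor_rel K s \<in> ?R" if s: "s \<in> T.B" for s
  proof -
    have sk: "s k \<in> WL_rels (Y k)" "s k \<subseteq> ?V k \<times> ?V k" if k: "k \<in> K" for k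
    proof -
      interpret Ck: coh "?C k" by (rule T.cohI[OF k])
      have "s k \<in> basis (?C k)" using s k by auto
      then show "s k \<in> WL_rels (Y k)" "s k \<subseteq> ?V k \<times> ?V k"
        using Ck.basis_rels Ck.basis_sub rels_WL[OF Y[OF k]] points_WL[OF Y[OF k]] by auto
    qed
    \<comment> \<open>Coordinates in L move according to s and all others stay, so the tensor
      relation is assembled one coordinate at a time.\<close>
    let ?T = "\<lambda>L. {(x, y). x \<in> ?P \<and> y \<in> ?P \<and> (\<forall>k\<in>L. (x k, y k) \<in> s k) \<and> (\<forall>l\<in>K - L. x l = y l)}"
    have "finite L \<Longrightarrow> L \<subseteq> K \<Longrightarrow> ?T L \<in> ?R" for L
    proof (induction L rule: finite_induct)
      case empty
      have "?T {} = Id_on ?P" 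
      proof (intro equalityI subrelI)
        fix x y assume a: "(x, y) \<in> ?T {}"
        then have "x = y" by (intro PiE_ext[of x K ?V y]) auto
        then show "(x, y) \<in> Id_on ?P" using a by auto
      qed auto
      then show ?case using W.id_mem by simp
    next
      case (insert k L)
      have k: "k \<in> K" "L \<subseteq> K" using insert by auto
      have "?T (insert k L) = ?T L O lift_rel K ?V k (s k)"
      proof (intro equalityI subrelI)
        fix x y assume a: "(x, y) \<in> ?T (insert k L)"
        then have x: "x \<in> ?P" "y \<in> ?P" "\<forall>i\<in>insert k L. (x i, y i) \<in> s i" "\<forall>l\<in>K - insert k L. x l = y l"
          by auto
        \<comment> \<open>Coordinate k moves last, so the midpoint is y with the old value at
          k.\<close>
        let ?z = "y(k := x k)"
        have z: "?z \<in> ?P" using PiE_upd[OF x(2) k(1)] PiE_mem[OF x(1) k(1)] by blast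
        have "(x, ?z) \<in> ?T L" using x z insert(2) by auto
        moreover have "(?z, y) \<in> lift_rel K ?V k (s k)" unfolding mem_lift_rel using x z by simp
        ultimately show "(x, y) \<in> ?T L O lift_rel K ?V k (s k)" by (rule relcompI)
      next
        fix x y assume "(x, y) \<in> ?T L O lift_rel K ?V k (s k)"
        then obtain z where z: "(x, z) \<in> ?T L" "(z, y) \<in> lift_rel K ?V k (s k)" by blast
        have zk: "\<forall>l\<in>K - {k}. z l = y l" "(z k, y k) \<in> s k" "y \<in> ?P" using z(2) unfolding mem_lift_rel by auto
        have xz: "x \<in> ?P" "\<forall>i\<in>L. (x i, z i) \<in> s i" "\<forall>l\<in>K - L. x l = z l" using z(1) by auto
        have "x k = z k" using xz(3) insert(2) k(1) by blast
        moreover have "z i = y i" if "i \<in> L" for i using zk(1) that insert(2) k(2) by blast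
        ultimately show "(x, y) \<in> ?T (insert k L)" using zk xz by auto
      qed
      also have "\<dots> \<in> ?R"
        by (rule W.comp_mem[OF insert(3)[OF k(2)] WL_rels_lift[OF K Y con dir[OF k(1)] k(1) sk(1)[OF k(1)]]])
      finally show ?case .
    qed
    from this[OF K subset_refl] have "?T K \<in> ?R" .
    moreover have "?T K = tensor_rel K s"
    proof (intro equalityI subrelI)
      fix x y assume xy: "(x, y) \<in> tensor_rel K s"
      have "x k \<in> ?V k \<and> y k \<in> ?V k" if "k \<in> K" for k
        using xy sk(2)[OF that] that unfolding mem_tensor_rel by blast
      then show "(x, y) \<in> ?T K" using xy unfolding mem_tensor_rel PiE_iff by simp
    qed (auto simp: mem_tensor_rel PiE_iff)
    ultimately show ?thesis by simp
  qed
  show ?thesis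
  proof (rule config_eqI)
    show "coherent (WL (cart_prod K Y))" by (rule coherent_WL[OF fg])
    show "coherent (tensor K ?C)" by (rule T.coherent_tensor)
    show p: "points (WL (cart_prod K Y)) = points (tensor K ?C)"
      unfolding pts points_WL[OF fg] pverts_cart_prod ..
    show "rels (WL (cart_prod K Y)) = rels (tensor K ?C)"
    proof
      have "parcs (cart_prod K Y) \<in> rels (tensor K ?C)" by (rule arcs_rels_tensor(2)[OF K Y])
      then show "rels (WL (cart_prod K Y)) \<subseteq> rels (tensor K ?C)"
        by (intro WL_rels_sub[OF fg T.coherent_tensor]) (simp_all add: pts pverts_cart_prod)
      show "rels (tensor K ?C) \<subseteq> rels (WL (cart_prod K Y))"
      proof
        fix r assume "r \<in> rels (tensor K ?C)"
        then obtain S where S: "S \<subseteq> basis (tensor K ?C)" "r = \<Union>S"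
          unfolding rels_def is_relation_def by blast
        have "S \<subseteq> ?R" using S(1) tens unfolding tensor_def by auto
        then show "r \<in> rels (WL (cart_prod K Y))" unfolding rels_WL[OF fg] S(2) by (rule W.Union_mem)
      qed
    qed
  qed
qed

section \<open>Transport of WL along an injective renaming of vertices\<close>

lemma image_paths:
  assumes "inj_on f V" "r \<subseteq> V \<times> V" "s \<subseteq> V \<times> V"
  shows "map_prod f f ` paths V r s n = paths (f ` V) (map_prod f f ` r) (map_prod f f ` s) n"
proof -
  have mem: "(f x, f y) \<in> map_prod f f ` t \<longleftrightarrow> (x, y) \<in> t"
    if "t \<subseteq> V \<times> V" "x \<in> V" "y \<in> V" for t x y
  proof
    assume "(f x, f y) \<in> map_prod f f ` t"
    then obtain a b where ab: "(a, b) \<in> t" "f a = f x" "f b = f y" by auto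
    then have "a = x" "b = y" using that assms(1) unfolding inj_on_def by blast+
    then show "(x, y) \<in> t" using ab by simp
  qed force
  have card: "card {z \<in> f ` V. (f x, z) \<in> map_prod f f ` r \<and> (z, f y) \<in> map_prod f f ` s} =
    card {z \<in> V. (x, z) \<in> r \<and> (z, y) \<in> s}" if "x \<in> V" "y \<in> V" for x y
  proof -
    have "{z \<in> f ` V. (f x, z) \<in> map_prod f f ` r \<and> (z, f y) \<in> map_prod f f ` s} =
      f ` {z \<in> V. (x, z) \<in> r \<and> (z, y) \<in> s}"
    proof (intro equalityI subsetI)
      fix z' assume z': "z' \<in> {z \<in> f ` V. (f x, z) \<in> map_prod f f ` r \<and> (z, f y) \<in> map_prod f f ` s}"
      then obtain z where z: "z \<in> V" "z' = f z" by blast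
      then show "z' \<in> f ` {z \<in> V. (x, z) \<in> r \<and> (z, y) \<in> s}"
        using z' mem[OF assms(2) that(1) z(1)] mem[OF assms(3) z(1) that(2)] by simp
    next
      fix z' assume "z' \<in> f ` {z \<in> V. (x, z) \<in> r \<and> (z, y) \<in> s}"
      then obtain z where z: "z \<in> V" "z' = f z" "(x, z) \<in> r" "(z, y) \<in> s" by blast
      then show "z' \<in> {z \<in> f ` V. (f x, z) \<in> map_prod f f ` r \<and> (z, f y) \<in> map_prod f f ` s}"
        using mem[OF assms(2) that(1) z(1)] mem[OF assms(3) z(1) that(2)] by simp
    qed
    moreover have "inj_on f {z \<in> V. (x, z) \<in> r \<and> (z, y) \<in> s}"
      by (rule inj_on_subset[OF assms(1)]) blast
    ultimately show ?thesis by (simp add: card_image)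
  qed
  show ?thesis
  proof (intro equalityI subsetI)
    fix p assume "p \<in> map_prod f f ` paths V r s n"
    then obtain x y where "p = (f x, f y)" "(x, y) \<in> paths V r s n" by auto
    then show "p \<in> paths (f ` V) (map_prod f f ` r) (map_prod f f ` s) n"
      unfolding paths_def using card by simp
  next
    fix p assume "p \<in> paths (f ` V) (map_prod f f ` r) (map_prod f f ` s) n"
    then obtain x y where xy: "p = (f x, f y)" "x \<in> V" "y \<in> V"
      "card {z \<in> f ` V. (f x, z) \<in> map_prod f f ` r \<and> (z, f y) \<in> map_prod f f ` s} = n"
      unfolding paths_def by auto
    then have "(x, y) \<in> paths V r s n" unfolding paths_def using card by simp
    then show "p \<in> map_prod f f ` paths V r s n" unfolding xy(1) by force
  qed
qed

definition image_graph :: "('a \<Rightarrow> 'b) \<Rightarrow> 'a pair_pre_digraph \<Rightarrow> 'b pair_pre_digraph" where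
  "image_graph f G = \<lparr> pverts = f ` pverts G, parcs = map_prod f f ` parcs G \<rparr>"

lemma fin_graph_image: "fin_graph G \<Longrightarrow> fin_graph (image_graph f G)"
  unfolding fin_graph_def image_graph_def by (auto simp: subset_iff)

lemma WL_rels_sub_verts: "fin_graph G \<Longrightarrow> r \<in> WL_rels G \<Longrightarrow> r \<subseteq> pverts G \<times> pverts G"
  using WL_rels_family unfolding coherent_family_def by blast

lemma WL_rels_image:
  assumes G: "fin_graph G" and f: "inj_on f (pverts G)"
  shows "WL_rels (image_graph f G) = (`) (map_prod f f) ` WL_rels G"
proof -
  let ?V = "pverts G" and ?f = "map_prod f f"
  have simps: "pverts (image_graph f G) = f ` ?V" "parcs (image_graph f G) = ?f ` parcs G"
    unfolding image_graph_def by simp_all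
  have inj: "inj_on ?f (?V \<times> ?V)" using f f by (rule map_prod_inj_on)
  note sub = WL_rels_sub_verts[OF G]
  have diag: "?f ` Id_on ?V = Id_on (f ` ?V)" by (auto simp: Id_on_def)
  have compl: "?f ` (?V \<times> ?V - r) = f ` ?V \<times> f ` ?V - ?f ` r" if "r \<subseteq> ?V \<times> ?V" for r
    using inj_on_image_set_diff[OF inj _ that, of "?V \<times> ?V"] by (simp add: map_prod_surj_on)
  have conv: "?f ` (r\<inverse>) = (?f ` r)\<inverse>" for r by auto
  show ?thesis
  proof (intro equalityI subsetI)
    fix r assume "r \<in> WL_rels (image_graph f G)"
    then show "r \<in> (`) ?f ` WL_rels G"
    proof (induction rule: WL_rels.induct)
      case arcs
      show ?case unfolding simps by (intro imageI WL_rels.arcs)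
    next
      case diag
      show ?case unfolding simps \<open>?f ` Id_on ?V = _\<close>[symmetric] by (intro imageI WL_rels.diag)
    next
      case (compl r)
      then obtain t where t: "t \<in> WL_rels G" "r = ?f ` t" by blast
      show ?case
        unfolding simps t(2) \<open>\<And>r. r \<subseteq> _ \<Longrightarrow> _\<close>[OF sub[OF t(1)], symmetric] by (intro imageI WL_rels.compl t)
    next
      case (un r s)
      then obtain t u where t: "t \<in> WL_rels G" "r = ?f ` t" and u: "u \<in> WL_rels G" "s = ?f ` u" by blast
      show ?case unfolding t(2) u(2) image_Un[symmetric] by (intro imageI WL_rels.un t u)
    next
      case (conv r)
      then obtain t where t: "t \<in> WL_rels G" "r = ?f ` t" by blast
      show ?case unfolding t(2) \<open>\<And>r. ?f ` (r\<inverse>) = _\<close>[symmetric] by (intro imageI WL_rels.conv t)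
    next
      case (paths r s n)
      then obtain t u where t: "t \<in> WL_rels G" "r = ?f ` t" and u: "u \<in> WL_rels G" "s = ?f ` u" by blast
      show ?case
        unfolding simps t(2) u(2) image_paths[OF f sub[OF t(1)] sub[OF u(1)], symmetric]
        by (intro imageI WL_rels.paths t u)
    qed
  next
    fix r assume "r \<in> (`) ?f ` WL_rels G"
    then obtain t where t: "t \<in> WL_rels G" "r = ?f ` t" by blast
    have "?f ` t \<in> WL_rels (image_graph f G)" using t(1)
    proof (induction rule: WL_rels.induct)
      case arcs
      show ?case using WL_rels.arcs[of "image_graph f G"] unfolding simps .
    next
      case diag
      show ?case using WL_rels.diag[of "image_graph f G"] unfolding simps \<open>?f ` Id_on ?V = _\<close> .
    next
      case (compl r)
      show ?case
        using WL_rels.compl[OF compl(2)] unfolding simps \<open>\<And>r. r \<subseteq> _ \<Longrightarrow> _\<close>[OF sub[OF compl(1)]] .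
    next
      case (un r s)
      show ?case unfolding image_Un by (rule WL_rels.un[OF un(3,4)])
    next
      case (conv r)
      show ?case unfolding \<open>\<And>r. ?f ` (r\<inverse>) = _\<close> by (rule WL_rels.conv[OF conv(2)])
    next
      case (paths r s n)
      show ?case
        using WL_rels.paths[OF paths(3,4)]
        unfolding simps image_paths[OF f sub[OF paths(1)] sub[OF paths(2)]] .
    qed
    then show "r \<in> WL_rels (image_graph f G)" unfolding t(2) .
  qed
qed

text \<open>Images under an injection preserve and reflect inclusion, so the minimal nonempty
  relations correspond.\<close>

lemma map_config_WL:
  assumes G: "fin_graph G" and f: "inj_on f (pverts G)"
  shows "map_config f (WL G) = WL (image_graph f G)"
proof -
  let ?V = "pverts G" and ?f = "map_prod f f" and ?H = "image_graph f G"
  have H: "fin_graph ?H" by (rule fin_graph_image[OF G])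
  interpret C: coh "WL G" by (unfold_locales) (rule coherent_WL[OF G])
  interpret D: coh "WL ?H" by (unfold_locales) (rule coherent_WL[OF H])
  note rels = rels_WL[OF G] rels_WL[OF H]
  have inj: "inj_on ?f (?V \<times> ?V)" using f f by (rule map_prod_inj_on)
  note sub = WL_rels_sub_verts[OF G]
  have le: "?f ` r \<subseteq> ?f ` s \<longleftrightarrow> r \<subseteq> s" if "r \<in> WL_rels G" "s \<in> WL_rels G" for r s
  proof
    assume fs: "?f ` r \<subseteq> ?f ` s"
    show "r \<subseteq> s"
    proof
      fix p assume p: "p \<in> r"
      have "?f p \<in> ?f ` s" using fs imageI[OF p] by (rule subsetD)
      then obtain q where q: "q \<in> s" "?f p = ?f q" by (rule imageE)
      have "p \<in> ?V \<times> ?V" "q \<in> ?V \<times> ?V" using sub[OF that(1)] sub[OF that(2)] p q(1) by auto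
      then have "p = q" using inj_onD[OF inj q(2)] by simp
      then show "p \<in> s" using q(1) by simp
    qed
  qed (rule image_mono)
  have minimal: "?f ` s \<in> basis (WL ?H) \<longleftrightarrow> s \<in> basis (WL G)" if s: "s \<in> WL_rels G" for s
  proof -
    have "(\<forall>r\<in>WL_rels ?H. r \<subseteq> ?f ` s \<longrightarrow> r = {} \<or> r = ?f ` s) \<longleftrightarrow>
      (\<forall>r\<in>WL_rels G. r \<subseteq> s \<longrightarrow> r = {} \<or> r = s)"
      unfolding WL_rels_image[OF G f] ball_simps(9)
    proof (rule ball_cong[OF refl])
      fix r assume r: "r \<in> WL_rels G"
      have "?f ` r = ?f ` s \<longleftrightarrow> r = s" using le[OF r s] le[OF s r] by (metis subset_antisym subset_refl)
      then show "(?f ` r \<subseteq> ?f ` s \<longrightarrow> ?f ` r = {} \<or> ?f ` r = ?f ` s) \<longleftrightarrow> (r \<subseteq> s \<longrightarrow> r = {} \<or> r = s)"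
        by (simp only: le[OF r s] image_is_empty)
    qed
    moreover have "?f ` s \<in> WL_rels ?H" unfolding WL_rels_image[OF G f] using s by blast
    ultimately show ?thesis
      unfolding C.basis_minimal D.basis_minimal rels using s by simp
  qed
  have "(`) ?f ` basis (WL G) = basis (WL ?H)"
  proof (intro equalityI subsetI)
    fix t assume "t \<in> (`) ?f ` basis (WL G)"
    then obtain s where s: "s \<in> basis (WL G)" "t = ?f ` s" by blast
    then show "t \<in> basis (WL ?H)" using minimal C.basis_rels rels by simp
  next
    fix t assume t: "t \<in> basis (WL ?H)"
    then have "t \<in> WL_rels ?H" using D.basis_rels rels by simp
    then obtain s where s: "s \<in> WL_rels G" "t = ?f ` s" unfolding WL_rels_image[OF G f] by blast
    then show "t \<in> (`) ?f ` basis (WL G)" using minimal t by blast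
  qed
  moreover have "f ` points (WL G) = points (WL ?H)"
    unfolding points_WL[OF G] points_WL[OF H] unfolding image_graph_def by simp
  ultimately show ?thesis unfolding map_config_def by simp
qed

subsection \<open>Distances and factorisations of a connected graph\<close>

lemma pair_graph_iff: "pair_graph G \<longleftrightarrow> fin_graph G \<and> sym (parcs G) \<and> irrefl (parcs G)"
proof
  assume "pair_graph G"
  then interpret pair_graph G .
  have "sym (parcs G)" using pair_sym_arcs unfolding symmetric_def by simp
  moreover have "irrefl (parcs G)" unfolding irrefl_def using pair_no_loops by fastforce
  moreover have "parcs G \<subseteq> pverts G \<times> pverts G" using arc_fst_in_verts arc_snd_in_verts by fastforce
  ultimately show "fin_graph G \<and> sym (parcs G) \<and> irrefl (parcs G)"
    unfolding fin_graph_def using pair_finite_verts by blast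
next
  assume a: "fin_graph G \<and> sym (parcs G) \<and> irrefl (parcs G)"
  then have f: "finite (pverts G)" "parcs G \<subseteq> pverts G \<times> pverts G" unfolding fin_graph_def by auto
  show "pair_graph G"
  proof
    show "fst e \<in> pverts G" "snd e \<in> pverts G" if "e \<in> parcs G" for e using that f(2) by auto
    show "finite (pverts G)" by (rule f)
    show "finite (parcs G)" by (rule finite_subset[OF f(2)]) (use f(1) in simp)
    show "fst e \<noteq> snd e" if "e \<in> parcs G" for e
      using that a unfolding irrefl_def by (metis prod.collapse)
    show "symmetric (with_proj G)" using a unfolding symmetric_def by simp
  qed
qed

definition conn_graph :: "'a pair_pre_digraph \<Rightarrow> bool" where
  "conn_graph G \<longleftrightarrow> fin_graph G \<and> sym (parcs G) \<and> irrefl (parcs G) \<and>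
    (\<forall>x\<in>pverts G. \<forall>y\<in>pverts G. (x, y) \<in> (parcs G)\<^sup>*)"

lemma conn_graphI:
  assumes "pair_graph G" "Digraph_Component.connected (with_proj G)"
  shows "conn_graph G"
proof -
  interpret pair_graph G by (rule assms)
  have sc: "strongly_connected (with_proj (mk_symmetric G))"
    using assms(2) unfolding Digraph_Component.connected_def by simp
  have "(x, y) \<in> (parcs G)\<^sup>*" if xy: "x \<in> pverts G" "y \<in> pverts G" for x y
  proof -
    have "x \<rightarrow>\<^sup>*\<^bsub>with_proj (mk_symmetric G)\<^esub> y" using sc xy unfolding strongly_connected_def by simp
    then have "x \<rightarrow>\<^sup>*\<^bsub>with_proj G\<^esub> y" using reachable_mk_symmetric_eq[OF pair_sym_arcs] by simp
    then have "(x, y) \<in> (arcs_ends (with_proj G))\<^sup>*" by (rule reachable_rtranclI)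
    then show ?thesis by simp
  qed
  then show "conn_graph G" unfolding conn_graph_def using assms(1) pair_graph_iff by blast
qed

text \<open>The value at unreachable pairs is unspecified, hence the reachability hypotheses below.
  It is still a function of the set of walk lengths, which is why \<open>gdist_sym\<close> and the
  later visibility of distances hold for all pairs.\<close>

definition gdist :: "'a rel \<Rightarrow> 'a \<Rightarrow> 'a \<Rightarrow> nat" where
  "gdist E x y = (LEAST n. (x, y) \<in> E ^^ n)"

lemma gdist_le: "(x, y) \<in> E ^^ n \<Longrightarrow> gdist E x y \<le> n"
  unfolding gdist_def by (rule Least_le)

lemma gdist_relpow: "(x, y) \<in> E\<^sup>* \<Longrightarrow> (x, y) \<in> E ^^ gdist E x y"
  unfolding gdist_def by (rule LeastI_ex) (simp add: rtrancl_power)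

lemma gdist_refl: "gdist E x x = 0"
  using gdist_le[of x x 0 E] by simp

lemma gdist_zero: "(x, y) \<in> E\<^sup>* \<Longrightarrow> gdist E x y = 0 \<longleftrightarrow> x = y"
  using gdist_relpow[of x y E] gdist_refl[of E x] by auto

lemma gdist_step: "(x, y) \<in> E\<^sup>* \<Longrightarrow> (y, z) \<in> E \<Longrightarrow> gdist E x z \<le> Suc (gdist E x y)"
  using gdist_relpow[of x y E] by (intro gdist_le) auto

lemma gdist_pred:
  assumes "(x, y) \<in> E\<^sup>*" "gdist E x y = Suc m"
  obtains z where "(x, z) \<in> E\<^sup>*" "(z, y) \<in> E" "gdist E x z = m"
proof -
  have "(x, y) \<in> E ^^ Suc m" using gdist_relpow[OF assms(1)] assms(2) by simp
  then obtain z where z: "(x, z) \<in> E ^^ m" "(z, y) \<in> E" by auto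
  have r: "(x, z) \<in> E\<^sup>*" using z(1) by (rule relpow_imp_rtrancl)
  have "gdist E x z = m" using gdist_le[OF z(1)] gdist_step[OF r z(2)] assms(2) by simp
  then show thesis using that r z(2) by blast
qed

lemma gdist_sym: "sym E \<Longrightarrow> gdist E x y = gdist E y x"
proof -
  assume E: "sym E"
  have "(x, y) \<in> E ^^ n \<Longrightarrow> (y, x) \<in> E ^^ n" for x y n
  proof (induction n arbitrary: y)
    case (Suc n)
    then obtain z where z: "(x, z) \<in> E ^^ n" "(z, y) \<in> E" by auto
    show ?case using Suc.IH[OF z(1)] symD[OF E z(2)] by (intro relpow_Suc_I2)
  qed simp
  then show ?thesis unfolding gdist_def by metis
qed

text \<open>Descending steps build a walk of length f y, and no walk is shorter because f grows by
  at most one along an arc. Intended for f a sum of coordinate distances.\<close>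

lemma gdist_eqI:
  assumes E: "E \<subseteq> V \<times> V" and zero: "f x = 0" "\<And>y. y \<in> V \<Longrightarrow> f y = 0 \<Longrightarrow> y = x"
    and up: "\<And>y z. (y, z) \<in> E \<Longrightarrow> f z \<le> Suc (f y)"
    and down: "\<And>y m. y \<in> V \<Longrightarrow> f y = Suc m \<Longrightarrow> \<exists>z\<in>V. (z, y) \<in> E \<and> f z = m"
    and y: "y \<in> V"
  shows "gdist E x y = f y" "(x, y) \<in> E\<^sup>*"
proof -
  have walk: "(x, y) \<in> E ^^ f y" if "y \<in> V" for y
    using that
  proof (induction "f y" arbitrary: y)
    case 0
    have "y = x" by (rule zero(2)[OF 0(2) 0(1)[symmetric]])
    then show ?case using zero(1) by simp
  next
    case (Suc m)
    obtain z where z: "z \<in> V" "(z, y) \<in> E" "f z = m" using down[OF Suc(3) Suc(2)[symmetric]] by blast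
    have "(x, z) \<in> E ^^ m" using Suc(1)[OF z(3)[symmetric] z(1)] z(3) by simp
    then show ?case unfolding Suc(2)[symmetric] using z(2) by auto
  qed
  show "(x, y) \<in> E\<^sup>*" using walk[OF y] by (rule relpow_imp_rtrancl)
  have le: "(x, y) \<in> E ^^ n \<Longrightarrow> f y \<le> n" for y n
  proof (induction n arbitrary: y)
    case (Suc n)
    then obtain z where "(x, z) \<in> E ^^ n" "(z, y) \<in> E" by auto
    then show ?case using Suc.IH[of z] up[of z y] by simp
  qed (use zero(1) in simp)
  show "gdist E x y = f y"
    using gdist_le[OF walk[OF y]] le[OF gdist_relpow[OF \<open>(x, y) \<in> E\<^sup>*\<close>]] by simp
qed

text \<open>\<open>Theta\<close> is the Djokovic relation, and \<open>tau\<close> relates arcs with a common tail that span no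
  square. Arcs of a Cartesian product in different directions are related by neither.\<close>
definition Theta :: "'a rel \<Rightarrow> ('a \<times> 'a) rel" where
  "Theta E = {((x, y), (u, v)). (x, y) \<in> E \<and> (u, v) \<in> E \<and>
     gdist E x u + gdist E y v \<noteq> gdist E x v + gdist E y u}"

definition tau :: "'a rel \<Rightarrow> ('a \<times> 'a) rel" where
  "tau E = {((x, y), (x', z)). x = x' \<and> (x, y) \<in> E \<and> (x', z) \<in> E \<and> y \<noteq> z \<and>
     (\<forall>w. (y, w) \<in> E \<and> (z, w) \<in> E \<longrightarrow> w = x)}"

lemma mem_Theta: "((x, y), (u, v)) \<in> Theta E \<longleftrightarrow> (x, y) \<in> E \<and> (u, v) \<in> E \<and>
     gdist E x u + gdist E y v \<noteq> gdist E x v + gdist E y u"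
  unfolding Theta_def by simp

lemma mem_tau: "((x, y), (x', z)) \<in> tau E \<longleftrightarrow> x = x' \<and> (x, y) \<in> E \<and> (x', z) \<in> E \<and> y \<noteq> z \<and>
     (\<forall>w. (y, w) \<in> E \<and> (z, w) \<in> E \<longrightarrow> w = x)"
  unfolding tau_def by simp

lemma sym_Theta: "sym E \<Longrightarrow> sym (Theta E)"
proof (rule symI)
  fix e f assume E: "sym E" and ef: "(e, f) \<in> Theta E"
  obtain x y u v where e: "e = (x, y)" "f = (u, v)" by (cases e, cases f)
  show "(f, e) \<in> Theta E"
    using ef unfolding e mem_Theta gdist_sym[OF E, of u x] gdist_sym[OF E, of v y]
      gdist_sym[OF E, of u y] gdist_sym[OF E, of v x] by auto
qed

lemma sym_tau: "sym (tau E)"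
  by (rule symI) (auto simp: tau_def)

text \<open>Theta and tau are symmetric, so excluding them from A to B excludes them from B to A
  (\<open>arc_split_swap\<close>). The aim is to show that A and B are the two directions of a
  product decomposition.\<close>

definition arc_split :: "'a pair_pre_digraph \<Rightarrow> 'a rel \<Rightarrow> 'a rel \<Rightarrow> bool" where
  "arc_split G A B \<longleftrightarrow> conn_graph G \<and> parcs G = A \<union> B \<and> A \<inter> B = {} \<and>
     (\<forall>e\<in>A. \<forall>f\<in>B. (e, f) \<notin> Theta (parcs G) \<union> tau (parcs G))"

lemma arc_split_swap: "arc_split G A B \<Longrightarrow> arc_split G B A"
proof -
  assume a: "arc_split G A B"
  then have "sym (parcs G)" unfolding arc_split_def conn_graph_def by blast
  then have "sym (Theta (parcs G) \<union> tau (parcs G))" by (intro sym_Un sym_Theta sym_tau)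
  then show ?thesis using a unfolding arc_split_def by (metis Un_commute Int_commute symD)
qed

section \<open>Squares, walks and shortest paths relative to a split of the arcs\<close>

context
  fixes G :: "'a pair_pre_digraph"
  assumes G: "conn_graph G"
begin

lemma conn_reach: "x \<in> pverts G \<Longrightarrow> y \<in> pverts G \<Longrightarrow> (x, y) \<in> (parcs G)\<^sup>*"
  and arc_sym: "(x, y) \<in> parcs G \<Longrightarrow> (y, x) \<in> parcs G"
  and arc_irrefl: "(x, x) \<notin> parcs G"
  and arc_verts: "(x, y) \<in> parcs G \<Longrightarrow> x \<in> pverts G \<and> y \<in> pverts G"
  using G unfolding conn_graph_def fin_graph_def sym_def irrefl_def by blast+

lemma dist_sym: "gdist (parcs G) x y = gdist (parcs G) y x"
  using G by (intro gdist_sym) (simp add: conn_graph_def)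

lemma dist_one: "x \<in> pverts G \<Longrightarrow> y \<in> pverts G \<Longrightarrow> gdist (parcs G) x y = 1 \<longleftrightarrow> (x, y) \<in> parcs G"
proof
  assume xy: "x \<in> pverts G" "y \<in> pverts G"
  show "(x, y) \<in> parcs G" if "gdist (parcs G) x y = 1"
    using gdist_relpow[OF conn_reach[OF xy]] that by simp
  assume e: "(x, y) \<in> parcs G"
  have "gdist (parcs G) x y \<le> 1" using gdist_le[of x y 1 "parcs G"] e by simp
  moreover have "gdist (parcs G) x y \<noteq> 0" using gdist_zero[OF conn_reach[OF xy]] e arc_irrefl by auto
  ultimately show "gdist (parcs G) x y = 1" by simp
qed

lemma dist_arc: "(x, y) \<in> parcs G \<Longrightarrow> gdist (parcs G) x y = 1"
  using dist_one arc_verts by blast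

lemma dist_zero: "x \<in> pverts G \<Longrightarrow> y \<in> pverts G \<Longrightarrow> gdist (parcs G) x y = 0 \<longleftrightarrow> x = y"
  using gdist_zero[OF conn_reach] .

lemma split_sub: "arc_split G A B \<Longrightarrow> e \<in> A \<Longrightarrow> e \<in> parcs G"
  unfolding arc_split_def by blast

lemma split_no: "arc_split G A B \<Longrightarrow> e \<in> A \<Longrightarrow> f \<in> parcs G \<Longrightarrow> (e, f) \<in> Theta (parcs G) \<union> tau (parcs G) \<Longrightarrow> f \<in> A"
  unfolding arc_split_def by blast

text \<open>An arc and its reverse are Theta-related: the two distance sums are 1 + 1 and 0 +
  0.\<close>

lemma split_sym: "arc_split G A B \<Longrightarrow> (x, y) \<in> A \<Longrightarrow> (y, x) \<in> A"
proof -
  assume s: "arc_split G A B" and xy: "(x, y) \<in> A"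
  have e: "(x, y) \<in> parcs G" by (rule split_sub[OF s xy])
  have "((x, y), (y, x)) \<in> Theta (parcs G)"
    unfolding mem_Theta using e arc_sym[OF e] dist_arc[OF e] dist_arc[OF arc_sym[OF e]] by (simp add: gdist_refl)
  then show ?thesis using split_no[OF s xy arc_sym[OF e]] by blast
qed

lemma split_rtrancl_sym: "arc_split G A B \<Longrightarrow> (x, y) \<in> A\<^sup>* \<Longrightarrow> (y, x) \<in> A\<^sup>*"
proof -
  assume s: "arc_split G A B"
  have "sym A" using split_sym[OF s] by (rule symI)
  then show "(x, y) \<in> A\<^sup>* \<Longrightarrow> (y, x) \<in> A\<^sup>*" using sym_rtrancl symD by metis
qed

lemma split_verts: "arc_split G A B \<Longrightarrow> (x, y) \<in> A\<^sup>* \<Longrightarrow> x \<in> pverts G \<Longrightarrow> y \<in> pverts G"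
proof -
  assume s: "arc_split G A B" and xy: "(x, y) \<in> A\<^sup>*" and x: "x \<in> pverts G"
  show "y \<in> pverts G" using xy by (induction rule: rtrancl_induct) (use x split_sub[OF s] arc_verts in blast)+
qed

text \<open>The absence of tau supplies a second common neighbour w of y and z; opposite sides of
  the resulting square are Theta-related and therefore lie in the same part.\<close>

lemma split_square:
  assumes s: "arc_split G A B" and xy: "(x, y) \<in> A" and xz: "(x, z) \<in> B"
  obtains w where "(y, w) \<in> B" "(z, w) \<in> A"
proof -
  note s' = arc_split_swap[OF s]
  note e = split_sub[OF s xy] split_sub[OF s' xz]
  have disj: "A \<inter> B = {}" using s unfolding arc_split_def by blast
  have verts: "x \<in> pverts G" "y \<in> pverts G" "z \<in> pverts G" using e arc_verts by blast+
  have yz: "y \<noteq> z" using xy xz disj by blast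
  \<comment> \<open>In a triangle the sums compared by Theta would be 0 + 1 and 1 + 1, putting both
    arcs into the same part.\<close>
  have nyz: "(y, z) \<notin> parcs G"
  proof
    assume "(y, z) \<in> parcs G"
    then have "((x, y), (x, z)) \<in> Theta (parcs G)"
      unfolding mem_Theta using e dist_arc[OF e(1)] dist_arc[OF e(2)] dist_arc[of y z] dist_sym[of y x]
      by (simp add: gdist_refl)
    then have "(x, z) \<in> A" using split_no[OF s xy e(2)] by blast
    then show False using disj xz by blast
  qed
  have "((x, y), (x, z)) \<notin> tau (parcs G)" using split_no[OF s xy e(2)] disj xz by blast
  then obtain w where w: "(y, w) \<in> parcs G" "(z, w) \<in> parcs G" "w \<noteq> x" unfolding mem_tau using e yz by blast
  have wV: "w \<in> pverts G" using arc_verts[OF w(1)] by blast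
  have "gdist (parcs G) y z \<noteq> 0" "gdist (parcs G) y z \<noteq> 1" using dist_zero[OF verts(2,3)] dist_one[OF verts(2,3)] yz nyz by blast+
  moreover have "gdist (parcs G) x w \<noteq> 0" using dist_zero[OF verts(1) wV] w(3) by blast
  \<comment> \<open>The diagonals of the square have total length at least 2 + 1, while two opposite
    sides have total length 2; this makes opposite sides Theta-related.\<close>
  ultimately have ge: "gdist (parcs G) x w + gdist (parcs G) y z \<ge> 3" by linarith
  have "((x, y), (z, w)) \<in> Theta (parcs G)"
    unfolding mem_Theta using e w ge dist_arc[OF e(2)] dist_arc[OF w(1)] by simp
  then have 1: "(z, w) \<in> A" using split_no[OF s xy w(2)] by blast
  have "((x, z), (y, w)) \<in> Theta (parcs G)"
    unfolding mem_Theta using e w ge dist_arc[OF e(1)] dist_arc[OF w(2)] dist_sym[of z y] by simp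
  then have 2: "(y, w) \<in> B" using split_no[OF s' xz w(1)] by blast
  show thesis by (rule that[OF 2 1])
qed

text \<open>Squares are glued along the B-walk and carry the A-arc to its other end.\<close>

lemma split_translate:
  assumes s: "arc_split G A B" and xy: "(x, y) \<in> A" and xz: "(x, z) \<in> B\<^sup>*"
  obtains w where "(y, w) \<in> B\<^sup>*" "(z, w) \<in> A"
proof -
  have "\<exists>w. (y, w) \<in> B\<^sup>* \<and> (z, w) \<in> A" using xz
  proof (induction rule: rtrancl_induct)
    case base
    then show ?case using xy by blast
  next
    case (step z z')
    then obtain w where w: "(y, w) \<in> B\<^sup>*" "(z, w) \<in> A" by blast
    obtain w' where "(w, w') \<in> B" "(z', w') \<in> A" by (rule split_square[OF s w(2) step(2)])
    then show ?case using w(1) rtrancl_into_rtrancl by metis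
  qed
  then show thesis using that by blast
qed

text \<open>An A-arc that follows a B-walk is translated back to the start of that walk, so every
  walk can be sorted with its A-arcs first.\<close>

lemma split_factor:
  assumes s: "arc_split G A B" and xy: "x \<in> pverts G" "y \<in> pverts G"
  obtains z where "(x, z) \<in> A\<^sup>*" "(z, y) \<in> B\<^sup>*"
proof -
  note s' = arc_split_swap[OF s]
  have "\<exists>z. (x, z) \<in> A\<^sup>* \<and> (z, y) \<in> B\<^sup>*" using conn_reach[OF xy]
  proof (induction rule: rtrancl_induct)
    case base
    then show ?case by blast
  next
    case (step y y')
    then obtain z where z: "(x, z) \<in> A\<^sup>*" "(z, y) \<in> B\<^sup>*" by blast
    have "(y, y') \<in> A \<or> (y, y') \<in> B" using s step(2) unfolding arc_split_def by blast
    then show ?case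
    proof
      assume "(y, y') \<in> B"
      then show ?thesis using z rtrancl_into_rtrancl by metis
    next
      assume "(y, y') \<in> A"
      then obtain w where w: "(y', w) \<in> B\<^sup>*" "(z, w) \<in> A"
        by (rule split_translate[OF s _ split_rtrancl_sym[OF s' z(2)]])
      then show ?thesis using z(1) split_rtrancl_sym[OF s' w(1)] rtrancl_into_rtrancl by metis
    qed
  qed
  then show thesis using that by blast
qed

text \<open>The last arc of a shortest path is in relation Theta with some arc of every other walk
  between the same ends.\<close>
lemma split_last_arc:
  assumes s: "arc_split G A B" and xV: "x \<in> pverts G" and xy: "(x, y) \<in> A\<^sup>*"
    and z: "(z, y) \<in> parcs G" "gdist (parcs G) x y = Suc (gdist (parcs G) x z)"
  shows "(z, y) \<in> A"
proof -
  \<comment> \<open>While no arc of the walk is Theta-related to (z, y), the difference of the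
    distances from t to y and from t to z stays 1. At t = y it is negative, so some arc of the walk
    must be related.\<close>
  have "(x, t) \<in> A\<^sup>* \<Longrightarrow> (\<exists>e\<in>A. (e, (z, y)) \<in> Theta (parcs G)) \<or> Suc (gdist (parcs G) t z) = gdist (parcs G) t y" for t
  proof (induction rule: rtrancl_induct)
    case (step t u)
    show ?case
    proof (cases "\<exists>e\<in>A. (e, (z, y)) \<in> Theta (parcs G)")
      case False
      then have "((t, u), (z, y)) \<notin> Theta (parcs G)" using step(2) by blast
      then have "gdist (parcs G) t z + gdist (parcs G) u y = gdist (parcs G) t y + gdist (parcs G) u z"
        unfolding mem_Theta using split_sub[OF s step(2)] z(1) by simp
      then show ?thesis using step(3) False by simp
    qed simp
  qed (use z(2) in simp)
  moreover have "Suc (gdist (parcs G) y z) \<noteq> gdist (parcs G) y y" by (simp add: gdist_refl)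
  ultimately obtain e where "e \<in> A" "(e, (z, y)) \<in> Theta (parcs G)" using xy by blast
  then show ?thesis using split_no[OF s _ z(1)] by blast
qed

text \<open>If x and y were distinct, the last arc of a shortest path between them would lie in both
  A and B.\<close>

lemma split_inter:
  assumes s: "arc_split G A B" and x: "x \<in> pverts G" and A: "(x, y) \<in> A\<^sup>*" and B: "(x, y) \<in> B\<^sup>*"
  shows "x = y"
proof (rule ccontr)
  assume ne: "x \<noteq> y"
  have y: "y \<in> pverts G" by (rule split_verts[OF s A x])
  then obtain m where "gdist (parcs G) x y = Suc m" using dist_zero[OF x y] ne not0_implies_Suc by blast
  then obtain z where z: "(z, y) \<in> parcs G" "gdist (parcs G) x y = Suc (gdist (parcs G) x z)" using gdist_pred[OF conn_reach[OF x y]] by metis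
  have "(z, y) \<in> A" by (rule split_last_arc[OF s x A z])
  moreover have "(z, y) \<in> B" by (rule split_last_arc[OF arc_split_swap[OF s] x B z])
  ultimately show False using s unfolding arc_split_def by blast
qed

end

lemma digraph_isoI:
  assumes G: "fin_graph G" and bij: "bij_betw f (pverts G) (pverts H)"
    and H: "parcs H = map_prod f f ` parcs G"
  shows "digraph_iso (with_proj G) (with_proj H)"
proof -
  let ?h = "\<lparr> iso_verts = f, iso_arcs = map_prod f f, iso_head = snd, iso_tail = fst \<rparr>"
  have inj: "inj_on f (pverts G)" "f ` pverts G = pverts H" using bij unfolding bij_betw_def by auto
  have E: "parcs G \<subseteq> pverts G \<times> pverts G" using G unfolding fin_graph_def by simp
  have "wf_digraph (with_proj G)" unfolding wf_digraph_def using E by auto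
  moreover have "inj_on (map_prod f f) (parcs G)"
    using inj_on_subset[OF map_prod_inj_on[OF inj(1) inj(1)] E] .
  ultimately have "pre_digraph.digraph_isomorphism (with_proj G) ?h"
    unfolding pre_digraph.digraph_isomorphism_def using inj(1) by simp
  moreover have "with_proj H = app_iso ?h (with_proj G)"
    unfolding app_iso_def using inj(2) H by (simp add: with_proj_def)
  ultimately show ?thesis unfolding digraph_iso_def by blast
qed

text \<open>The two factors are the components of a base point in the two parts of the split.\<close>
lemma prime_no_split:
  assumes prime: "prime_graph G" and s: "arc_split G A B" and ne: "A \<noteq> {}" "B \<noteq> {}"
  shows False
proof -
  have G: "conn_graph G" using s unfolding arc_split_def by blast
  note s' = arc_split_swap[OF s]
  let ?V = "pverts G" and ?E = "parcs G"
  note c = split_rtrancl_sym[OF G s] split_rtrancl_sym[OF G s']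
  have fin: "finite ?V" and fg: "fin_graph G" using G unfolding conn_graph_def fin_graph_def by auto
  obtain e where "e \<in> A" using ne by blast
  then obtain o' where o: "o' \<in> ?V" using split_sub[OF G s] arc_verts[OF G] by (metis prod.collapse)
  \<comment> \<open>y is the A-coordinate of x: the vertex where the A-component of the base point
    meets the B-component of x.\<close>
  define factor where "factor A B x y \<longleftrightarrow> (o', y) \<in> A\<^sup>* \<and> (y, x) \<in> B\<^sup>*" for A B :: "'a rel" and x y
  have uniq: "y = y'" if s: "arc_split G A B" and yy: "factor A B x y" "factor A B x y'" for A B x y y'
  proof (rule split_inter[OF G s])
    note s' = arc_split_swap[OF s]
    show "(y, y') \<in> A\<^sup>*"
      using yy split_rtrancl_sym[OF G s] unfolding factor_def by (metis rtrancl_trans)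
    show "(y, y') \<in> B\<^sup>*"
      using yy split_rtrancl_sym[OF G s'] unfolding factor_def by (metis rtrancl_trans)
    show "y \<in> ?V" using yy split_verts[OF G s _ o] unfolding factor_def by blast
  qed
  define proj where "proj A B x = (SOME y. factor A B x y)" for A B x
  have proj: "factor A B x (proj A B x)" if s: "arc_split G A B" and x: "x \<in> ?V" for A B x
  proof -
    obtain y where "factor A B x y" unfolding factor_def by (rule split_factor[OF G s o x]) blast
    then show ?thesis unfolding proj_def by (rule someI)
  qed
  have proj_eq: "proj A B x = y" if s: "arc_split G A B" and x: "x \<in> ?V" and f: "factor A B x y" for A B x y
    by (rule uniq[OF s proj[OF s x] f])
  have inj: "x = x'" if s: "arc_split G A B" and x: "x \<in> ?V" "x' \<in> ?V"
    and eq: "proj A B x = proj A B x'" "proj B A x = proj B A x'" for A B x x'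
  proof (rule split_inter[OF G s x(1)])
    note s' = arc_split_swap[OF s]
    show "(x, x') \<in> A\<^sup>*"
      using proj[OF s' x(1)] proj[OF s' x(2)] eq(2) split_rtrancl_sym[OF G s] unfolding factor_def
      by (metis rtrancl_trans)
    show "(x, x') \<in> B\<^sup>*"
      using proj[OF s x(1)] proj[OF s x(2)] eq(1) split_rtrancl_sym[OF G s'] unfolding factor_def
      by (metis rtrancl_trans)
  qed
  \<comment> \<open>An A-arc keeps the B-coordinate, and translated along a B-walk it becomes the
    arc between the A-coordinates. Conversely the projected arc is translated back to x; its end has
    the same coordinates as x' and so equals x'.\<close>
  have arc: "(x, x') \<in> A \<longleftrightarrow> (proj A B x, proj A B x') \<in> A \<and> proj B A x = proj B A x'"
    if s: "arc_split G A B" and x: "x \<in> ?V" "x' \<in> ?V" for A B x x'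
  proof
    note s' = arc_split_swap[OF s]
    note f = proj[OF s x(1)] proj[OF s x(2)] proj[OF s' x(1)] proj[OF s' x(2)]
    {
      assume xx: "(x, x') \<in> A"
      have "factor B A x' (proj B A x)"
        using f(3) xx unfolding factor_def by (meson rtrancl_into_rtrancl)
      then have q: "proj B A x = proj B A x'" using proj_eq[OF s' x(2)] by simp
      have "(x, proj A B x) \<in> B\<^sup>*" using f(1) split_rtrancl_sym[OF G s'] unfolding factor_def by blast
      then obtain w where w: "(x', w) \<in> B\<^sup>*" "(proj A B x, w) \<in> A" by (rule split_translate[OF G s xx])
      have "factor A B x' w"
        using w f(1) split_rtrancl_sym[OF G s'] unfolding factor_def by (meson rtrancl_into_rtrancl)
      then have "proj A B x' = w" by (rule proj_eq[OF s x(2)])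
      then show "(proj A B x, proj A B x') \<in> A \<and> proj B A x = proj B A x'" using w(2) q by simp
    }
    assume a: "(proj A B x, proj A B x') \<in> A \<and> proj B A x = proj B A x'"
    have "(proj A B x, x) \<in> B\<^sup>*" using f(1) unfolding factor_def by blast
    then obtain w where w: "(proj A B x', w) \<in> B\<^sup>*" "(x, w) \<in> A"
      using split_translate[OF G s conjunct1[OF a]] by metis
    have wV: "w \<in> ?V" using split_sub[OF G s w(2)] arc_verts[OF G] by blast
    have 1: "proj A B w = proj A B x'" using f(2) w(1) unfolding factor_def
      by (intro proj_eq[OF s wV]) (simp add: factor_def)
    have "factor B A w (proj B A x)"
      using f(3) w(2) unfolding factor_def by (meson rtrancl_into_rtrancl)
    then have 2: "proj B A w = proj B A x'" using proj_eq[OF s' wV] a by simp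
    show "(x, x') \<in> A" using inj[OF s wV x(2) 1 2] w(2) by simp
  qed
  let ?p = "proj A B" and ?q = "proj B A"
  have comp: "proj A B ` ?V = {y. (o', y) \<in> A\<^sup>*}" if s: "arc_split G A B" for A B
  proof (intro equalityI subsetI)
    show "y \<in> {y. (o', y) \<in> A\<^sup>*}" if "y \<in> proj A B ` ?V" for y
      using that proj[OF s] unfolding factor_def by blast
    fix y assume y: "y \<in> {y. (o', y) \<in> A\<^sup>*}"
    then have yV: "y \<in> ?V" using split_verts[OF G s _ o] by blast
    have "proj A B y = y" by (rule proj_eq[OF s yV]) (use y in \<open>simp add: factor_def\<close>)
    then show "y \<in> proj A B ` ?V" using yV by (metis imageI)
  qed
  define VA where "VA = ?p ` ?V"
  define VB where "VB = ?q ` ?V"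
  have VA: "y \<in> VA \<longleftrightarrow> (o', y) \<in> A\<^sup>*" and VB: "y \<in> VB \<longleftrightarrow> (o', y) \<in> B\<^sup>*" for y
    unfolding VA_def VB_def comp[OF s] comp[OF s'] by simp_all
  have sub: "VA \<subseteq> ?V" "VB \<subseteq> ?V"
    using VA VB split_verts[OF G s _ o] split_verts[OF G s' _ o] by blast+
  \<comment> \<open>A path from y to z sorted with its B-part first turns at the vertex with
    A-coordinate y and B-coordinate z.\<close>
  have surj: "\<exists>x\<in>?V. ?p x = y \<and> ?q x = z" if "y \<in> VA" "z \<in> VB" for y z
  proof -
    have yz: "y \<in> ?V" "z \<in> ?V" using that sub by auto
    obtain w where w: "(y, w) \<in> B\<^sup>*" "(w, z) \<in> A\<^sup>*" by (rule split_factor[OF G s' yz])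
    have wV: "w \<in> ?V" by (rule split_verts[OF G s' w(1) yz(1)])
    have "?p w = y" using that VA w(1) by (intro proj_eq[OF s wV]) (simp add: factor_def)
    moreover have "?q w = z"
      using that VB split_rtrancl_sym[OF G s w(2)] by (intro proj_eq[OF s' wV]) (simp add: factor_def)
    ultimately show ?thesis using wV by blast
  qed
  \<comment> \<open>\<open>prime_graph\<close> quantifies over factors whose vertices are natural
    numbers, so both components are renamed along an injection.\<close>
  obtain h :: "'a \<Rightarrow> nat" where h: "inj_on h ?V" using finite_imp_inj_to_nat_seg[OF fin] by blast
  have hh: "h x = h y \<longleftrightarrow> x = y" if "x \<in> ?V" "y \<in> ?V" for x y using inj_on_eq_iff[OF h that] .
  define Y where "Y i = (if i = 1 then \<lparr> pverts = h ` VA, parcs = map_prod h h ` (A \<inter> VA \<times> VA) \<rparr>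
      else \<lparr> pverts = h ` VB, parcs = map_prod h h ` (B \<inter> VB \<times> VB) \<rparr>)" for i :: nat
  have two: "{1..2} = {1, 2 :: nat}" by auto
  have pg: "pair_graph \<lparr> pverts = h ` W, parcs = map_prod h h ` (A \<inter> W \<times> W) \<rparr>"
    if s: "arc_split G A B" and W: "W \<subseteq> ?V" for A B W
    unfolding pair_graph_iff
  proof (intro conjI)
    show "fin_graph \<lparr>pverts = h ` W, parcs = map_prod h h ` (A \<inter> W \<times> W)\<rparr>"
      unfolding fin_graph_def using finite_subset[OF W fin] by auto
    show "sym (parcs \<lparr>pverts = h ` W, parcs = map_prod h h ` (A \<inter> W \<times> W)\<rparr>)"
      using split_sym[OF G s] by (auto intro!: symI)
    show "irrefl (parcs \<lparr>pverts = h ` W, parcs = map_prod h h ` (A \<inter> W \<times> W)\<rparr>)"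
      unfolding irrefl_def
    proof (intro allI notI)
      fix n assume "(n, n) \<in> parcs \<lparr>pverts = h ` W, parcs = map_prod h h ` (A \<inter> W \<times> W)\<rparr>"
      then obtain x y where xy: "(x, y) \<in> A" "x \<in> W" "y \<in> W" "h x = h y" by auto
      then have "x = y" using hh W by blast
      then show False using xy(1) split_sub[OF G s] arc_irrefl[OF G] by blast
    qed
  qed
  \<comment> \<open>An arc of A projects to an arc of A, hence to two different vertices of that
    factor.\<close>
  have two_le: "card (h ` (proj A B ` ?V)) \<ge> 2"
    if s: "arc_split G A B" and e: "e \<in> A" and W: "proj A B ` ?V \<subseteq> ?V" for A B e
  proof -
    obtain x y where xy: "e = (x, y)" by (cases e)
    have xV: "x \<in> ?V" "y \<in> ?V" using split_sub[OF G s] e arc_verts[OF G] unfolding xy by blast+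
    have "(proj A B x, proj A B y) \<in> A" using arc[OF s xV] e unfolding xy by blast
    then have "proj A B x \<noteq> proj A B y" using split_sub[OF G s] arc_irrefl[OF G] by metis
    then have "card {proj A B x, proj A B y} = 2" by simp
    moreover have "card {proj A B x, proj A B y} \<le> card (proj A B ` ?V)"
      using xV fin by (intro card_mono) auto
    moreover have "card (h ` (proj A B ` ?V)) = card (proj A B ` ?V)"
      by (rule card_image[OF inj_on_subset[OF h W]])
    ultimately show ?thesis by simp
  qed
  define f where "f x = (\<lambda>i\<in>{1..2::nat}. h (if i = 1 then ?p x else ?q x))" for x
  let ?H = "cart_prod {1..2} Y"
  have f12: "f x 1 = h (?p x)" "f x 2 = h (?q x)" for x unfolding f_def by auto
  have pV: "?p x \<in> VA" "?q x \<in> VB" if "x \<in> ?V" for x using that unfolding VA_def VB_def by auto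
  have fP: "f x \<in> pverts ?H" if "x \<in> ?V" for x
    unfolding pverts_cart_prod f_def Y_def using pV[OF that] by auto
  have finj: "inj_on f ?V"
  proof (rule inj_onI)
    fix x y assume xy: "x \<in> ?V" "y \<in> ?V" "f x = f y"
    then have "h (?p x) = h (?p y)" "h (?q x) = h (?q y)" using f12 by metis+
    then show "x = y" using inj[OF s xy(1,2)] hh pV[OF xy(1)] pV[OF xy(2)] sub by blast
  qed
  have fsurj: "f ` ?V = pverts ?H"
  proof
    show "f ` ?V \<subseteq> pverts ?H" using fP by blast
    show "pverts ?H \<subseteq> f ` ?V"
    proof
      fix u assume u: "u \<in> pverts ?H"
      have "u 1 \<in> h ` VA" "u 2 \<in> h ` VB"
        using u unfolding pverts_cart_prod Y_def two by (auto simp: PiE_iff)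
      then obtain y z where yz: "y \<in> VA" "z \<in> VB" "u 1 = h y" "u 2 = h z" by blast
      then obtain x where x: "x \<in> ?V" "?p x = y" "?q x = z" using surj by blast
      have "f x = u"
      proof (rule PiE_ext[of _ "{1..2}" "\<lambda>i. pverts (Y i)"])
        show "f x \<in> (\<Pi>\<^sub>E i\<in>{1..2}. pverts (Y i))" "u \<in> (\<Pi>\<^sub>E i\<in>{1..2}. pverts (Y i))"
          using fP[OF x(1)] u unfolding pverts_cart_prod by auto
        fix i :: nat assume "i \<in> {1..2}"
        then show "f x i = u i" using f12[of x] x yz unfolding two by auto
      qed
      then show "u \<in> f ` ?V" using x(1) by blast
    qed
  qed
  have im: "(h x, h y) \<in> map_prod h h ` (R \<inter> W \<times> W) \<longleftrightarrow> (x, y) \<in> R"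
    if "W \<subseteq> ?V" "x \<in> W" "y \<in> W" for R W x y
  proof
    assume "(h x, h y) \<in> map_prod h h ` (R \<inter> W \<times> W)"
    then obtain a b where ab: "(a, b) \<in> R" "a \<in> W" "b \<in> W" "h a = h x" "h b = h y" by auto
    then have "a = x" "b = y" using hh that by blast+
    then show "(x, y) \<in> R" using ab(1) by simp
  qed (use that in force)
  have farc: "(f x, f y) \<in> parcs ?H \<longleftrightarrow> (x, y) \<in> ?E" if xy: "x \<in> ?V" "y \<in> ?V" for x y
  proof -
    have "(f x, f y) \<in> parcs ?H \<longleftrightarrow> (\<exists>i\<in>{1..2}. (f x i, f y i) \<in> parcs (Y i) \<and> (\<forall>j\<in>{1..2} - {i}. f x j = f y j))"
      using fP[OF xy(1)] fP[OF xy(2)] unfolding cart_prod_def by simp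
    also have "\<dots> \<longleftrightarrow> (f x 1, f y 1) \<in> parcs (Y 1) \<and> f x 2 = f y 2 \<or> (f x 2, f y 2) \<in> parcs (Y 2) \<and> f x 1 = f y 1"
      unfolding two by auto
    also have "(f x 1, f y 1) \<in> parcs (Y 1) \<longleftrightarrow> (?p x, ?p y) \<in> A"
      unfolding f12 Y_def using im[OF sub(1) pV(1)[OF xy(1)] pV(1)[OF xy(2)]] by simp
    also have "(f x 2, f y 2) \<in> parcs (Y 2) \<longleftrightarrow> (?q x, ?q y) \<in> B"
      unfolding f12 Y_def using im[OF sub(2) pV(2)[OF xy(1)] pV(2)[OF xy(2)]] by simp
    also have "f x 1 = f y 1 \<longleftrightarrow> ?p x = ?p y"
      unfolding f12 using pV[OF xy(1)] pV[OF xy(2)] sub by (intro hh) auto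
    also have "f x 2 = f y 2 \<longleftrightarrow> ?q x = ?q y"
      unfolding f12 using pV[OF xy(1)] pV[OF xy(2)] sub by (intro hh) auto
    finally have "(f x, f y) \<in> parcs ?H \<longleftrightarrow> (x, y) \<in> A \<or> (x, y) \<in> B"
      unfolding arc[OF s xy] arc[OF s' xy] .
    then show ?thesis using s unfolding arc_split_def by blast
  qed
  have "parcs ?H = map_prod f f ` ?E"
  proof (intro equalityI subrelI)
    fix u v assume uv: "(u, v) \<in> parcs ?H"
    then have "u \<in> f ` ?V" "v \<in> f ` ?V" unfolding fsurj unfolding cart_prod_def by auto
    then obtain x y where "x \<in> ?V" "y \<in> ?V" "u = f x" "v = f y" by blast
    then show "(u, v) \<in> map_prod f f ` ?E" using farc uv by force
  next
    fix u v assume "(u, v) \<in> map_prod f f ` ?E"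
    then obtain x y where xy: "(x, y) \<in> ?E" "u = f x" "v = f y" by auto
    then show "(u, v) \<in> parcs ?H" using farc arc_verts[OF G xy(1)] by simp
  qed
  then have iso: "digraph_iso (with_proj G) (with_proj ?H)"
    using digraph_isoI[OF fg] finj fsurj unfolding bij_betw_def by blast
  obtain e f where ef: "e \<in> A" "f \<in> B" using ne by blast
  have "\<forall>i\<in>{1..2}. pair_graph (Y i) \<and> card (pverts (Y i)) \<ge> 2"
    unfolding two Y_def
    using pg[OF s sub(1)] pg[OF s' sub(2)] two_le[OF s ef(1)] two_le[OF s' ef(2)] sub
    unfolding VA_def VB_def by simp
  then have "2 = (1 :: nat)" using prime iso unfolding prime_graph_def by (metis one_le_numeral)
  then show False by simp
qed

lemma prime_single_class:
  assumes G: "conn_graph G" and prime: "prime_graph G" and e: "e \<in> parcs G" "f \<in> parcs G"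
  shows "(e, f) \<in> (Theta (parcs G) \<union> tau (parcs G))\<^sup>*"
proof (rule ccontr)
  let ?E = "parcs G" and ?S = "Theta (parcs G) \<union> tau (parcs G)"
  let ?A = "{g \<in> ?E. (e, g) \<in> ?S\<^sup>*}"
  assume "(e, f) \<notin> ?S\<^sup>*"
  then have "f \<in> ?E - ?A" using e by simp
  moreover have "e \<in> ?A" using e by simp
  ultimately have ne: "?A \<noteq> {}" "?E - ?A \<noteq> {}" by blast+
  have "arc_split G ?A (?E - ?A)"
    unfolding arc_split_def
  proof (intro conjI ballI)
    fix g h assume "g \<in> ?A" "h \<in> ?E - ?A"
    then show "(g, h) \<notin> ?S" using rtrancl_into_rtrancl[of e g ?S h] by blast
  qed (use G in auto)
  then show False using prime_no_split[OF prime] ne by blast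
qed

subsection \<open>Directions of arcs in a Cartesian product\<close>

locale graph_product =
  fixes I :: "'i set" and X :: "'i \<Rightarrow> 'a pair_pre_digraph"
  assumes finI: "finite I" and conn: "\<And>i. i \<in> I \<Longrightarrow> conn_graph (X i)"
begin

abbreviation "P \<equiv> (\<Pi>\<^sub>E i\<in>I. pverts (X i))"
abbreviation "E \<equiv> parcs (cart_prod I X)"
abbreviation "dir \<equiv> arcs_in_dir I X"
abbreviation "di i \<equiv> gdist (parcs (X i))"

lemma fin: "i \<in> I \<Longrightarrow> fin_graph (X i)"
  using conn unfolding conn_graph_def by blast

lemma fin_prod: "fin_graph (cart_prod I X)"
  by (rule fin_graph_cart_prod[OF finI fin])

lemma mem_dir: "(x, y) \<in> dir i \<longleftrightarrow> x \<in> P \<and> y \<in> P \<and> (x i, y i) \<in> parcs (X i) \<and>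
    (\<forall>j\<in>I - {i}. x j = y j)"
  unfolding arcs_in_dir_def by simp

lemma E_dir: "e \<in> E \<longleftrightarrow> (\<exists>i\<in>I. e \<in> dir i)"
  unfolding parcs_cart_prod by blast

lemma E_sub: "E \<subseteq> P \<times> P"
  using fin_prod unfolding fin_graph_def pverts_cart_prod by blast

lemma dir_upd: "x \<in> P \<Longrightarrow> i \<in> I \<Longrightarrow> (c, e) \<in> parcs (X i) \<Longrightarrow> (x(i := c), x(i := e)) \<in> dir i"
  unfolding mem_dir using arc_verts[OF conn] PiE_upd[of x I "\<lambda>i. pverts (X i)" i] by simp

lemma dir_form: "(x, y) \<in> dir i \<Longrightarrow> i \<in> I \<Longrightarrow> x \<in> P \<and> y = x(i := y i) \<and> (x i, y i) \<in> parcs (X i)"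
  unfolding mem_dir using agree_upd[of x I "\<lambda>i. pverts (X i)" y i] by simp

text \<open>By \<open>gdist_eqI\<close>: an arc changes one summand only and raises it by at most
  one, and a positive sum has a positive summand that a step can lower.\<close>

lemma prod_sum:
  assumes x: "x \<in> P" and y: "y \<in> P"
  shows "gdist E x y = (\<Sum>i\<in>I. di i (x i) (y i))" "(x, y) \<in> E\<^sup>*"
proof -
  let ?f = "\<lambda>y. \<Sum>i\<in>I. di i (x i) (y i)"
  have xi: "x i \<in> pverts (X i)" if "i \<in> I" for i using x that by auto
  have sum_upd: "(\<Sum>i\<in>I. di i (x i) (z i)) = di k (x k) (z k) + (\<Sum>i\<in>I - {k}. di i (x i) (z i))"
    if "k \<in> I" for k z by (rule sum.remove[OF finI that])
  have 1: "?f x = 0" by (simp add: gdist_refl)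
  have 2: "y = x" if "y \<in> P" "?f y = 0" for y
  proof (rule PiE_ext[OF that(1) x])
    fix i assume i: "i \<in> I"
    have yi: "y i \<in> pverts (X i)" using that(1) i by auto
    have "di i (x i) (y i) = 0" using that(2) finI i by simp
    then show "y i = x i" using dist_zero[OF conn[OF i] xi[OF i] yi] by simp
  qed
  have 3: "?f z \<le> Suc (?f y)" if yz: "(y, z) \<in> E" for y z
  proof -
    obtain k where k: "k \<in> I" "(y, z) \<in> dir k" using yz E_dir by blast
    have yz': "y \<in> P" "(y k, z k) \<in> parcs (X k)" "\<forall>j\<in>I - {k}. y j = z j" using k(2) unfolding mem_dir by auto
    have "y k \<in> pverts (X k)" using yz'(1) k(1) by auto
    then have "di k (x k) (z k) \<le> Suc (di k (x k) (y k))"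
      using gdist_step[OF conn_reach[OF conn[OF k(1)] xi[OF k(1)]] yz'(2)] by simp
    moreover have "(\<Sum>i\<in>I - {k}. di i (x i) (z i)) = (\<Sum>i\<in>I - {k}. di i (x i) (y i))"
      using yz'(3) by (intro sum.cong) auto
    ultimately show ?thesis unfolding sum_upd[OF k(1)] by simp
  qed
  have 4: "\<exists>z\<in>P. (z, y) \<in> E \<and> ?f z = m" if y: "y \<in> P" and f: "?f y = Suc m" for y m
  proof -
    have "?f y \<noteq> 0" using f by simp
    then obtain k where k: "k \<in> I" "di k (x k) (y k) \<noteq> 0" by (rule sum.not_neutral_contains_not_neutral)
    then obtain n where n: "di k (x k) (y k) = Suc n" using not0_implies_Suc by blast
    have yk: "y k \<in> pverts (X k)" using y k(1) by auto
    obtain c where c: "(c, y k) \<in> parcs (X k)" "di k (x k) c = n"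
      using gdist_pred[OF conn_reach[OF conn[OF k(1)] xi[OF k(1)] yk] n] by metis
    have "(y(k := c), y(k := y k)) \<in> dir k" by (rule dir_upd[OF y k(1) c(1)])
    then have e: "(y(k := c), y) \<in> E" unfolding E_dir using k(1) by auto
    have "?f (y(k := c)) = n + (\<Sum>i\<in>I - {k}. di i (x i) (y i))"
      unfolding sum_upd[OF k(1)] using c(2) by (simp add: fun_upd_other)
    moreover have "?f y = Suc n + (\<Sum>i\<in>I - {k}. di i (x i) (y i))"
      unfolding sum_upd[OF k(1)] n ..
    ultimately show ?thesis using f e E_sub by (intro bexI[of _ "y(k := c)"]) auto
  qed
  show "gdist E x y = ?f y" "(x, y) \<in> E\<^sup>*"
    using gdist_eqI[of E P ?f x y, OF E_sub 1 2 3 4 y] by blast+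
qed

lemma conn_prod: "conn_graph (cart_prod I X)"
  unfolding conn_graph_def
proof (intro conjI ballI)
  show "fin_graph (cart_prod I X)" by (rule fin_prod)
  show "sym E"
  proof (rule symI)
    fix x y assume "(x, y) \<in> E"
    then obtain i where i: "i \<in> I" "(x, y) \<in> dir i" using E_dir by blast
    then have "(y, x) \<in> dir i" using arc_sym[OF conn[OF i(1)]] unfolding mem_dir by simp
    then show "(y, x) \<in> E" using i(1) E_dir by blast
  qed
  show "irrefl E"
    unfolding irrefl_def
  proof (intro allI notI)
    fix x assume "(x, x) \<in> E"
    then obtain i where i: "i \<in> I" "(x, x) \<in> dir i" using E_dir by blast
    then show False using arc_irrefl[OF conn[OF i(1)]] unfolding mem_dir by simp
  qed
  show "(x, y) \<in> E\<^sup>*" if "x \<in> pverts (cart_prod I X)" "y \<in> pverts (cart_prod I X)" for x y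
    using prod_sum(2) that unfolding pverts_cart_prod by blast
qed

abbreviation "S \<equiv> Theta E \<union> tau E"

text \<open>For arcs of different directions every coordinate is constant along one of the two, so
  the distance sums in Theta agree term by term. If they share their tail, changing both coordinates
  gives the fourth corner of a square, which rules out tau.\<close>

lemma S_same_dir:
  assumes ef: "(e, f) \<in> S" and i: "i \<in> I" "e \<in> dir i"
  shows "f \<in> dir i"
proof -
  obtain x y u v where e: "e = (x, y)" "f = (u, v)" by (cases e, cases f)
  have "f \<in> E" using ef unfolding e by (auto simp: mem_Theta mem_tau)
  then obtain j where j: "j \<in> I" "f \<in> dir j" using E_dir by blast
  show ?thesis
  proof (cases "i = j")
    case False
    have xy: "x \<in> P" "y \<in> P" "\<forall>l\<in>I - {i}. x l = y l" "(x i, y i) \<in> parcs (X i)"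
      using i(2) unfolding e mem_dir by auto
    have uv: "u \<in> P" "v \<in> P" "\<forall>l\<in>I - {j}. u l = v l" "(u j, v j) \<in> parcs (X j)"
      using j(2) unfolding e mem_dir by auto
    have "(e, f) \<notin> Theta E"
    proof -
      have "gdist E x u + gdist E y v = (\<Sum>l\<in>I. di l (x l) (u l) + di l (y l) (v l))"
        unfolding prod_sum(1)[OF xy(1) uv(1)] prod_sum(1)[OF xy(2) uv(2)] by (rule sum.distrib[symmetric])
      also have "\<dots> = (\<Sum>l\<in>I. di l (x l) (v l) + di l (y l) (u l))"
      proof (rule sum.cong[OF refl])
        fix l assume l: "l \<in> I"
        have "x l = y l \<or> u l = v l" using xy(3) uv(3) False l by blast
        then show "di l (x l) (u l) + di l (y l) (v l) = di l (x l) (v l) + di l (y l) (u l)" by auto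
      qed
      also have "\<dots> = gdist E x v + gdist E y u"
        unfolding prod_sum(1)[OF xy(1) uv(2)] prod_sum(1)[OF xy(2) uv(1)] by (rule sum.distrib)
      finally show ?thesis unfolding e mem_Theta by simp
    qed
    moreover have "(e, f) \<notin> tau E"
    proof
      assume t: "(e, f) \<in> tau E"
      then have ux: "u = x" unfolding e mem_tau by simp
      have only: "w = x" if "(y, w) \<in> E" "(v, w) \<in> E" for w
        using t that unfolding e mem_tau by metis
      let ?w = "x(i := y i, j := v j)"
      have y: "y = x(i := y i)" using dir_form[of x y i] i unfolding e by blast
      have v: "v = x(j := v j)" using dir_form[of u v j] j unfolding e ux by blast
      have "y j = x j" using xy(3) j(1) False by simp
      then have "y = y(j := x j)" by (rule fun_upd_idem[symmetric])
      moreover have "?w = y(j := v j)" using y by metis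
      moreover have "(y(j := x j), y(j := v j)) \<in> dir j"
        using dir_upd[OF xy(2) j(1)] uv(4) ux by blast
      ultimately have 1: "(y, ?w) \<in> E" using j(1) E_dir by metis
      have "v i = x i" using uv(3) i(1) False ux by simp
      then have "v = v(i := x i)" by (rule fun_upd_idem[symmetric])
      moreover have "?w = v(i := y i)" using v False by (metis fun_upd_twist)
      moreover have "(v(i := x i), v(i := y i)) \<in> dir i"
        using dir_upd[OF uv(2) i(1)] xy(4) by blast
      ultimately have 2: "(v, ?w) \<in> E" using i(1) E_dir by metis
      have "?w = x" by (rule only[OF 1 2])
      then have "x i = y i" using False by (metis fun_upd_apply)
      then show False using xy(4) arc_irrefl[OF conn[OF i(1)]] by simp
    qed
    ultimately show ?thesis using ef by blast
  qed (use j in simp)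
qed

lemma dist_upd:
  assumes "x \<in> P" "i \<in> I" "a \<in> pverts (X i)" "b \<in> pverts (X i)"
  shows "gdist E (x(i := a)) (x(i := b)) = di i a b"
proof -
  have "gdist E (x(i := a)) (x(i := b)) = (\<Sum>l\<in>I. di l ((x(i := a)) l) ((x(i := b)) l))"
    using assms PiE_upd[of x I "\<lambda>i. pverts (X i)" i] by (intro prod_sum(1)) blast+
  also have "\<dots> = di i a b + (\<Sum>l\<in>I - {i}. di l ((x(i := a)) l) ((x(i := b)) l))"
    using sum.remove[OF finI assms(2), of "\<lambda>l. di l ((x(i := a)) l) ((x(i := b)) l)"] by simp
  also have "(\<Sum>l\<in>I - {i}. di l ((x(i := a)) l) ((x(i := b)) l)) = 0"
    by (rule sum.neutral) (simp add: gdist_refl)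
  finally show ?thesis unfolding add_0_right .
qed

text \<open>A layer is embedded isometrically, which transfers Theta. For tau, a common neighbour of
  two distinct vertices of the layer can differ from them only in coordinate i, so no square leaves
  the layer.\<close>

lemma S_layer:
  assumes x: "x \<in> P" and i: "i \<in> I"
    and S: "((a, b), (a', b')) \<in> Theta (parcs (X i)) \<union> tau (parcs (X i))"
  shows "((x(i := a), x(i := b)), (x(i := a'), x(i := b'))) \<in> S"
proof -
  have ar: "(a, b) \<in> parcs (X i)" "(a', b') \<in> parcs (X i)" using S by (auto simp: mem_Theta mem_tau)
  have V: "a \<in> pverts (X i)" "b \<in> pverts (X i)" "a' \<in> pverts (X i)" "b' \<in> pverts (X i)"
    using ar arc_verts[OF conn[OF i]] by blast+
  have e: "(x(i := a), x(i := b)) \<in> E" "(x(i := a'), x(i := b')) \<in> E"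
    using dir_upd[OF x i ar(1)] dir_upd[OF x i ar(2)] i E_dir by blast+
  show ?thesis
  proof (cases "((a, b), (a', b')) \<in> Theta (parcs (X i))")
    case True
    then have "((x(i := a), x(i := b)), (x(i := a'), x(i := b'))) \<in> Theta E"
      unfolding mem_Theta using e by (simp add: dist_upd[OF x i] V)
    then show ?thesis by blast
  next
    case False
    then have t: "a = a'" "b \<noteq> b'" "\<And>w. (b, w) \<in> parcs (X i) \<Longrightarrow> (b', w) \<in> parcs (X i) \<Longrightarrow> w = a"
      using S unfolding Un_iff mem_tau by blast+
    have "w = x(i := a)" if w: "(x(i := b), w) \<in> E" "(x(i := b'), w) \<in> E" for w
    proof -
      obtain k where k: "k \<in> I" "(x(i := b), w) \<in> dir k" using w(1) E_dir by blast
      obtain l where l: "l \<in> I" "(x(i := b'), w) \<in> dir l" using w(2) E_dir by blast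
      have kl: "k = i \<and> l = i"
      proof (rule ccontr)
        assume n: "\<not> (k = i \<and> l = i)"
        consider "k \<noteq> i" "l \<noteq> i" | "k \<noteq> i" "l = i" | "k = i" "l \<noteq> i" using n by blast
        then show False
        proof cases
          case 1
          have "(x(i := b)) i = w i" using k(2) 1(1) i unfolding mem_dir by blast
          moreover have "(x(i := b')) i = w i" using l(2) 1(2) i unfolding mem_dir by blast
          ultimately show False using t(2) by simp
        next
          case 2
          have "(x k, w k) \<in> parcs (X k)" using k(2) 2 unfolding mem_dir by simp
          moreover have "x k = w k" using l(2) 2 k(1) unfolding mem_dir by simp
          ultimately show False using arc_irrefl[OF conn[OF k(1)]] by simp
        next
          case 3
          have "(x l, w l) \<in> parcs (X l)" using l(2) 3 unfolding mem_dir by simp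
          moreover have "x l = w l" using k(2) 3 l(1) unfolding mem_dir by simp
          ultimately show False using arc_irrefl[OF conn[OF l(1)]] by simp
        qed
      qed
      then have "w = (x(i := b))(i := w i)" "(b, w i) \<in> parcs (X i)" "(b', w i) \<in> parcs (X i)"
        using dir_form[OF k(2,1)] dir_form[OF l(2,1)] by auto
      then show ?thesis using t(3) by (metis fun_upd_upd)
    qed
    moreover have "x(i := b) \<noteq> x(i := b')" using t(2) by (metis fun_upd_same)
    ultimately have "((x(i := a), x(i := b)), (x(i := a'), x(i := b'))) \<in> tau E"
      unfolding mem_tau using e t(1) by blast
    then show ?thesis by blast
  qed
qed

text \<open>With D the distance contributed by the other coordinates, Theta compares D + D with (1 +
  D) + (1 + D).\<close>

lemma S_parallel:
  assumes x: "x \<in> P" and u: "u \<in> P" and i: "i \<in> I" and ab: "(a, b) \<in> parcs (X i)"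
  shows "((x(i := a), x(i := b)), (u(i := a), u(i := b))) \<in> S"
proof -
  have V: "a \<in> pverts (X i)" "b \<in> pverts (X i)" using ab arc_verts[OF conn[OF i]] by blast+
  have e: "(x(i := a), x(i := b)) \<in> E" "(u(i := a), u(i := b)) \<in> E"
    using dir_upd[OF x i ab] dir_upd[OF u i ab] i E_dir by blast+
  let ?D = "\<Sum>l\<in>I - {i}. di l (x l) (u l)"
  have dd: "gdist E (x(i := c)) (u(i := c')) = di i c c' + ?D"
    if "c \<in> pverts (X i)" "c' \<in> pverts (X i)" for c c'
  proof -
    have "gdist E (x(i := c)) (u(i := c')) = (\<Sum>l\<in>I. di l ((x(i := c)) l) ((u(i := c')) l))"
      using x u i that PiE_upd[of _ I "\<lambda>i. pverts (X i)" i] by (intro prod_sum(1)) blast+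
    also have "\<dots> = di i c c' + (\<Sum>l\<in>I - {i}. di l ((x(i := c)) l) ((u(i := c')) l))"
      using sum.remove[OF finI i, of "\<lambda>l. di l ((x(i := c)) l) ((u(i := c')) l)"] by simp
    also have "(\<Sum>l\<in>I - {i}. di l ((x(i := c)) l) ((u(i := c')) l)) = ?D"
      by (rule sum.cong) auto
    finally show ?thesis .
  qed
  have "di i a b = 1" "di i b a = 1"
    using dist_arc[OF conn[OF i] ab] dist_arc[OF conn[OF i] arc_sym[OF conn[OF i] ab]] by auto
  then have "((x(i := a), x(i := b)), (u(i := a), u(i := b))) \<in> Theta E"
    unfolding mem_Theta using e by (simp add: dd V gdist_refl)
  then show ?thesis by blast
qed

text \<open>Primeness of the factor links arcs within one layer, and a single step between parallel
  arcs then changes the layer.\<close>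

lemma S_rtrancl_dir:
  assumes prime: "\<And>i. i \<in> I \<Longrightarrow> prime_graph (X i)" and i: "i \<in> I" and e: "e \<in> dir i"
  shows "(e, f) \<in> S\<^sup>* \<longleftrightarrow> f \<in> dir i"
proof
  assume "(e, f) \<in> S\<^sup>*"
  then show "f \<in> dir i" by (induction rule: rtrancl_induct) (use e S_same_dir i in blast)+
next
  assume f: "f \<in> dir i"
  obtain x y u v where xy: "e = (x, y)" "f = (u, v)" by (cases e, cases f)
  have x: "x \<in> P" "y = x(i := y i)" "(x i, y i) \<in> parcs (X i)" using dir_form[of x y i] e i unfolding xy by auto
  have u: "u \<in> P" "v = u(i := v i)" "(u i, v i) \<in> parcs (X i)" using dir_form[of u v i] f i unfolding xy by auto
  have "((x i, y i), (u i, v i)) \<in> (Theta (parcs (X i)) \<union> tau (parcs (X i)))\<^sup>*"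
    by (rule prime_single_class[OF conn[OF i] prime[OF i] x(3) u(3)])
  then have "((x(i := x i), x(i := y i)), (x(i := u i), x(i := v i))) \<in> S\<^sup>*"
  proof (induction rule: rtrancl_induct2)
    case (step a b a' b')
    show ?case by (rule rtrancl_into_rtrancl[OF step(3) S_layer[OF x(1) i step(2)]])
  qed simp
  moreover have "((x(i := u i), x(i := v i)), (u(i := u i), u(i := v i))) \<in> S"
    by (rule S_parallel[OF x(1) u(1) i u(3)])
  ultimately have "((x(i := x i), x(i := y i)), (u(i := u i), u(i := v i))) \<in> S\<^sup>*" by (rule rtrancl_into_rtrancl)
  then show "(e, f) \<in> S\<^sup>*" unfolding xy using x(2) u(2) by simp
qed

end

subsection \<open>Functions invariant under the stable colouring\<close>

lemma same_type_refl: "same_type G m x x"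
  unfolding same_type_def by simp

lemma same_type_eq: "same_type G m x y \<Longrightarrow> same_type G m x z \<longleftrightarrow> same_type G m y z"
  unfolding same_type_def by simp

text \<open>Lets equality of colours, which the rounds compare, be read as membership in a
  class.\<close>

lemma wl_class_iff:
  assumes "x \<in> tuples m (pverts G)" "y \<in> tuples m (pverts G)"
  shows "y \<in> wl_class G m r x \<longleftrightarrow> wl_class G m r y = wl_class G m r x"
proof (cases r)
  case 0
  have "y \<in> wl_class G m 0 y" using assms(2) same_type_refl by simp
  moreover have "wl_class G m 0 y = wl_class G m 0 x" if "y \<in> wl_class G m 0 x"
    using that same_type_eq[of G m x y] by auto
  ultimately show ?thesis unfolding 0 by blast
next
  case (Suc r)
  have "y \<in> wl_class G m (Suc r) y" using assms(2) by simp
  moreover have "wl_class G m (Suc r) y = wl_class G m (Suc r) x" if "y \<in> wl_class G m (Suc r) x"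
    using that by auto
  ultimately show ?thesis unfolding Suc by blast
qed

lemma wl_class_pred:
  assumes "x \<in> tuples m (pverts G)" "y \<in> tuples m (pverts G)"
    "wl_class G m (Suc r) y = wl_class G m (Suc r) x"
  shows "wl_class G m r y = wl_class G m r x"
  using wl_class_iff[OF assms(1,2), of "Suc r"] assms(3) by simp

lemma wl_class_le:
  assumes "x \<in> tuples m (pverts G)" "y \<in> tuples m (pverts G)"
    "wl_class G m r y = wl_class G m r x" "q \<le> r"
  shows "wl_class G m q y = wl_class G m q x"
  using assms(4,3) by (induction rule: dec_induct) (use wl_class_pred[OF assms(1,2)] in blast)+

definition stable_eq :: "'a pair_pre_digraph \<Rightarrow> nat \<Rightarrow> 'a list \<Rightarrow> 'a list \<Rightarrow> bool" where
  "stable_eq G m x y \<longleftrightarrow> (\<forall>r. wl_class G m r y = wl_class G m r x)"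

definition invariant :: "'a pair_pre_digraph \<Rightarrow> nat \<Rightarrow> ('a list \<Rightarrow> 'b) \<Rightarrow> bool" where
  "invariant G m f \<longleftrightarrow> (\<forall>x\<in>tuples m (pverts G). \<forall>y\<in>tuples m (pverts G). stable_eq G m x y \<longrightarrow> f x = f y)"

text \<open>There are finitely many pairs of tuples, and a pair once separated stays separated; so
  one waits until every pair that is ever separated has been.\<close>

lemma stable_round:
  assumes fin: "finite (pverts G)"
  obtains N where "\<And>x y. x \<in> tuples m (pverts G) \<Longrightarrow> y \<in> tuples m (pverts G) \<Longrightarrow>
    wl_class G m N y = wl_class G m N x \<Longrightarrow> stable_eq G m x y"
proof -
  let ?T = "tuples m (pverts G)"
  have finT: "finite ?T"
    using finite_lists_length_eq[OF fin, of m] unfolding tuples_def by (simp add: conj_commute)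
  define q where "q = (\<lambda>(x, y). SOME r. wl_class G m r y \<noteq> wl_class G m r x)"
  \<comment> \<open>The inserted 0 keeps the maximum meaningful when there are no tuples.\<close>
  let ?N = "Max (insert 0 (q ` (?T \<times> ?T)))"
  show thesis
  proof (rule that)
    fix x y assume xy: "x \<in> ?T" "y \<in> ?T" and eq: "wl_class G m ?N y = wl_class G m ?N x"
    show "stable_eq G m x y"
    proof (rule ccontr)
      assume "\<not> stable_eq G m x y"
      then have "\<exists>r. wl_class G m r y \<noteq> wl_class G m r x" unfolding stable_eq_def by blast
      then have "wl_class G m (q (x, y)) y \<noteq> wl_class G m (q (x, y)) x"
        unfolding q_def prod.case by (rule someI_ex)
      moreover have "q (x, y) \<le> ?N" using finT xy by (intro Max_ge) auto
      ultimately show False using wl_class_le[OF xy eq] by blast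
    qed
  qed
qed

lemma tuples_update: "x \<in> tuples m V \<Longrightarrow> v \<in> V \<Longrightarrow> x[i := v] \<in> tuples m V"
  unfolding tuples_def using set_update_subset_insert[of x i v] by auto

text \<open>An invariant function factors through the colour of a stable round N, and round N + 1
  compares exactly the multisets of these colours over all substitutions.\<close>

lemma invariant_mset:
  assumes fin: "finite (pverts G)" and f: "invariant G m f" and i: "i < m"
  shows "invariant G m (\<lambda>x. image_mset (\<lambda>v. f (x[i := v])) (mset_set (pverts G)))"
  unfolding invariant_def
proof (intro ballI impI)
  let ?V = "pverts G" and ?T = "tuples m (pverts G)"
  fix x y assume xy: "x \<in> ?T" "y \<in> ?T" "stable_eq G m x y"
  obtain N where N: "\<And>x y. x \<in> ?T \<Longrightarrow> y \<in> ?T \<Longrightarrow>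
    wl_class G m N y = wl_class G m N x \<Longrightarrow> stable_eq G m x y" using stable_round[OF fin] by blast
  \<comment> \<open>g reads the value of f off a colour; the choice of representative is immaterial
    because f is invariant and round N is stable.\<close>
  define g where "g c = f (SOME z. z \<in> ?T \<and> wl_class G m N z = c)" for c
  have g: "g (wl_class G m N z) = f z" if z: "z \<in> ?T" for z
  proof -
    let ?w = "SOME w. w \<in> ?T \<and> wl_class G m N w = wl_class G m N z"
    have "?w \<in> ?T \<and> wl_class G m N ?w = wl_class G m N z" by (rule someI[of _ z]) (use z in simp)
    then have "stable_eq G m z ?w" "?w \<in> ?T" using N[OF z] by auto
    then show ?thesis using f z unfolding g_def invariant_def by metis
  qed
  let ?c = "\<lambda>x. image_mset (\<lambda>v. map (\<lambda>i. wl_class G m N (x[i := v])) [0..<m]) (mset_set ?V)"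
  have "image_mset (\<lambda>v. f (x[i := v])) (mset_set ?V) = image_mset (\<lambda>l. g (l ! i)) (?c x)" if x: "x \<in> ?T" for x
  proof -
    have "image_mset (\<lambda>v. f (x[i := v])) (mset_set ?V) =
      image_mset (\<lambda>v. g (map (\<lambda>i. wl_class G m N (x[i := v])) [0..<m] ! i)) (mset_set ?V)"
    proof (rule image_mset_cong)
      fix v assume "v \<in># mset_set ?V"
      then have "v \<in> ?V" using fin by simp
      then show "f (x[i := v]) = g (map (\<lambda>i. wl_class G m N (x[i := v])) [0..<m] ! i)"
        using g[OF tuples_update[OF x]] i by simp
    qed
    then show ?thesis by (simp add: multiset.map_comp comp_def)
  qed
  moreover have "?c y = ?c x"
  proof -
    have "y \<in> wl_class G m (Suc N) x"
      using wl_class_iff[OF xy(1,2)] xy(3) unfolding stable_eq_def by blast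
    then show ?thesis by simp
  qed
  ultimately show "image_mset (\<lambda>v. f (x[i := v])) (mset_set ?V) = image_mset (\<lambda>v. f (y[i := v])) (mset_set ?V)"
    using xy by simp
qed

lemma invariant_cong:
  "invariant G m f \<Longrightarrow> (\<And>x. x \<in> tuples m (pverts G) \<Longrightarrow> f x = g x) \<Longrightarrow> invariant G m g"
  unfolding invariant_def by simp

lemma invariant_map: "invariant G m f \<Longrightarrow> invariant G m (\<lambda>x. h (f x))"
  unfolding invariant_def by metis

lemma invariant_map2: "invariant G m f \<Longrightarrow> invariant G m g \<Longrightarrow> invariant G m (\<lambda>x. h (f x) (g x))"
  unfolding invariant_def by metis

text \<open>Collects infinitely many invariant values into one, so that distances and transitive
  closures can be derived from walks of each fixed length.\<close>

lemma invariant_fun: "(\<And>n. invariant G m (\<lambda>x. f x n)) \<Longrightarrow> invariant G m f"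
  unfolding invariant_def by (intro ballI impI ext) blast

lemma invariant_type:
  assumes "i < m" "j < m"
  shows "invariant G m (\<lambda>x. x ! i = x ! j)" "invariant G m (\<lambda>x. (x ! i, x ! j) \<in> parcs G)"
proof -
  have "same_type G m x y"
    if "x \<in> tuples m (pverts G)" "y \<in> tuples m (pverts G)" "stable_eq G m x y" for x y
  proof -
    have "y \<in> wl_class G m 0 x"
      using wl_class_iff[OF that(1,2), of 0] that(3) unfolding stable_eq_def by blast
    then show ?thesis by simp
  qed
  then show "invariant G m (\<lambda>x. x ! i = x ! j)" "invariant G m (\<lambda>x. (x ! i, x ! j) \<in> parcs G)"
    unfolding invariant_def same_type_def using assms by blast+
qed

lemma invariant_card:
  assumes fin: "finite (pverts G)" and P: "invariant G m P" and i: "i < m"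
  shows "invariant G m (\<lambda>x. card {v \<in> pverts G. P (x[i := v])})"
proof -
  have "size (filter_mset id (image_mset (\<lambda>v. P (x[i := v])) (mset_set (pverts G)))) =
    card {v \<in> pverts G. P (x[i := v])}" for x
    by (simp add: filter_mset_image_mset filter_mset_mset_set fin)
  then show ?thesis using invariant_map[OF invariant_mset[OF fin P i], of "\<lambda>M. size (filter_mset id M)"] by simp
qed

text \<open>A function of four vertices that is invariant wherever its arguments are read off a 6-tuple.
  Two positions remain free for quantified vertices.\<close>
definition visible :: "'a pair_pre_digraph \<Rightarrow> ('a \<Rightarrow> 'a \<Rightarrow> 'a \<Rightarrow> 'a \<Rightarrow> 'b) \<Rightarrow> bool" where
  "visible G F \<longleftrightarrow> (\<forall>i<6. \<forall>j<6. \<forall>k<6. \<forall>l<6. invariant G 6 (\<lambda>x. F (x ! i) (x ! j) (x ! k) (x ! l)))"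

lemma visibleD: "visible G F \<Longrightarrow> i < 6 \<Longrightarrow> j < 6 \<Longrightarrow> k < 6 \<Longrightarrow> l < 6 \<Longrightarrow>
    invariant G 6 (\<lambda>x. F (x ! i) (x ! j) (x ! k) (x ! l))"
  unfolding visible_def by blast

lemma visibleI: "(\<And>i j k l. i < 6 \<Longrightarrow> j < 6 \<Longrightarrow> k < 6 \<Longrightarrow> l < 6 \<Longrightarrow>
    invariant G 6 (\<lambda>x. F (x ! i) (x ! j) (x ! k) (x ! l))) \<Longrightarrow> visible G F"
  unfolding visible_def by blast

lemma visible_map: "visible G F \<Longrightarrow> visible G (\<lambda>a b c d. h (F a b c d))"
  by (rule visibleI, rule invariant_map[where h = h], rule visibleD)

lemma visible_map2: "visible G F \<Longrightarrow> visible G F' \<Longrightarrow> visible G (\<lambda>a b c d. h (F a b c d) (F' a b c d))"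
  by (rule visibleI, rule invariant_map2[where h = h]; rule visibleD)

lemmas visible_not = visible_map[where h = Not]
  and visible_conj = visible_map2[where h = "(\<and>)"]

lemma visible_fun: "(\<And>n. visible G (\<lambda>a b c d. F a b c d n)) \<Longrightarrow> visible G F"
proof (rule visibleI, rule invariant_fun)
  fix i j k l :: nat and n
  assume F: "\<And>n. visible G (\<lambda>a b c d. F a b c d n)" and ijkl: "i < 6" "j < 6" "k < 6" "l < 6"
  show "invariant G 6 (\<lambda>x. F (x ! i) (x ! j) (x ! k) (x ! l) n)" using visibleD[OF F ijkl] .
qed

text \<open>The positions in \<open>visible\<close> are arbitrary and may coincide, so arguments can
  be permuted and repeated.\<close>

lemma visible_perm:
  assumes "visible G F"
  shows "visible G (\<lambda>a b c d. F b a c d)" "visible G (\<lambda>a b c d. F a c b d)" "visible G (\<lambda>a b c d. F a b d c)"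
    "visible G (\<lambda>a b c d. F a d c b)" "visible G (\<lambda>a b c d. F a b a d)" "visible G (\<lambda>a b c d. F a b a c)"
    "visible G (\<lambda>a b c d. F c d a b)"
  by (intro visibleI visibleD[OF assms]; assumption)+

lemma visible_type: "visible G (\<lambda>a b c d. a = b)" "visible G (\<lambda>a b c d. (a, b) \<in> parcs G)"
  by (intro visibleI invariant_type; assumption)+

text \<open>At most five positions are blocked: four arguments and one quantified vertex already
  placed. This is the count behind dimension six.\<close>

lemma fresh_index: "\<exists>p<6. p \<noteq> i \<and> p \<noteq> j \<and> p \<noteq> k \<and> p \<noteq> l \<and> p \<noteq> (q :: nat)"
proof -
  have "card {i, j, k, l, q} \<le> 5"
    using card_insert_le_m1[of 5 "{j, k, l, q}"] card_insert_le_m1[of 4 "{k, l, q}"]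
      card_insert_le_m1[of 3 "{l, q}"] card_insert_le_m1[of 2 "{q}"] by simp
  then have "\<not> {..<6} \<subseteq> {i, j, k, l, q}"
    using card_mono[of "{i, j, k, l, q}" "{..<6}"] by auto
  then show ?thesis by blast
qed

context
  fixes G :: "'a pair_pre_digraph"
  assumes fin: "finite (pverts G)"
begin

text \<open>The pattern is a path c, p, d between relations with parameters a, b, as needed for path
  counts on a layer; p takes a fifth position.\<close>

lemma visible_card:
  assumes R: "visible G R" and S: "visible G S"
  shows "visible G (\<lambda>a b c d. card {p \<in> pverts G. R a b c p \<and> S a b p d})"
proof (rule visibleI)
  fix i j k l :: nat assume b: "i < 6" "j < 6" "k < 6" "l < 6"
  obtain q where q: "q < 6" "q \<noteq> i" "q \<noteq> j" "q \<noteq> k" "q \<noteq> l" using fresh_index[of i j k l 0] by blast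
  have "invariant G 6 (\<lambda>x. card {v \<in> pverts G. R (x[q := v] ! i) (x[q := v] ! j) (x[q := v] ! k) (x[q := v] ! q) \<and>
      S (x[q := v] ! i) (x[q := v] ! j) (x[q := v] ! q) (x[q := v] ! l)})"
    by (rule invariant_card[OF fin _ q(1), where P = "\<lambda>x. R (x ! i) (x ! j) (x ! k) (x ! q) \<and>
      S (x ! i) (x ! j) (x ! q) (x ! l)"], rule invariant_map2[where h = "(\<and>)"]) (intro visibleD R S b q)+
  then show "invariant G 6 (\<lambda>x. card {p \<in> pverts G. R (x ! i) (x ! j) (x ! k) p \<and> S (x ! i) (x ! j) p (x ! l)})"
    by (rule invariant_cong) (use q in \<open>simp add: tuples_def\<close>)
qed

lemma visible_ex:
  assumes R: "visible G R" and S: "visible G S"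
  shows "visible G (\<lambda>a b c d. \<exists>p\<in>pverts G. R a b c p \<and> S a b p d)"
proof -
  have "card {p \<in> pverts G. R a b c p \<and> S a b p d} \<noteq> 0 \<longleftrightarrow> (\<exists>p\<in>pverts G. R a b c p \<and> S a b p d)" for a b c d
    using fin by auto
  then show ?thesis using visible_map[OF visible_card[OF R S], of "\<lambda>n. n \<noteq> 0"] by simp
qed

text \<open>Composes relations between arcs. The intermediate arc (p, q) needs two fresh positions,
  which uses up all six.\<close>

lemma visible_ex2:
  assumes R: "visible G R" and S: "visible G S"
  shows "visible G (\<lambda>a b c d. \<exists>p\<in>pverts G. \<exists>q\<in>pverts G. R a b p q \<and> S p q c d)"
proof (rule visibleI)
  fix i j k l :: nat assume b: "i < 6" "j < 6" "k < 6" "l < 6"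
  obtain p where p: "p < 6" "p \<noteq> i" "p \<noteq> j" "p \<noteq> k" "p \<noteq> l" using fresh_index[of i j k l 0] by blast
  obtain q where q: "q < 6" "q \<noteq> i" "q \<noteq> j" "q \<noteq> k" "q \<noteq> l" "q \<noteq> p" using fresh_index[of i j k l p] by blast
  let ?P = "\<lambda>x. R (x ! i) (x ! j) (x ! p) (x ! q) \<and> S (x ! p) (x ! q) (x ! k) (x ! l)"
  let ?Q = "\<lambda>x. card {v \<in> pverts G. ?P (x[q := v])} \<noteq> 0"
  have P: "invariant G 6 ?P"
    by (rule invariant_map2[where h = "(\<and>)"]) (intro visibleD R S b p q)+
  have Q: "invariant G 6 ?Q" by (rule invariant_map[OF invariant_card[OF fin P q(1)]])
  have "invariant G 6 (\<lambda>x. card {u \<in> pverts G. ?Q (x[p := u])} \<noteq> 0)"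
    by (rule invariant_map[OF invariant_card[OF fin Q p(1)]])
  then show "invariant G 6 (\<lambda>x. \<exists>u\<in>pverts G. \<exists>v\<in>pverts G. R (x ! i) (x ! j) u v \<and> S u v (x ! k) (x ! l))"
  proof (rule invariant_cong)
    fix x assume x: "x \<in> tuples 6 (pverts G)"
    have nz: "card {v \<in> pverts G. A v} \<noteq> 0 \<longleftrightarrow> (\<exists>v\<in>pverts G. A v)" for A using fin by auto
    show "(card {u \<in> pverts G. ?Q (x[p := u])} \<noteq> 0) =
      (\<exists>u\<in>pverts G. \<exists>v\<in>pverts G. R (x ! i) (x ! j) u v \<and> S u v (x ! k) (x ! l))"
      unfolding nz using x p q by (simp add: tuples_def)
  qed
qed

lemma visible_gdist:
  assumes E: "parcs G \<subseteq> pverts G \<times> pverts G"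
  shows "visible G (\<lambda>a b c d. gdist (parcs G) a b)"
proof -
  have "visible G (\<lambda>a b c d. (a, b) \<in> parcs G ^^ n)" for n
  proof (induction n)
    case (Suc n)
    have "(a, b) \<in> parcs G ^^ Suc n \<longleftrightarrow> (\<exists>p\<in>pverts G. (a, p) \<in> parcs G ^^ n \<and> (p, b) \<in> parcs G)" for a b
      using E by auto
    then show ?case
      \<comment> \<open>The permutations bring the steps from a to p and from p to b into the
        argument pattern of \<open>visible_ex\<close>, and the result back to the arguments a,
        b.\<close>
      using visible_perm(4)[OF visible_ex[OF visible_perm(4)[OF Suc] visible_perm(7)[OF visible_type(2)]]]
      by simp
  qed (use visible_type(1) in simp)
  then have "visible G (\<lambda>a b c d n. (a, b) \<in> parcs G ^^ n)" by (rule visible_fun)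
  then show ?thesis unfolding gdist_def by (rule visible_map)
qed

end

subsection \<open>Directions seen by the 6-dimensional algorithm\<close>

context
  fixes G :: "'a pair_pre_digraph"
  assumes G: "fin_graph G"
begin

lemma finite_verts: "finite (pverts G)" and arcs_sub: "parcs G \<subseteq> pverts G \<times> pverts G"
  using G unfolding fin_graph_def by auto

lemma visible_Theta: "visible G (\<lambda>a b c d. ((a, b), (c, d)) \<in> Theta (parcs G))"
proof -
  note d = visible_gdist[OF finite_verts arcs_sub]
  note arc = visible_type(2)[of G]
  have ac: "visible G (\<lambda>a b c d. gdist (parcs G) a c)" by (rule visible_perm(2)[OF d])
  have ad: "visible G (\<lambda>a b c d. gdist (parcs G) a d)" by (rule visible_perm(4)[OF d])
  have bc: "visible G (\<lambda>a b c d. gdist (parcs G) b c)" by (rule visible_perm(1)[OF ac])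
  have bd: "visible G (\<lambda>a b c d. gdist (parcs G) b d)" by (rule visible_perm(1)[OF ad])
  have sum1: "visible G (\<lambda>a b c d. gdist (parcs G) a c + gdist (parcs G) b d)"
    by (rule visible_map2[OF ac bd])
  have sum2: "visible G (\<lambda>a b c d. gdist (parcs G) a d + gdist (parcs G) b c)"
    by (rule visible_map2[OF ad bc])
  show ?thesis
    unfolding mem_Theta
    by (rule visible_conj[OF arc visible_conj[OF visible_perm(7)[OF arc] visible_map2[OF sum1 sum2]]])
qed

lemma visible_tau: "visible G (\<lambda>a b c d. ((a, b), (c, d)) \<in> tau (parcs G))"
proof -
  note arc = visible_type(2)[of G] and eq = visible_type(1)[of G]
  have ac: "visible G (\<lambda>a b c d. a = c)" by (rule visible_perm(2)[OF eq])
  have ad: "visible G (\<lambda>a b c d. a = d)" by (rule visible_perm(4)[OF eq])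
  have bd: "visible G (\<lambda>a b c d. b = d)" by (rule visible_perm(1)[OF ad])
  have arc_bd: "visible G (\<lambda>a b c d. (b, d) \<in> parcs G)" by (rule visible_perm(1)[OF visible_perm(4)[OF arc]])
  have ex: "visible G (\<lambda>a b c d. \<exists>p\<in>pverts G. (a \<noteq> p \<and> (b, p) \<in> parcs G) \<and> (d, p) \<in> parcs G)"
    by (rule visible_ex[OF finite_verts visible_conj[OF visible_not[OF ad] arc_bd]
          visible_perm(3)[OF visible_perm(7)[OF arc]]])
  have V: "p \<in> pverts G" if "(b, p) \<in> parcs G" for b p using arcs_sub that by blast
  have iff: "((a, b), (c, d)) \<in> tau (parcs G) \<longleftrightarrow> a = c \<and> (a, b) \<in> parcs G \<and> (c, d) \<in> parcs G \<and> b \<noteq> d \<and>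
      \<not> (\<exists>p\<in>pverts G. (a \<noteq> p \<and> (b, p) \<in> parcs G) \<and> (d, p) \<in> parcs G)" for a b c d
    unfolding mem_tau using V by metis
  show ?thesis
    unfolding iff
    by (rule visible_conj[OF ac visible_conj[OF arc visible_conj[OF visible_perm(7)[OF arc]
          visible_conj[OF visible_not[OF bd] visible_not[OF ex]]]]])
qed

text \<open>Each link of a chain quantifies over one intermediate arc, and its two positions are
  free again for the next link, so long chains need no more variables.\<close>

lemma visible_dir: "visible G (\<lambda>a b c d. ((a, b), (c, d)) \<in> (Theta (parcs G) \<union> tau (parcs G))\<^sup>*)"
proof -
  let ?S = "Theta (parcs G) \<union> tau (parcs G)"
  have sub: "?S \<subseteq> parcs G \<times> parcs G" by (auto simp: Theta_def tau_def)
  have S: "visible G (\<lambda>a b c d. ((a, b), (c, d)) \<in> ?S)"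
    unfolding Un_iff by (rule visible_map2[OF visible_Theta visible_tau])
  have "visible G (\<lambda>a b c d. ((a, b), (c, d)) \<in> ?S ^^ n)" for n
  proof (induction n)
    case 0
    have "visible G (\<lambda>a b c d. a = c \<and> b = d)"
      by (rule visible_conj[OF visible_perm(2)[OF visible_type(1)]
            visible_perm(1)[OF visible_perm(4)[OF visible_type(1)]]])
    then show ?case by simp
  next
    case (Suc n)
    have iff: "((a, b), (c, d)) \<in> ?S ^^ Suc n \<longleftrightarrow>
        (\<exists>p\<in>pverts G. \<exists>q\<in>pverts G. ((a, b), (p, q)) \<in> ?S ^^ n \<and> ((p, q), (c, d)) \<in> ?S)" for a b c d
    proof
      assume "((a, b), (c, d)) \<in> ?S ^^ Suc n"
      then obtain p q where pq: "((a, b), (p, q)) \<in> ?S ^^ n" "((p, q), (c, d)) \<in> ?S"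
        by (metis relpow_Suc_E prod.collapse)
      have "(p, q) \<in> parcs G" using subsetD[OF sub pq(2)] by simp
      then have "p \<in> pverts G" "q \<in> pverts G" using arcs_sub by auto
      then show "\<exists>p\<in>pverts G. \<exists>q\<in>pverts G. ((a, b), (p, q)) \<in> ?S ^^ n \<and> ((p, q), (c, d)) \<in> ?S"
        using pq by metis
    next
      assume "\<exists>p\<in>pverts G. \<exists>q\<in>pverts G. ((a, b), (p, q)) \<in> ?S ^^ n \<and> ((p, q), (c, d)) \<in> ?S"
      then show "((a, b), (c, d)) \<in> ?S ^^ Suc n" by (metis relpow_Suc_I)
    qed
    show ?case unfolding iff by (rule visible_ex2[OF finite_verts Suc S])
  qed
  then have "visible G (\<lambda>a b c d n. ((a, b), (c, d)) \<in> ?S ^^ n)" by (rule visible_fun)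
  from visible_map[OF this, of "\<lambda>f. \<exists>n. f n"] show ?thesis unfolding rtrancl_power .
qed

text \<open>In a product of primes this is the set of all arcs with the direction of (a, b), in
  every layer. The layer of a itself is what these arcs reach from a.\<close>

definition layer :: "'a \<Rightarrow> 'a \<Rightarrow> 'a rel" where
  "layer a b = {e \<in> parcs G. ((a, b), e) \<in> (Theta (parcs G) \<union> tau (parcs G))\<^sup>*}"

lemma visible_layer: "visible G (\<lambda>a b c d. (c, d) \<in> (layer a b)\<^sup>*)"
proof -
  have step: "visible G (\<lambda>a b c d. (c, d) \<in> layer a b)"
    unfolding layer_def mem_Collect_eq
    by (rule visible_conj[OF visible_perm(7)[OF visible_type(2)] visible_dir])
  have "visible G (\<lambda>a b c d. (c, d) \<in> layer a b ^^ n)" for n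
  proof (induction n)
    case 0
    then show ?case using visible_perm(7)[OF visible_type(1)[of G]] by simp
  next
    case (Suc n)
    have iff: "(c, d) \<in> layer a b ^^ Suc n \<longleftrightarrow> (\<exists>p\<in>pverts G. (c, p) \<in> layer a b ^^ n \<and> (p, d) \<in> layer a b)"
      for a b c d using arcs_sub unfolding layer_def by auto
    show ?case unfolding iff by (rule visible_ex[OF finite_verts Suc step])
  qed
  then have "visible G (\<lambda>a b c d n. (c, d) \<in> layer a b ^^ n)" by (rule visible_fun)
  from visible_map[OF this, of "\<lambda>f. \<exists>n. f n"] show ?thesis unfolding rtrancl_power .
qed

text \<open>Closedness makes the stable class of the padded tuple project onto a basis relation,
  necessarily s. So (u, v) begins some tuple with the same stable colour, and F is read off the
  first two positions.\<close>

lemma visible_same_basis: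
  assumes closed: "WL_closed 6 G" and s: "s \<in> basis (WL G)" "(x, y) \<in> s" "(u, v) \<in> s" and F: "visible G F"
  shows "F x y x y = F u v u v"
proof -
  interpret C: coh "WL G" by (unfold_locales) (rule coherent_WL[OF G])
  let ?t = "[x, y, y, y, y, y]" and ?T = "tuples 6 (pverts G)"
  have xy: "x \<in> pverts G" "y \<in> pverts G" using C.basis_sub[OF s(1)] s(2) points_WL[OF G] by auto
  then have t: "?t \<in> ?T" unfolding tuples_def by simp
  let ?L = "\<Inter>r. wl_class G 6 r ?t"
  let ?p = "(\<lambda>x. (x ! 0, x ! 1)) ` ?L"
  have "?p \<in> basis (WL G)"
    using closed t unfolding WL_closed_def pr2_def WL_dim_def by blast
  moreover have "?t \<in> ?L" using wl_class_iff[OF t t] by blast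
  then have "(x, y) \<in> ?p" by (force intro: image_eqI[of _ _ ?t])
  ultimately have "?p = s" using C.basis_eq[OF _ s(1) _ s(2)] by blast
  then obtain z where z: "z \<in> ?L" "u = z ! 0" "v = z ! 1" using s(3) by auto
  have "z \<in> wl_class G 6 0 ?t" using z(1) by blast
  then have zT: "z \<in> ?T" by simp
  have "stable_eq G 6 ?t z" unfolding stable_eq_def using wl_class_iff[OF t zT] z(1) by blast
  moreover have "invariant G 6 (\<lambda>x. F (x ! 0) (x ! 1) (x ! 0) (x ! 1))" by (rule visibleD[OF F]) simp_all
  ultimately have "F (?t ! 0) (?t ! 1) (?t ! 0) (?t ! 1) = F (z ! 0) (z ! 1) (z ! 0) (z ! 1)"
    using t zT unfolding invariant_def by blast
  then show ?thesis using z(2,3) by simp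
qed

end

section \<open>Arcs of one colour have WL-equivalent factors\<close>

locale prime_product = graph_product I X
  for I :: "'i set" and X :: "'i \<Rightarrow> 'a pair_pre_digraph" +
  assumes prime: "\<And>i. i \<in> I \<Longrightarrow> prime_graph (X i)" and closed: "WL_closed 6 (cart_prod I X)"
begin

abbreviation "W \<equiv> cart_prod I X"

text \<open>By \<open>S_rtrancl_dir\<close> the arcs involved are those of direction i; they change
  coordinate i only, and connectedness of the factor lets them reach every value there.\<close>

lemma layer_iff:
  assumes i: "i \<in> I" and xy: "(x, y) \<in> dir i"
  shows "(x, z) \<in> (layer W x y)\<^sup>* \<longleftrightarrow> (\<exists>c\<in>pverts (X i). z = x(i := c))"
proof -
  have L: "layer W x y = dir i"
  proof (rule set_eqI)
    fix e
    show "e \<in> layer W x y \<longleftrightarrow> e \<in> dir i"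
      using E_dir[of e] i S_rtrancl_dir[OF prime i xy, of e] unfolding layer_def[OF fin_prod] by blast
  qed
  have x: "x \<in> P" using xy unfolding mem_dir by blast
  have xi: "x i \<in> pverts (X i)" using x i by auto
  show ?thesis
    unfolding L
  proof
    assume "(x, z) \<in> (dir i)\<^sup>*"
    then show "\<exists>c\<in>pverts (X i). z = x(i := c)"
    proof (induction rule: rtrancl_induct)
      case base
      then show ?case using xi by (intro bexI[of _ "x i"]) simp_all
    next
      case (step z w)
      then obtain c where "z = x(i := c)" by blast
      moreover have "w = z(i := w i)" "(z i, w i) \<in> parcs (X i)" using dir_form[OF step(2) i] by auto
      ultimately show ?case
        using arc_verts[OF conn[OF i]] by (intro bexI[of _ "w i"]) (metis fun_upd_upd, blast)
    qed
  next
    assume "\<exists>c\<in>pverts (X i). z = x(i := c)"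
    then obtain c where c: "c \<in> pverts (X i)" "z = x(i := c)" by blast
    have "(x i, c) \<in> (parcs (X i))\<^sup>*" by (rule conn_reach[OF conn[OF i] xi c(1)])
    then have "(x(i := x i), x(i := c)) \<in> (dir i)\<^sup>*"
    proof (induction rule: rtrancl_induct)
      case (step a b)
      show ?case by (rule rtrancl_into_rtrancl[OF step(3) dir_upd[OF x i step(2)]])
    qed simp
    then show "(x, z) \<in> (dir i)\<^sup>*" unfolding c(2) by simp
  qed
qed

lemma card_layer:
  assumes i: "i \<in> I" and xy: "(x, y) \<in> dir i"
  shows "card {p \<in> P. (x, p) \<in> (layer W x y)\<^sup>* \<and> Q p} = card {c \<in> pverts (X i). Q (x(i := c))}"
proof -
  have x: "x \<in> P" using xy unfolding mem_dir by blast
  have "{p \<in> P. (x, p) \<in> (layer W x y)\<^sup>* \<and> Q p} = (\<lambda>c. x(i := c)) ` {c \<in> pverts (X i). Q (x(i := c))}"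
    unfolding layer_iff[OF i xy] using PiE_upd[OF x i] by blast
  moreover have "inj_on (\<lambda>c. x(i := c)) {c \<in> pverts (X i). Q (x(i := c))}"
    by (intro inj_onI) (metis fun_upd_same)
  ultimately show ?thesis by (simp add: card_image)
qed

text \<open>R takes the arc (x, y) as parameters and is judged only on the i-layer of x, in
  coordinate i. Keeping R apart from x, y and i lets the same R be evaluated at an arc of another
  direction.\<close>

definition defines_on_layer :: "(('i \<Rightarrow> 'a) \<Rightarrow> ('i \<Rightarrow> 'a) \<Rightarrow> ('i \<Rightarrow> 'a) \<Rightarrow> ('i \<Rightarrow> 'a) \<Rightarrow> bool) \<Rightarrow>
    ('i \<Rightarrow> 'a) \<Rightarrow> ('i \<Rightarrow> 'a) \<Rightarrow> 'i \<Rightarrow> 'a rel \<Rightarrow> bool" where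
  "defines_on_layer R x y i r \<longleftrightarrow> r \<subseteq> pverts (X i) \<times> pverts (X i) \<and>
    (\<forall>c\<in>pverts (X i). \<forall>d\<in>pverts (X i). R x y (x(i := c)) (x(i := d)) \<longleftrightarrow> (c, d) \<in> r)"

lemma defines_arcs:
  assumes i: "i \<in> I" and xy: "(x, y) \<in> dir i"
  shows "defines_on_layer (\<lambda>a b c d. (c, d) \<in> E) x y i (parcs (X i))"
  unfolding defines_on_layer_def
proof (intro conjI ballI)
  show "parcs (X i) \<subseteq> pverts (X i) \<times> pverts (X i)" using fin[OF i] unfolding fin_graph_def by blast
  have x: "x \<in> P" using xy unfolding mem_dir by blast
  fix c d
  show "(x(i := c), x(i := d)) \<in> E \<longleftrightarrow> (c, d) \<in> parcs (X i)"
  proof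
    assume "(x(i := c), x(i := d)) \<in> E"
    then obtain k where k: "k \<in> I" "(x(i := c), x(i := d)) \<in> dir k" using E_dir by blast
    then have ar: "((x(i := c)) k, (x(i := d)) k) \<in> parcs (X k)" unfolding mem_dir by blast
    show "(c, d) \<in> parcs (X i)"
    proof (cases "k = i")
      case False
      then show ?thesis using ar arc_irrefl[OF conn[OF k(1)]] by simp
    qed (use ar in simp)
  next
    assume "(c, d) \<in> parcs (X i)"
    then show "(x(i := c), x(i := d)) \<in> E" using dir_upd[OF x i] i E_dir by blast
  qed
qed

lemma defines_diag: "defines_on_layer (\<lambda>a b c d. c = d) x y i (Id_on (pverts (X i)))"
proof -
  have "x(i := c) = x(i := d) \<longleftrightarrow> c = d" for c d by (metis fun_upd_same)
  then show ?thesis unfolding defines_on_layer_def by auto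
qed

lemma defines_compl:
  "defines_on_layer R x y i r \<Longrightarrow>
    defines_on_layer (\<lambda>a b c d. \<not> R a b c d) x y i (pverts (X i) \<times> pverts (X i) - r)"
  unfolding defines_on_layer_def by auto

lemma defines_un:
  "defines_on_layer R x y i r \<Longrightarrow> defines_on_layer Q x y i s \<Longrightarrow>
    defines_on_layer (\<lambda>a b c d. R a b c d \<or> Q a b c d) x y i (r \<union> s)"
  unfolding defines_on_layer_def by auto

lemma defines_conv:
  "defines_on_layer R x y i r \<Longrightarrow> defines_on_layer (\<lambda>a b c d. R a b d c) x y i (r\<inverse>)"
  unfolding defines_on_layer_def by auto

text \<open>R is unconstrained off the layer, so the counted vertex p is confined to the layer of a;
  confining it once, beside R, serves Q as well.\<close>

lemma defines_paths:
  assumes i: "i \<in> I" and xy: "(x, y) \<in> dir i"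
    and R: "defines_on_layer R x y i r" and Q: "defines_on_layer Q x y i s"
  shows "defines_on_layer (\<lambda>a b c d. card {p \<in> P. ((a, p) \<in> (layer W a b)\<^sup>* \<and> R a b c p) \<and> Q a b p d} = n)
    x y i (paths (pverts (X i)) r s n)"
  unfolding defines_on_layer_def
proof (intro conjI ballI)
  show "paths (pverts (X i)) r s n \<subseteq> pverts (X i) \<times> pverts (X i)" unfolding paths_def by blast
  fix c d assume cd: "c \<in> pverts (X i)" "d \<in> pverts (X i)"
  have "card {p \<in> P. ((x, p) \<in> (layer W x y)\<^sup>* \<and> R x y (x(i := c)) p) \<and> Q x y p (x(i := d))} =
    card {e \<in> pverts (X i). R x y (x(i := c)) (x(i := e)) \<and> Q x y (x(i := e)) (x(i := d))}"
    using card_layer[OF i xy, of "\<lambda>p. R x y (x(i := c)) p \<and> Q x y p (x(i := d))"] by (simp only: conj_assoc)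
  also have "{e \<in> pverts (X i). R x y (x(i := c)) (x(i := e)) \<and> Q x y (x(i := e)) (x(i := d))} =
    {e \<in> pverts (X i). (c, e) \<in> r \<and> (e, d) \<in> s}"
    using R Q cd unfolding defines_on_layer_def by blast
  finally have eq: "card {p \<in> P. ((x, p) \<in> (layer W x y)\<^sup>* \<and> R x y (x(i := c)) p) \<and> Q x y p (x(i := d))} =
    card {e \<in> pverts (X i). (c, e) \<in> r \<and> (e, d) \<in> s}" .
  show "(card {p \<in> P. ((x, p) \<in> (layer W x y)\<^sup>* \<and> R x y (x(i := c)) p) \<and> Q x y p (x(i := d))} = n) \<longleftrightarrow>
    (c, d) \<in> paths (pverts (X i)) r s n"
    unfolding eq paths_def using cd by simp
qed

text \<open>Makes emptiness a property of the arc (x, y) that can be compared between arcs of one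
  basis relation. The trailing \<open>True\<close> fills the second conjunct in the pattern of
  \<open>visible_ex2\<close>.\<close>

lemma defines_empty:
  assumes i: "i \<in> I" and xy: "(x, y) \<in> dir i" and R: "defines_on_layer R x y i r"
  shows "r = {} \<longleftrightarrow> \<not> (\<exists>p\<in>P. \<exists>q\<in>P. ((x, p) \<in> (layer W x y)\<^sup>* \<and> (x, q) \<in> (layer W x y)\<^sup>* \<and> R x y p q) \<and> True)"
proof -
  have x: "x \<in> P" using xy unfolding mem_dir by blast
  have Rr: "R x y (x(i := c)) (x(i := d)) \<longleftrightarrow> (c, d) \<in> r" if "c \<in> pverts (X i)" "d \<in> pverts (X i)" for c d
    using R that unfolding defines_on_layer_def by blast
  show ?thesis
  proof
    assume r: "r = {}"
    show "\<not> (\<exists>p\<in>P. \<exists>q\<in>P. ((x, p) \<in> (layer W x y)\<^sup>* \<and> (x, q) \<in> (layer W x y)\<^sup>* \<and> R x y p q) \<and> True)"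
      unfolding layer_iff[OF i xy] using Rr r by blast
  next
    assume n: "\<not> (\<exists>p\<in>P. \<exists>q\<in>P. ((x, p) \<in> (layer W x y)\<^sup>* \<and> (x, q) \<in> (layer W x y)\<^sup>* \<and> R x y p q) \<and> True)"
    show "r = {}"
    proof (rule equals0I)
      fix e assume e: "e \<in> r"
      obtain c d where cd: "e = (c, d)" by (cases e)
      have V: "c \<in> pverts (X i)" "d \<in> pverts (X i)" using R e unfolding cd defines_on_layer_def by auto
      have "R x y (x(i := c)) (x(i := d))" using Rr[OF V] e unfolding cd by simp
      moreover have "x(i := c) \<in> P" "x(i := d) \<in> P" using PiE_upd[OF x i] V by blast+
      moreover have "(x, x(i := c)) \<in> (layer W x y)\<^sup>*" "(x, x(i := d)) \<in> (layer W x y)\<^sup>*"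
        unfolding layer_iff[OF i xy] using V by blast+
      ultimately show False using n by blast
    qed
  qed
qed

lemma finite_P: "finite (pverts W)"
  using fin_prod unfolding fin_graph_def by blast

lemma visible_on_layer:
  "visible W R \<Longrightarrow> visible W (\<lambda>a b c d. (a, d) \<in> (layer W a b)\<^sup>* \<and> R a b c d)"
proof (rule visible_conj)
  have "visible W (\<lambda>a b c d. (c, d) \<in> (layer W a b)\<^sup>*)" by (rule visible_layer[OF fin_prod])
  then show "visible W (\<lambda>a b c d. (a, d) \<in> (layer W a b)\<^sup>*)"
    by (rule visible_perm(5))
qed

text \<open>The term that generates the pair (r, r') is translated once into a formula R, which
  therefore defines r on one layer and r' on the other.\<close>

lemma rel_pairs_visible:
  assumes i: "i \<in> I" "(x, y) \<in> dir i" and j: "j \<in> I" "(u, v) \<in> dir j"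
    and r: "(r, r') \<in> WL_rel_pairs (X i) (X j)"
  shows "\<exists>R. visible W R \<and> defines_on_layer R x y i r \<and> defines_on_layer R u v j r'"
  using r
proof (induction rule: WL_rel_pairs.induct)
  case arcs
  have "visible W (\<lambda>a b c d. (c, d) \<in> E)" by (rule visible_perm(7)[OF visible_type(2)])
  then show ?case using defines_arcs[OF i] defines_arcs[OF j] by blast
next
  case diag
  have "visible W (\<lambda>a b c d. c = d)" by (rule visible_perm(7)[OF visible_type(1)])
  then show ?case using defines_diag by blast
next
  case (compl r r')
  then obtain R where R: "visible W R" "defines_on_layer R x y i r" "defines_on_layer R u v j r'" by blast
  show ?case using visible_not[OF R(1)] defines_compl[OF R(2)] defines_compl[OF R(3)] by blast
next
  case (un r r' s s')
  then obtain R Q where R: "visible W R" "defines_on_layer R x y i r" "defines_on_layer R u v j r'"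
    and Q: "visible W Q" "defines_on_layer Q x y i s" "defines_on_layer Q u v j s'" by blast
  have "visible W (\<lambda>a b c d. R a b c d \<or> Q a b c d)" by (rule visible_map2[OF R(1) Q(1)])
  then show ?case using defines_un[OF R(2) Q(2)] defines_un[OF R(3) Q(3)] by blast
next
  case (conv r r')
  then obtain R where R: "visible W R" "defines_on_layer R x y i r" "defines_on_layer R u v j r'" by blast
  show ?case using visible_perm(3)[OF R(1)] defines_conv[OF R(2)] defines_conv[OF R(3)] by blast
next
  case (paths r r' s s' n)
  then obtain R Q where R: "visible W R" "defines_on_layer R x y i r" "defines_on_layer R u v j r'"
    and Q: "visible W Q" "defines_on_layer Q x y i s" "defines_on_layer Q u v j s'" by blast
  have "visible W (\<lambda>a b c d. card {p \<in> P. ((a, p) \<in> (layer W a b)\<^sup>* \<and> R a b c p) \<and> Q a b p d} = n)"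
    using visible_map[OF visible_card[OF finite_P visible_on_layer[OF R(1)] Q(1)], of "\<lambda>m. m = n"]
    unfolding pverts_cart_prod .
  then show ?case
    using defines_paths[OF i R(2) Q(2)] defines_paths[OF j R(3) Q(3)] by blast
qed

text \<open>Emptiness on a layer is visible from its defining arc, and visible properties agree on
  arcs of one basis relation; this is the hypothesis of \<open>WL_equivalentI\<close>.\<close>

lemma same_basis_equivalent:
  assumes s: "s \<in> basis (WL W)" and i: "i \<in> I" "(x, y) \<in> dir i" "(x, y) \<in> s"
    and j: "j \<in> I" "(u, v) \<in> dir j" "(u, v) \<in> s"
  shows "WL_equivalent (X i) (X j)"
proof (rule WL_equivalentI[OF fin[OF i(1)] fin[OF j(1)]])
  fix r r' assume "(r, r') \<in> WL_rel_pairs (X i) (X j)"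
  then obtain R where R: "visible W R" "defines_on_layer R x y i r" "defines_on_layer R u v j r'"
    using rel_pairs_visible[OF i(1,2) j(1,2)] by blast
  let ?F = "\<lambda>a b c d. \<exists>p\<in>P. \<exists>q\<in>P. ((a, p) \<in> (layer W a b)\<^sup>* \<and> (a, q) \<in> (layer W a b)\<^sup>* \<and> R a b p q) \<and> True"
  have L: "visible W (\<lambda>a b c d. (c, d) \<in> (layer W a b)\<^sup>*)" by (rule visible_layer[OF fin_prod])
  have "visible W (\<lambda>a b c d. (a, c) \<in> (layer W a b)\<^sup>*)"
    by (rule visible_perm(6)[OF L])
  then have "visible W (\<lambda>a b c d. (a, c) \<in> (layer W a b)\<^sup>* \<and> (a, d) \<in> (layer W a b)\<^sup>* \<and> R a b c d)"
    by (rule visible_conj[OF _ visible_on_layer[OF R(1)]])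
  moreover have "visible W (\<lambda>a b c d. True)" using visible_map[OF L, of "\<lambda>_. True"] .
  ultimately have F: "visible W ?F"
    using visible_ex2[OF finite_P] unfolding pverts_cart_prod by blast
  have "?F x y x y = ?F u v u v" by (rule visible_same_basis[OF fin_prod closed s i(3) j(3) F])
  then show "r = {} \<longleftrightarrow> r' = {}"
    unfolding defines_empty[OF i(1,2) R(2)] defines_empty[OF j(1,2) R(3)] by simp
qed

text \<open>A basis relation meeting these arcs consists of arcs, and all their directions have
  WL-equivalent factors; since J is closed under that equivalence, the basis relation stays
  inside.\<close>

lemma class_arcs_rel:
  assumes J: "J \<subseteq> I" "\<And>i j. i \<in> J \<Longrightarrow> j \<in> I \<Longrightarrow> WL_equivalent (X i) (X j) \<Longrightarrow> j \<in> J"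
  shows "(\<Union>i\<in>J. dir i) \<in> WL_rels W"
proof -
  let ?D = "\<Union>i\<in>J. dir i"
  interpret C: coh "WL W" by (unfold_locales) (rule coherent_WL[OF fin_prod])
  have E: "E \<in> rels (WL W)" unfolding rels_WL[OF fin_prod] by (rule WL_rels.arcs)
  have "?D \<in> rels (WL W)"
    unfolding C.rels_iff
  proof (intro conjI ballI)
    have "?D \<subseteq> E" using J(1) E_dir by blast
    then show "?D \<subseteq> points (WL W) \<times> points (WL W)" using C.rels_sub[OF E] by blast
    fix s assume s: "s \<in> basis (WL W)"
    show "s \<inter> ?D = {} \<or> s \<subseteq> ?D"
    proof (cases "s \<inter> ?D = {}")
      case False
      then obtain x y i where i: "i \<in> J" "(x, y) \<in> dir i" "(x, y) \<in> s" by auto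
      have "i \<in> I" using i(1) J(1) by blast
      then have "(x, y) \<in> E" using i(2) E_dir by blast
      then have sE: "s \<subseteq> E" using C.rels_cases[OF E s] i(3) by blast
      have "s \<subseteq> ?D"
      proof (rule subrelI)
        fix u v assume uv: "(u, v) \<in> s"
        then obtain j where j: "j \<in> I" "(u, v) \<in> dir j" using sE E_dir by blast
        have "WL_equivalent (X i) (X j)" by (rule same_basis_equivalent[OF s \<open>i \<in> I\<close> i(2,3) j uv])
        then show "(u, v) \<in> ?D" using J(2)[OF i(1) j(1)] j(2) by blast
      qed
      then show ?thesis by simp
    qed simp
  qed
  then show ?thesis unfolding rels_WL[OF fin_prod] .
qed

end

subsection \<open>Regrouping coordinates and conclusion\<close>

locale index_partition =
  fixes I :: "'i set" and K :: "'k set" and J :: "'k \<Rightarrow> 'i set"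
  assumes cover: "\<Union>(J ` K) = I" and disj: "k \<in> K \<Longrightarrow> l \<in> K \<Longrightarrow> i \<in> J k \<Longrightarrow> i \<in> J l \<Longrightarrow> k = l"
begin

lemma J_sub: "k \<in> K \<Longrightarrow> J k \<subseteq> I"
  using cover by blast

lemma J_ex: "i \<in> I \<Longrightarrow> \<exists>k\<in>K. i \<in> J k"
  using cover by blast

lemma regroup_at: "k \<in> K \<Longrightarrow> regroup K J x k = restrict x (J k)"
  unfolding regroup_def by simp

lemma restrict_eq_iff: "restrict x A = restrict y A \<longleftrightarrow> (\<forall>i\<in>A. x i = y i)"
  by (auto simp: restrict_def fun_eq_iff)

lemma regroup_inj: "inj_on (regroup K J) (Pi\<^sub>E I V)"
proof (rule inj_onI)
  fix x y assume xy: "x \<in> Pi\<^sub>E I V" "y \<in> Pi\<^sub>E I V" "regroup K J x = regroup K J y"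
  show "x = y"
  proof (rule PiE_ext[OF xy(1,2)])
    fix i assume "i \<in> I"
    then obtain k where k: "k \<in> K" "i \<in> J k" using J_ex by blast
    have "restrict x (J k) = restrict y (J k)" using fun_cong[OF xy(3), of k] unfolding regroup_at[OF k(1)] .
    then show "x i = y i" unfolding restrict_eq_iff using k(2) by blast
  qed
qed

lemma regroup_image: "regroup K J ` Pi\<^sub>E I V = (\<Pi>\<^sub>E k\<in>K. Pi\<^sub>E (J k) V)"
proof (intro equalityI subsetI)
  fix w assume "w \<in> regroup K J ` Pi\<^sub>E I V"
  then obtain x where x: "x \<in> Pi\<^sub>E I V" "w = regroup K J x" by blast
  have "restrict x (J k) \<in> Pi\<^sub>E (J k) V" if "k \<in> K" for k using x(1) J_sub[OF that] by auto
  then show "w \<in> (\<Pi>\<^sub>E k\<in>K. Pi\<^sub>E (J k) V)" unfolding x(2) regroup_def by auto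
next
  fix w assume w: "w \<in> (\<Pi>\<^sub>E k\<in>K. Pi\<^sub>E (J k) V)"
  \<comment> \<open>The blocks are disjoint, so each index determines its block; a family of block
    vertices is glued along this choice.\<close>
  define \<kappa> where "\<kappa> i = (THE k. k \<in> K \<and> i \<in> J k)" for i
  have \<kappa>: "\<kappa> i = k" if "k \<in> K" "i \<in> J k" for i k
    unfolding \<kappa>_def using that disj by (intro the_equality) auto
  let ?x = "\<lambda>i\<in>I. w (\<kappa> i) i"
  have wk: "w k \<in> Pi\<^sub>E (J k) V" if "k \<in> K" for k using w that by auto
  have "?x \<in> Pi\<^sub>E I V"
  proof (rule PiE_I)
    fix i assume i: "i \<in> I"
    then obtain k where k: "k \<in> K" "i \<in> J k" using J_ex by blast
    show "?x i \<in> V i" using PiE_mem[OF wk[OF k(1)] k(2)] \<kappa>[OF k] i by simp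
  qed simp
  moreover have "w = regroup K J ?x"
  proof (rule PiE_ext[OF w])
    show "regroup K J ?x \<in> (\<Pi>\<^sub>E k\<in>K. Pi\<^sub>E (J k) V)"
      unfolding regroup_def using \<open>?x \<in> Pi\<^sub>E I V\<close> J_sub by fastforce
    fix k assume k: "k \<in> K"
    have "w k i = restrict ?x (J k) i" for i
    proof (cases "i \<in> J k")
      case True
      then show ?thesis using \<kappa>[OF k True] J_sub[OF k] by auto
    next
      case False
      then show ?thesis using PiE_arb[OF wk[OF k] False] by simp
    qed
    then show "w k = regroup K J ?x k" unfolding regroup_at[OF k] by (rule ext)
  qed
  ultimately show "w \<in> regroup K J ` Pi\<^sub>E I V" by blast
qed

text \<open>Agreement on the other blocks and one moving coordinate inside block k amount to a
  single moving coordinate overall, lying in \<open>J k\<close>.\<close>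

lemma regroup_arc:
  assumes x: "x \<in> (\<Pi>\<^sub>E i\<in>I. pverts (X i))" and y: "y \<in> (\<Pi>\<^sub>E i\<in>I. pverts (X i))" and k: "k \<in> K"
  shows "(regroup K J x, regroup K J y) \<in> arcs_in_dir K (\<lambda>k. cart_prod (J k) X) k \<longleftrightarrow>
    (x, y) \<in> (\<Union>i\<in>J k. arcs_in_dir I X i)"
proof -
  have mem: "regroup K J z \<in> (\<Pi>\<^sub>E k\<in>K. pverts (cart_prod (J k) X))"
    if "z \<in> (\<Pi>\<^sub>E i\<in>I. pverts (X i))" for z
    using regroup_image[of "\<lambda>i. pverts (X i)"] that unfolding pverts_cart_prod by blast
  have memk: "restrict z (J k) \<in> (\<Pi>\<^sub>E i\<in>J k. pverts (X i))" if "z \<in> (\<Pi>\<^sub>E i\<in>I. pverts (X i))" for z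
    using that J_sub[OF k] by auto
  have "(regroup K J x, regroup K J y) \<in> arcs_in_dir K (\<lambda>k. cart_prod (J k) X) k \<longleftrightarrow>
    (restrict x (J k), restrict y (J k)) \<in> parcs (cart_prod (J k) X) \<and>
    (\<forall>l\<in>K - {k}. \<forall>i\<in>J l. x i = y i)"
    unfolding arcs_in_dir_def using mem[OF x] mem[OF y] k by (auto simp: regroup_at restrict_eq_iff)
  also have "(restrict x (J k), restrict y (J k)) \<in> parcs (cart_prod (J k) X) \<longleftrightarrow>
    (\<exists>i\<in>J k. (x i, y i) \<in> parcs (X i) \<and> (\<forall>j\<in>J k - {i}. x j = y j))"
    unfolding parcs_cart_prod arcs_in_dir_def using memk[OF x] memk[OF y] by auto
  also have "(\<exists>i\<in>J k. (x i, y i) \<in> parcs (X i) \<and> (\<forall>j\<in>J k - {i}. x j = y j)) \<and>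
      (\<forall>l\<in>K - {k}. \<forall>i\<in>J l. x i = y i) \<longleftrightarrow>
    (\<exists>i\<in>J k. (x i, y i) \<in> parcs (X i) \<and> (\<forall>j\<in>I - {i}. x j = y j))" (is "?L \<longleftrightarrow> ?R")
  proof
    assume ?L
    then obtain i where i: "i \<in> J k" "(x i, y i) \<in> parcs (X i)" "\<forall>j\<in>J k - {i}. x j = y j"
      "\<forall>l\<in>K - {k}. \<forall>i\<in>J l. x i = y i" by blast
    have "x j = y j" if "j \<in> I - {i}" for j
    proof -
      have "j \<in> I" using that by blast
      then obtain l where l: "l \<in> K" "j \<in> J l" using J_ex by blast
      then show ?thesis using i(3,4) that by (cases "l = k") auto
    qed
    then show ?R using i(1,2) by blast
  next
    assume ?R
    then obtain i where i: "i \<in> J k" "(x i, y i) \<in> parcs (X i)" "\<forall>j\<in>I - {i}. x j = y j" by blast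
    have "x j = y j" if l: "l \<in> K - {k}" "j \<in> J l" for j l
    proof -
      have "j \<noteq> i" using disj[of k l i] l i(1) k by blast
      then show ?thesis using i(3) J_sub[of l] l by blast
    qed
    moreover have "\<forall>j\<in>J k - {i}. x j = y j" using i(3) J_sub[OF k] by blast
    ultimately show ?L using i(1,2) by blast
  qed
  also have "\<dots> \<longleftrightarrow> (x, y) \<in> (\<Union>i\<in>J k. arcs_in_dir I X i)"
    unfolding arcs_in_dir_def using x y by auto
  finally show ?thesis .
qed

lemma regroup_arcs_in_dir:
  assumes k: "k \<in> K"
  shows "arcs_in_dir K (\<lambda>k. cart_prod (J k) X) k =
    map_prod (regroup K J) (regroup K J) ` (\<Union>i\<in>J k. arcs_in_dir I X i)"
proof (intro equalityI subrelI)
  let ?P = "\<Pi>\<^sub>E i\<in>I. pverts (X i)"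
  fix u v assume uv: "(u, v) \<in> arcs_in_dir K (\<lambda>k. cart_prod (J k) X) k"
  then have "u \<in> regroup K J ` ?P" "v \<in> regroup K J ` ?P"
    unfolding regroup_image unfolding arcs_in_dir_def pverts_cart_prod by auto
  then obtain x y where xy: "x \<in> ?P" "y \<in> ?P" "u = regroup K J x" "v = regroup K J y" by blast
  then have "(x, y) \<in> (\<Union>i\<in>J k. arcs_in_dir I X i)" using regroup_arc[OF xy(1,2) k] uv by simp
  then show "(u, v) \<in> map_prod (regroup K J) (regroup K J) ` (\<Union>i\<in>J k. arcs_in_dir I X i)"
    unfolding xy(3,4) by (rule map_prod_imageI)
next
  fix u v assume "(u, v) \<in> map_prod (regroup K J) (regroup K J) ` (\<Union>i\<in>J k. arcs_in_dir I X i)"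
  then obtain x y where xy: "(x, y) \<in> (\<Union>i\<in>J k. arcs_in_dir I X i)" "u = regroup K J x" "v = regroup K J y"
    by auto
  then have "x \<in> (\<Pi>\<^sub>E i\<in>I. pverts (X i))" "y \<in> (\<Pi>\<^sub>E i\<in>I. pverts (X i))" unfolding arcs_in_dir_def by auto
  then show "(u, v) \<in> arcs_in_dir K (\<lambda>k. cart_prod (J k) X) k"
    unfolding xy(2,3) using regroup_arc[OF _ _ k] xy(1) by blast
qed

lemma regroup_image_graph:
  "image_graph (regroup K J) (cart_prod I X) = cart_prod K (\<lambda>k. cart_prod (J k) X)"
proof -
  have "(\<Union>i\<in>I. arcs_in_dir I X i) = (\<Union>k\<in>K. \<Union>i\<in>J k. arcs_in_dir I X i)" using cover by blast
  then have "map_prod (regroup K J) (regroup K J) ` parcs (cart_prod I X) =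
    (\<Union>k\<in>K. arcs_in_dir K (\<lambda>k. cart_prod (J k) X) k)"
    unfolding parcs_cart_prod by (simp only: image_UN regroup_arcs_in_dir cong: SUP_cong)
  then have "parcs (image_graph (regroup K J) (cart_prod I X)) = parcs (cart_prod K (\<lambda>k. cart_prod (J k) X))"
    unfolding image_graph_def parcs_cart_prod[of K] by simp
  moreover have "pverts (image_graph (regroup K J) (cart_prod I X)) = pverts (cart_prod K (\<lambda>k. cart_prod (J k) X))"
    unfolding image_graph_def by (simp add: pverts_cart_prod regroup_image)
  ultimately show ?thesis by simp
qed

end

lemma index_partition_quotient:
  assumes R: "equiv I R" and J: "bij_betw J K (I // R)"
  shows "index_partition I K J"
proof
  have im: "J ` K = I // R" and inj: "inj_on J K" using J unfolding bij_betw_def by auto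
  show "\<Union>(J ` K) = I" unfolding im by (rule Union_quotient[OF R])
  fix k l i assume k: "k \<in> K" "l \<in> K" "i \<in> J k" "i \<in> J l"
  then have "J k \<in> I // R" "J l \<in> I // R" using im by auto
  then have "J k = J l" using quotient_disj[OF R] k(3,4) by blast
  then show "k = l" using inj_onD[OF inj] k(1,2) by blast
qed

theorem theorem1p2:
  fixes X :: "nat \<Rightarrow> 'a pair_pre_digraph" and n a :: nat and J :: "nat \<Rightarrow> nat set"
  assumes "n \<ge> 1"
    and "\<And>i. i \<in> {1..n} \<Longrightarrow> pair_graph (X i)"
    and "\<And>i. i \<in> {1..n} \<Longrightarrow> Digraph_Component.connected (with_proj (X i))"
    and "\<And>i. i \<in> {1..n} \<Longrightarrow> prime_graph (X i)"
    and "WL_closed 6 (cart_prod {1..n} X)"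
    and "bij_betw J {1..a}
           ({1..n} // {(i, j) \<in> {1..n} \<times> {1..n}. WL_equivalent (X i) (X j)})"
  shows "map_config (regroup {1..a} J) (WL (cart_prod {1..n} X)) =
           tensor {1..a} (\<lambda>k. WL (cart_prod (J k) X)) \<and>
         (\<forall>k\<in>{1..a}.
           (\<exists>\<phi>. alg_iso_system (J k) (\<lambda>j. WL (X j)) \<phi> \<and>
                (\<forall>i\<in>J k. \<forall>j\<in>J k. WL_iso (X i) (X j) (\<phi> i j))) \<and>
           (\<forall>\<phi>. alg_iso_system (J k) (\<lambda>j. WL (X j)) \<phi> \<and>
                (\<forall>i\<in>J k. \<forall>j\<in>J k. WL_iso (X i) (X j) (\<phi> i j)) \<longrightarrow>
                config_le (WL (cart_prod (J k) X))
                  (exponentiation (J k) (\<lambda>j. WL (X j)) \<phi> {g. g permutes J k})))"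
proof -
  let ?I = "{1..n}" and ?K = "{1..a}" and ?Y = "\<lambda>k. cart_prod (J k) X"
  let ?R = "{(i, j) \<in> ?I \<times> ?I. WL_equivalent (X i) (X j)}"
  have conn: "conn_graph (X i)" if "i \<in> ?I" for i
    by (rule conn_graphI[OF assms(2)[OF that] assms(3)[OF that]])
  interpret prime_product ?I X
    using conn assms(4,5) by unfold_locales auto
  have R: "equiv ?I ?R"
  proof (rule equivI)
    show "?R \<subseteq> ?I \<times> ?I" by blast
    show "refl_on ?I ?R" using WL_equivalent_refl[OF fin] by (auto intro!: refl_onI)
    show "sym ?R" using WL_equivalent_sym[OF fin fin] by (auto intro!: symI)
    show "trans ?R" using WL_equivalent_trans[OF fin fin fin] by (auto intro!: transI)
  qed
  interpret index_partition ?I ?K J by (rule index_partition_quotient[OF R assms(6)])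
  have JQ: "J k \<in> ?I // ?R" if "k \<in> ?K" for k using assms(6) that unfolding bij_betw_def by blast
  have equivJ: "WL_equivalent (X i) (X j)" if "k \<in> ?K" "i \<in> J k" "j \<in> J k" for i j k
    using quotient_eq_iff[OF R JQ[OF that(1)] JQ[OF that(1)] that(2,3)] by simp
  have closedJ: "j \<in> J k" if k: "k \<in> ?K" "i \<in> J k" and j: "j \<in> ?I" "WL_equivalent (X i) (X j)" for i j k
  proof -
    have "(i, j) \<in> ?R" using k j J_sub by blast
    then show ?thesis using in_quotient_imp_closed[OF R JQ[OF k(1)] k(2)] by blast
  qed
  have finJ: "finite (J k)" "fin_graph (?Y k)" and prodJ: "graph_product (J k) X" if "k \<in> ?K" for k
  proof -
    show f: "finite (J k)" using J_sub[OF that] finite_subset by blast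
    show "fin_graph (?Y k)" using J_sub[OF that] fin by (intro fin_graph_cart_prod[OF f]) blast
    show "graph_product (J k) X" using f conn J_sub[OF that] by unfold_locales auto
  qed
  have inj: "inj_on (regroup ?K J) (pverts W)" unfolding pverts_cart_prod by (rule regroup_inj)
  \<comment> \<open>Regrouping renames the vertices injectively and turns the product into the
    product of the block products, whose directions are the classes.\<close>
  have "map_config (regroup ?K J) (WL W) = WL (cart_prod ?K ?Y)"
    using map_config_WL[OF fin_prod inj] unfolding regroup_image_graph .
  also have "\<dots> = tensor ?K (\<lambda>k. WL (?Y k))"
  proof (rule WL_cart_prod_tensor)
    show "finite ?K" by simp
    fix k assume k: "k \<in> ?K"
    show "fin_graph (?Y k)" by (rule finJ(2)[OF k])
    show "(x, y) \<in> (parcs (?Y k))\<^sup>*" if "x \<in> pverts (?Y k)" "y \<in> pverts (?Y k)" for x y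
      by (rule conn_reach[OF graph_product.conn_prod[OF prodJ[OF k]] that])
    \<comment> \<open>The block is closed under WL-equivalence, so its arcs form a relation of the
      original product; regrouping carries them to direction k of the coarser one.\<close>
    have "(\<Union>i\<in>J k. dir i) \<in> WL_rels W"
      using J_sub[OF k] closedJ[OF k] by (intro class_arcs_rel) blast+
    then show "arcs_in_dir ?K ?Y k \<in> WL_rels (cart_prod ?K ?Y)"
      unfolding regroup_arcs_in_dir[OF k] regroup_image_graph[symmetric] WL_rels_image[OF fin_prod inj]
      by (rule imageI)
  qed
  finally have tens: "map_config (regroup ?K J) (WL W) = tensor ?K (\<lambda>k. WL (?Y k))" .
  have "config_le (WL (?Y k)) (exponentiation (J k) (\<lambda>j. WL (X j)) \<phi> {g. g permutes J k})"
    if k: "k \<in> ?K" and \<phi>: "alg_iso_system (J k) (\<lambda>j. WL (X j)) \<phi>" "\<forall>i\<in>J k. \<forall>j\<in>J k. WL_iso (X i) (X j) (\<phi> i j)"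
    for k \<phi>
    using \<phi> fin J_sub[OF k] permutes_id by (intro WL_le_exponentiation finJ(1)[OF k]) auto
  moreover have "\<exists>\<phi>. alg_iso_system (J k) (\<lambda>j. WL (X j)) \<phi> \<and> (\<forall>i\<in>J k. \<forall>j\<in>J k. WL_iso (X i) (X j) (\<phi> i j))"
    if k: "k \<in> ?K" for k
    using fin J_sub[OF k] equivJ[OF k] by (intro ex_alg_iso_system) blast+
  ultimately show ?thesis using tens by blast
qed

end
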